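(* Let $n,k\ge 1$ be integers and let $q>0$, $q\neq 1$. Put $N=n+k-1$. For a Young diagram $\lambda=(\lambda_1\ge\dots\ge\lambda_n\ge 0)$ with $\lambda_1\le k$, put $a_i=\lambda_i+n-i$ for $i=1,\dots,n$ (so $a_i\in\{0,1,\dots,N\}$). (1) The probability measure $$\mu_{n,k}(\lambda|q)=\frac{q^{\|\lambda\|}\dim_q(V_{GL_n}(\lambda))\cdot q^{\|\bar\lambda'\|}\dim_q(V_{GL_k}(\bar\lambda'))}{\prod_{i=1}^n\prod_{j=1}^k(q^{i-1}+q^{j-1})}$$ on Young diagrams $\lambda$ contained in the $n\times k$ rectangle is a $q$-Krawtchouk polynomial ensemble: for every such $\lambda$, $$\mu_{n,k}(\lambda|q)=\det\left(\sqrt{W(a_i)W(a_j)}\sum_{l=0}^{n-1}\tilde K^q_l(a_i)\,\tilde K^q_l(a_j)\right)_{i,j=1}^n,$$ where $\tilde K^q_l(x)=\tilde K^q_l(q^{-x};p,N;q)$ are the normalized $q$-Krawtchouk polynomials with $p=q^{1-2n}$, and $$W(a)=q^{\binom a2+a(n-k)}\genfrac{[}{]}{0pt}{}{n+k-1}{a}_q .$$ (2) The probability measure $$\mu_{n,k}(\lambda|q,q^{-1})=\frac{q^{\|\lambda\|}\dim_q(V_{GL_n}(\lambda))\cdot q^{-\|\bar\lambda'\|}\dim_{1/q}(V_{GL_k}(\bar\lambda'))}{\prod_{i=1}^n\prod_{j=1}^k(q^{i-1}+q^{1-j})}$$ on Young diagrams contained in the $n\times k$ rectangle is a $q$-Krawtchouk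 polynomial ensemble for the polynomials $\tilde K^q_l(q^{-x};q^{2-2n-k},n+k-1;q)$; that is, for every such $\lambda$ the determinantal formula of part (1) holds for $\mu_{n,k}(\lambda|q,q^{-1})$ with $p=q^{2-2n-k}$, with these polynomials in place of $\tilde K_l^q$, and with their orthogonality weight $\hat W(a)=q^{\binom a2+a(n-1)}\genfrac{[}{]}{0pt}{}{n+k-1}{a}_q$ in place of $W$.
   Context: Diagrams: $\lambda$ runs over Young diagrams with at most $n$ rows and at most $k$ columns. $\bar\lambda$ is the complement of $\lambda$ in the $n\times k$ rectangle, $\bar\lambda_i=k-\lambda_{n+1-i}$, and $\bar\lambda'$ is its conjugate (transposed) diagram, which has at most $k$ rows and at most $n$ columns. For a diagram $\mu$, $\|\mu\|=\sum_{i}(i-1)\mu_i$. $q$-dimension: for the irreducible polynomial representation $V_{GL_m}(\mu)$ of $GL_m$ with highest weight $\mu=(\mu_1\ge\dots\ge\mu_m\ge0)$, $$\dim_q(V_{GL_m}(\mu))=\sum_{(u_1,\dots,u_{m-1})\in\mathbb Z_{\ge0}^{m-1}}q^{\sum_i u_i}\,\dim V_{GL_m}(\mu)_{\mu-\sum_i u_i\alpha_i},$$ where $\alpha_1,\dots,\alpha_{m-1}$ are the simple roots and the subscript denotes the weight subspace. $\dim_{1/q}$ is the same with $q$ replaced by $1/q$. (Equivalently, $q^{\|\mu\|}\dim_q(V_{GL_m}(\mu))=s_\mu(1,q,\dots,q^{m-1})$, a principal specialization of the Schur polynomial.) $q$-numbers: $[m]_q=\frac{1-q^m}{1-q}$,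 $[m]_q!=\prod_{i=1}^m[i]_q$, $\genfrac{[}{]}{0pt}{}{N}{i}_q=\frac{[N]_q!}{[i]_q!\,[N-i]_q!}$. Normalized $q$-Krawtchouk polynomials: $\tilde K^q_j(q^{-x};p,N;q)$, $0\le j\le N$, is a polynomial of degree $j$ in the variable $q^{-x}$, and these satisfy $$\sum_{i=0}^{N}\genfrac{[}{]}{0pt}{}{N}{i}_q p^{-i}q^{\binom i2-iN}\,\tilde K^q_j(q^{-i};p,N;q)\,\tilde K^q_l(q^{-i};p,N;q)=\delta_{jl}$$ (for $p>0$ this determines them up to sign). *)

theory Defs
  imports "HOL-Analysis.Infinite_Sum" "Jordan_Normal_Form.VS_Connect"
    "Jordan_Normal_Form.Determinant"
begin

(* A diagram with at most n rows is the list of its n row lengths, zero rows included;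
   row i (counted from 1) is entry i - 1. *)

definition diagrams :: "nat \<Rightarrow> nat \<Rightarrow> nat list set" where
  "diagrams n k = {lam. length lam = n \<and> sorted_wrt (\<ge>) lam \<and> (\<forall>x\<in>set lam. x \<le> k)}"

definition complement_diagram :: "nat \<Rightarrow> nat list \<Rightarrow> nat list" where
  "complement_diagram k lam = map (\<lambda>i. k - lam ! (length lam - 1 - i)) [0..<length lam]"

definition conjugate_diagram :: "nat \<Rightarrow> nat list \<Rightarrow> nat list" where
  "conjugate_diagram c mu = map (\<lambda>j. card {i. i < length mu \<and> j < mu ! i}) [0..<c]"

definition diagram_norm :: "nat list \<Rightarrow> nat" where
  "diagram_norm mu = (\<Sum>i<length mu. i * mu ! i)"

definition GL :: "nat \<Rightarrow> complex mat set" where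
  "GL m = {A \<in> carrier_mat m m. invertible_mat A}"

inductive polynomial_fun :: "nat \<Rightarrow> (complex mat \<Rightarrow> complex) \<Rightarrow> bool" for m where
  const: "polynomial_fun m (\<lambda>A. c)"
| entry: "i < m \<Longrightarrow> j < m \<Longrightarrow> polynomial_fun m (\<lambda>A. A $$ (i, j))"
| add: "polynomial_fun m f \<Longrightarrow> polynomial_fun m g \<Longrightarrow> polynomial_fun m (\<lambda>A. f A + g A)"
| mult: "polynomial_fun m f \<Longrightarrow> polynomial_fun m g \<Longrightarrow> polynomial_fun m (\<lambda>A. f A * g A)"

(* (d, rho) stands for a homomorphism rho from GL m to GL d acting on complex d-vectors;
   values of rho outside GL m are irrelevant. *)
type_synonym matrix_rep = "nat \<times> (complex mat \<Rightarrow> complex mat)"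

abbreviation rep_space :: "matrix_rep \<Rightarrow> complex vec set" where
  "rep_space R \<equiv> carrier_vec (fst R)"

definition polynomial_rep :: "nat \<Rightarrow> matrix_rep \<Rightarrow> bool" where
  "polynomial_rep m R \<longleftrightarrow>
     (\<forall>A\<in>GL m. snd R A \<in> carrier_mat (fst R) (fst R)) \<and>
     snd R (1\<^sub>m m) = 1\<^sub>m (fst R) \<and>
     (\<forall>A\<in>GL m. \<forall>B\<in>GL m. snd R (A * B) = snd R A * snd R B) \<and>
     (\<forall>r<fst R. \<forall>c<fst R. \<exists>f. polynomial_fun m f \<and> (\<forall>A\<in>GL m. snd R A $$ (r, c) = f A))"

definition irreducible_rep :: "nat \<Rightarrow> matrix_rep \<Rightarrow> bool" where
  "irreducible_rep m R \<longleftrightarrow>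
     fst R > 0 \<and>
     (\<forall>U. VectorSpace.subspace class_ring U (module_vec TYPE(complex) (fst R)) \<and>
          (\<forall>A\<in>GL m. \<forall>v\<in>U. snd R A *\<^sub>v v \<in> U)
          \<longrightarrow> U = {0\<^sub>v (fst R)} \<or> U = rep_space R)"

(* A highest weight vector: an eigenvector of the upper triangular Borel subgroup. *)
definition has_highest_weight :: "nat \<Rightarrow> matrix_rep \<Rightarrow> nat list \<Rightarrow> bool" where
  "has_highest_weight m R mu \<longleftrightarrow>
     (\<exists>v\<in>rep_space R. v \<noteq> 0\<^sub>v (fst R) \<and>
        (\<forall>B\<in>GL m. upper_triangular B \<longrightarrow>
           snd R B *\<^sub>v v = (\<Prod>i<m. (B $$ (i, i)) ^ (mu ! i)) \<cdot>\<^sub>v v))"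

definition is_irrep_GL :: "nat \<Rightarrow> nat list \<Rightarrow> matrix_rep \<Rightarrow> bool" where
  "is_irrep_GL m mu R \<longleftrightarrow>
     polynomial_rep m R \<and> irreducible_rep m R \<and> has_highest_weight m R mu"

definition weight_space :: "nat \<Rightarrow> matrix_rep \<Rightarrow> (nat \<Rightarrow> int) \<Rightarrow> complex vec set" where
  "weight_space m R nu =
     {v \<in> rep_space R. \<forall>T\<in>GL m. diagonal_mat T \<longrightarrow>
        snd R T *\<^sub>v v = (\<Prod>i<m. (T $$ (i, i)) powi (nu i)) \<cdot>\<^sub>v v}"

definition weight_multiplicity :: "nat \<Rightarrow> matrix_rep \<Rightarrow> (nat \<Rightarrow> int) \<Rightarrow> nat" where
  "weight_multiplicity m R nu =
     vectorspace.dim class_ring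
       ((module_vec TYPE(complex) (fst R))\<lparr>carrier := weight_space m R nu\<rparr>)"

definition simple_root :: "nat \<Rightarrow> nat \<Rightarrow> int" where
  "simple_root i j = (if j = i then 1 else if j = Suc i then - 1 else 0)"

definition dim_q :: "nat \<Rightarrow> nat list \<Rightarrow> matrix_rep \<Rightarrow> real \<Rightarrow> real" where
  "dim_q m mu R q =
     (\<Sum>\<^sub>\<infinity>u\<in>{u :: nat list. length u = m - 1}.
        q ^ sum_list u *
        real (weight_multiplicity m R
                (\<lambda>j. int (mu ! j) - (\<Sum>i<m - 1. int (u ! i) * simple_root i j))))"

definition q_number :: "real \<Rightarrow> nat \<Rightarrow> real" where
  "q_number q m = (1 - q ^ m) / (1 - q)"

definition q_fact :: "real \<Rightarrow> nat \<Rightarrow> real" where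
  "q_fact q m = (\<Prod>i=1..m. q_number q i)"

definition q_binomial :: "real \<Rightarrow> nat \<Rightarrow> nat \<Rightarrow> real" where
  "q_binomial q N i = q_fact q N / (q_fact q i * q_fact q (N - i))"

definition normalized_q_Krawtchouk :: "real \<Rightarrow> nat \<Rightarrow> real \<Rightarrow> (nat \<Rightarrow> real poly) \<Rightarrow> bool" where
  "normalized_q_Krawtchouk p N q K \<longleftrightarrow>
     (\<forall>j\<le>N. degree (K j) = j) \<and>
     (\<forall>j\<le>N. \<forall>l\<le>N.
        (\<Sum>i\<le>N. q_binomial q N i * p powi (- int i)
                * q powi (int (i choose 2) - int i * int N)
                * poly (K j) (q powi (- int i)) * poly (K l) (q powi (- int i)))
        = (if j = l then 1 else 0))"

(* V and U choose, for each diagram, a model of the irreducible representation of GL n,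
   resp. GL k, with that highest weight. *)

definition mu_q ::
  "nat \<Rightarrow> nat \<Rightarrow> (nat list \<Rightarrow> matrix_rep) \<Rightarrow> (nat list \<Rightarrow> matrix_rep) \<Rightarrow> real \<Rightarrow> nat list \<Rightarrow> real" where
  "mu_q n k V U q lam =
     (let nu = conjugate_diagram k (complement_diagram k lam) in
       q ^ diagram_norm lam * dim_q n lam (V lam) q *
       (q ^ diagram_norm nu * dim_q k nu (U nu) q) /
       (\<Prod>i=1..n. \<Prod>j=1..k. q ^ (i - 1) + q ^ (j - 1)))"

definition mu_q_inv ::
  "nat \<Rightarrow> nat \<Rightarrow> (nat list \<Rightarrow> matrix_rep) \<Rightarrow> (nat list \<Rightarrow> matrix_rep) \<Rightarrow> real \<Rightarrow> nat list \<Rightarrow> real" where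
  "mu_q_inv n k V U q lam =
     (let nu = conjugate_diagram k (complement_diagram k lam) in
       q ^ diagram_norm lam * dim_q n lam (V lam) q *
       (q powi (- int (diagram_norm nu)) * dim_q k nu (U nu) (1 / q)) /
       (\<Prod>i=1..n. \<Prod>j=1..k. q ^ (i - 1) + q powi (1 - int j)))"

definition is_probability_on :: "'a set \<Rightarrow> ('a \<Rightarrow> real) \<Rightarrow> bool" where
  "is_probability_on S f \<longleftrightarrow> finite S \<and> (\<forall>x\<in>S. f x \<ge> 0) \<and> (\<Sum>x\<in>S. f x) = 1"

definition weight_W :: "nat \<Rightarrow> nat \<Rightarrow> real \<Rightarrow> nat \<Rightarrow> real" where
  "weight_W n k q a =
     q powi (int (a choose 2) + int a * (int n - int k)) * q_binomial q (n + k - 1) a"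

definition weight_W_hat :: "nat \<Rightarrow> nat \<Rightarrow> real \<Rightarrow> nat \<Rightarrow> real" where
  "weight_W_hat n k q a =
     q powi (int (a choose 2) + int a * (int n - 1)) * q_binomial q (n + k - 1) a"

(* The points a_i of a diagram, with i counted from 0. *)
definition particle :: "nat \<Rightarrow> nat list \<Rightarrow> nat \<Rightarrow> nat" where
  "particle n lam i = lam ! i + (n - 1 - i)"

definition ensemble_det ::
  "nat \<Rightarrow> real \<Rightarrow> (nat \<Rightarrow> real) \<Rightarrow> (nat \<Rightarrow> real poly) \<Rightarrow> nat list \<Rightarrow> real" where
  "ensemble_det n q w K lam =
     (let a = particle n lam in
       det (mat n n (\<lambda>(i, j). sqrt (w (a i) * w (a j)) *
         (\<Sum>l<n. poly (K l) (q powi (- int (a i))) * poly (K l) (q powi (- int (a j)))))))"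

end

theory Submission
  imports Defs "Jordan_Normal_Form.Matrix_Kernel"
begin

text \<open>Put \<open>N = n + k - 1\<close>, let \<open>a_i\<close> be the points of \<open>\<lambda>\<close> and \<open>b_j\<close> the points
of the diagram \<open>\<nu>\<close> conjugate to the complement of \<open>\<lambda>\<close>. Three facts together give both parts.

First, \<open>q^||\<lambda>|| dim_q V(\<lambda>)\<close> is the character of \<open>V(\<lambda>)\<close> at \<open>diag(1, q, ..., q^(n-1))\<close>, which
by the Weyl character formula is the Vandermonde product of the \<open>q^(a_i)\<close> divided by that of
\<open>1, q, ..., q^(n-1)\<close>, up to sign (\<open>dim_q_eq_vandermonde\<close>). The same holds for \<open>\<nu>\<close>, with \<open>q\<close> or \<open>1/q\<close>.

Second, the \<open>b_j\<close> are exactly the points of \<open>{0..N}\<close> that are not among the \<open>a_i\<close>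
(\<open>particle_hole_permutes\<close>). Splitting the Vandermonde product of all \<open>q^0, ..., q^N\<close> into
particle-particle, particle-hole and hole-hole pairs expresses the product over the holes as the
product over the particles divided by factors that depend on one particle each
(\<open>vandermonde_holes\<close>). Hence the measure is a constant times the squared Vandermonde product of the
\<open>q^(-a_i)\<close> times \<open>\<Prod> W(a_i)\<close>, and these one-particle factors are the \<open>q\<close>-Krawtchouk weights.

Third, the kernel matrix factors as \<open>M * transpose M\<close>, where row \<open>i\<close> of \<open>M\<close> contains
the values of \<open>n\<close> polynomials of degrees \<open>0, ..., n - 1\<close> at \<open>q^(-a_i)\<close>. Its determinant is therefore
again a constant times that same product. The two constants agree because both sides have total
mass 1: for the measure this is the Laplace expansion of the Vandermonde determinant in the variables
\<open>x_1, ..., x_n, -y_1, ..., -y_k\<close> (\<open>laplace_expansion_rows\<close>, \<open>vandermonde_sum_over_diagrams\<close>), and for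
the determinants it is the Cauchy-Binet formula together with orthonormality
(\<open>cauchy_binet\<close>, \<open>ensemble_det_total\<close>).

The representations are arbitrary irreducible polynomial representations with a given
highest weight, so the Weyl formula is derived from these properties alone.
Matrix entries are polynomials, hence the representation extends to a multiplicative map on all
matrices (\<open>polyext_mult\<close>) and has a derivative at the identity (\<open>lie\<close>), both handled by comparing
coefficients of polynomials in one parameter. The Casimir operator, the sum of all
\<open>lie(E_ij) lie(E_ji)\<close>, commutes with the group and so is a scalar by irreducibility. Its trace against
a torus element is a second order differential equation for the character (\<open>casimir_equation\<close>).
Multiplying the character by the Vandermonde alternant turns this into the statement that all
exponents of the product lie on one sphere (\<open>laplace_eigenfunction\<close>). The product is antisymmetric,
and all weights are dominated by the highest one (\<open>wts_dominated\<close>), which occurs once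
(\<open>wmult_top_weight\<close>); so only the permutations of the shifted highest weight survive
(\<open>acoeff_support\<close>), which is the Weyl formula.\<close>

section \<open>Vandermonde determinants and decreasing enumerations\<close>

definition vandermonde :: "nat \<Rightarrow> (nat \<Rightarrow> 'a) \<Rightarrow> 'a::comm_ring_1" where
  "vandermonde n x = (\<Prod>j<n. \<Prod>l<j. x j - x l)"

text \<open>Writing each polynomial in monomials factors the matrix into the matrix of powers and a
coefficient matrix, which is upper triangular by the degree bound.\<close>

lemma det_poly_eval:
  fixes P :: "nat \<Rightarrow> 'a::idom poly"
  assumes deg: "\<And>j. j < n \<Longrightarrow> degree (P j) \<le> j"
  shows "det (mat n n (\<lambda>(i, j). poly (P j) (x i))) =
    det (mat n n (\<lambda>(i, j). x i ^ j)) * (\<Prod>j<n. coeff (P j) j)"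
proof -
  let ?A = "mat n n (\<lambda>(i, j). x i ^ j)"
  let ?C = "mat n n (\<lambda>(l, j). coeff (P j) l)"
  have "mat n n (\<lambda>(i, j). poly (P j) (x i)) = ?A * ?C"
  proof (rule eq_matI)
    fix i j assume ij: "i < dim_row (?A * ?C)" "j < dim_col (?A * ?C)"
    then have i: "i < n" and j: "j < n" by auto
    have "poly (P j) (x i) = (\<Sum>l\<le>degree (P j). coeff (P j) l * x i ^ l)"
      by (rule poly_altdef)
    also have "\<dots> = (\<Sum>l<n. coeff (P j) l * x i ^ l)"
      using deg[OF j] j by (intro sum.mono_neutral_left) (auto simp: coeff_eq_0)
    finally show "mat n n (\<lambda>(i, j). poly (P j) (x i)) $$ (i, j) = (?A * ?C) $$ (i, j)"
      using i j by (simp add: scalar_prod_def atLeast0LessThan mult.commute)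
  qed auto
  moreover have "det ?C = (\<Prod>j<n. coeff (P j) j)"
  proof -
    have "upper_triangular ?C"
      unfolding upper_triangular_def using le_less_trans[OF deg] by (auto intro!: coeff_eq_0)
    then have "det ?C = prod_list (diag_mat ?C)" by (intro det_upper_triangular) auto
    also have "\<dots> = (\<Prod>j<n. coeff (P j) j)"
      by (auto simp: prod_list_diag_prod atLeast0LessThan intro!: prod.cong)
    finally show ?thesis .
  qed
  ultimately show ?thesis using det_mult[of ?A n ?C] by simp
qed

text \<open>The Newton polynomials \<open>\<Prod>l<j. X - x l\<close> are monic of degree \<open>j\<close>, so
they can replace the powers \<open>X ^ j\<close> in the determinant; evaluated at the \<open>x i\<close> they
give a lower triangular matrix.\<close>

lemma det_vandermonde:
  fixes x :: "nat \<Rightarrow> 'a::idom"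
  shows "det (mat n n (\<lambda>(i, j). x i ^ j)) = vandermonde n x"
proof -
  define P where "P = (\<lambda>j. \<Prod>l<j. [:- x l, 1:])"
  have lead: "degree (P j) = j \<and> lead_coeff (P j) = 1" for j
  proof (induction j)
    case (Suc j)
    have d: "degree (P j) = j" "coeff (P j) j = 1" using Suc by auto
    have "P (Suc j) = P j * [:- x j, 1:]" unfolding P_def by (simp only: prod.lessThan_Suc)
    moreover have "P j \<noteq> 0" using Suc by (metis leading_coeff_0_iff zero_neq_one)
    ultimately show ?case using d degree_mult_eq[of "P j" "[:- x j, 1:]"] lead_coeff_mult[of "P j" "[:- x j, 1:]"]
      by (simp del: mult_pCons_right mult_pCons_left)
  qed (simp add: P_def)
  have ev: "poly (P j) (x i) = (\<Prod>l<j. x i - x l)" for i j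
    by (simp add: P_def poly_prod)
  let ?M = "mat n n (\<lambda>(i, j). poly (P j) (x i))"
  have "det ?M = det (mat n n (\<lambda>(i, j). x i ^ j)) * (\<Prod>j<n. coeff (P j) j)"
    by (rule det_poly_eval) (simp add: lead)
  moreover have "(\<Prod>j<n. coeff (P j) j) = 1" using lead by (intro prod.neutral) metis
  moreover have "det ?M = prod_list (diag_mat ?M)"
  proof (rule det_lower_triangular[of n])
    fix i j assume "i < j" "j < n"
    then show "?M $$ (i, j) = 0" by (auto simp: ev)
  qed auto
  moreover have "prod_list (diag_mat ?M) = vandermonde n x"
    by (auto simp: prod_list_diag_prod atLeast0LessThan vandermonde_def ev intro!: prod.cong)
  ultimately show ?thesis by simp
qed

lemma det_vandermonde_transpose:
  fixes x :: "nat \<Rightarrow> 'a::idom"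
  shows "det (mat n n (\<lambda>(i, j). x j ^ i)) = vandermonde n x"
proof -
  have "mat n n (\<lambda>(i, j). x j ^ i) = transpose_mat (mat n n (\<lambda>(i, j). x i ^ j))"
    by (rule eq_matI) auto
  then show ?thesis using det_transpose[of "mat n n (\<lambda>(i, j). x i ^ j)" n] det_vandermonde by simp
qed

lemma vandermonde_permute:
  fixes x :: "nat \<Rightarrow> 'a::idom"
  assumes "p permutes {0..<n}"
  shows "vandermonde n (\<lambda>i. x (p i)) = signof p * vandermonde n x"
proof -
  have "mat n n (\<lambda>(i, j). x (p i) ^ j) = mat n n (\<lambda>(i, j). mat n n (\<lambda>(i, j). x i ^ j) $$ (p i, j))"
    using permutes_in_image[OF assms] by (intro eq_matI) auto
  then show ?thesis
    using det_permute_rows[OF _ assms, of "mat n n (\<lambda>(i, j). x i ^ j)"]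
      det_vandermonde[of n "\<lambda>i. x (p i)"] by (simp add: det_vandermonde)
qed

text \<open>Distinct values can be put in decreasing order. Decreasing functions on \<open>{0..<n}\<close>
play two roles: they are the point configurations of diagrams, and they represent the orbits of exponents
under permutations.\<close>

lemma sort_decreasing:
  fixes f :: "nat \<Rightarrow> nat"
  assumes "inj_on f {0..<n}"
  obtains p where "p permutes {0..<n}" "strict_antimono_on {0..<n} (f \<circ> p)"
proof -
  define xs where "xs = rev (sorted_list_of_set (f ` {0..<n}))"
  have len: "length xs = n" unfolding xs_def using card_image[OF assms] by simp
  have set: "set xs = f ` {0..<n}" by (simp add: xs_def)
  have dec: "sorted_wrt (>) xs"
    unfolding xs_def using strict_sorted_list_of_set[of "f ` {0..<n}"]
    by (simp add: sorted_wrt_rev)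
  have dist: "distinct xs" by (simp add: xs_def)
  define p where "p = (\<lambda>i. if i < n then the_inv_into {0..<n} f (xs ! i) else i)"
  have xsin: "xs ! i \<in> f ` {0..<n}" if "i < n" for i using that len set nth_mem by metis
  have fp: "f (p i) = xs ! i" if "i < n" for i
    using that f_the_inv_into_f[OF assms xsin[OF that]] by (simp add: p_def)
  have pin: "p i \<in> {0..<n}" if "i < n" for i
    using that the_inv_into_into[OF assms xsin[OF that] order_refl] by (simp add: p_def)
  have "inj_on p {0..<n}"
  proof (rule inj_onI)
    fix i j assume "i \<in> {0..<n}" "j \<in> {0..<n}" "p i = p j"
    then have "xs ! i = xs ! j" using fp by (metis atLeastLessThan_iff)
    then show "i = j" using dist len \<open>i \<in> {0..<n}\<close> \<open>j \<in> {0..<n}\<close> nth_eq_iff_index_eq by fastforce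
  qed
  then have "bij_betw p {0..<n} {0..<n}"
    using pin by (intro bij_betw_imageI endo_inj_surj) auto
  then have "p permutes {0..<n}" by (intro bij_imp_permutes) (auto simp: p_def)
  moreover have "strict_antimono_on {0..<n} (f \<circ> p)"
    using dec len by (auto simp: monotone_on_def fp sorted_wrt_iff_nth_less)
  ultimately show ?thesis by (rule that)
qed

lemma decreasing_unique:
  fixes f g :: "nat \<Rightarrow> nat"
  assumes "strict_antimono_on {0..<n} f" "strict_antimono_on {0..<n} g"
    and "f ` {0..<n} = g ` {0..<n}" and "i < n"
  shows "f i = g i"
proof -
  have sr: "sorted_wrt (<) (rev (map h [0..<n]))" if "strict_antimono_on {0..<n} h" for h :: "nat \<Rightarrow> nat"
    using that by (auto simp: monotone_on_def sorted_wrt_iff_nth_less rev_nth)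
  have "rev (map f [0..<n]) = rev (map g [0..<n])"
    using assms by (intro strict_sorted_equal[OF sr sr]) auto
  then show ?thesis using \<open>i < n\<close> by simp
qed

lemma strict_antimono_inj:
  fixes f :: "nat \<Rightarrow> nat"
  shows "strict_antimono_on {0..<n} f \<Longrightarrow> inj_on f {0..<n}"
  unfolding monotone_on_def inj_on_def by (metis less_irrefl linorder_neqE_nat)

section \<open>Polynomial functions on matrices\<close>

definition exponents :: "nat \<Rightarrow> (nat \<Rightarrow> nat) set" where
  "exponents m = {\<nu>. \<forall>i\<ge>m. \<nu> i = 0}"

definition tpow :: "nat \<Rightarrow> (nat \<Rightarrow> 'a) \<Rightarrow> (nat \<Rightarrow> nat) \<Rightarrow> 'a::comm_semiring_1" where
  "tpow m t \<nu> = (\<Prod>i<m. t i ^ \<nu> i)"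

lemma exponents_eqI:
  "\<nu> \<in> exponents m \<Longrightarrow> \<kappa> \<in> exponents m \<Longrightarrow> (\<And>i. i < m \<Longrightarrow> \<nu> i = \<kappa> i) \<Longrightarrow> \<nu> = \<kappa>"
  by (rule ext) (metis (mono_tags, lifting) exponents_def mem_Collect_eq not_le)

lemma tpow_add: "tpow m t (\<lambda>i. \<nu> i + \<kappa> i) = tpow m t \<nu> * tpow m t \<kappa>"
  by (simp add: tpow_def power_add prod.distrib)

lemma tpow_mult: "tpow m (\<lambda>i. t i * s i) \<nu> = tpow m t \<nu> * tpow m s \<nu>"
  by (simp add: tpow_def power_mult_distrib prod.distrib)

lemma tpow_one [simp]: "tpow m (\<lambda>i. 1) \<nu> = 1"
  by (simp add: tpow_def)

lemma tpow_zero [simp]: "tpow m t (\<lambda>i. 0) = 1"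
  by (simp add: tpow_def)

text \<open>Uniqueness of base \<open>B\<close> digits, the combinatorial part of Kronecker's substitution
below.\<close>

lemma digits_unique:
  fixes \<nu> \<kappa> :: "nat \<Rightarrow> nat"
  assumes "\<And>i. i < m \<Longrightarrow> \<nu> i < B" "\<And>i. i < m \<Longrightarrow> \<kappa> i < B"
    and "(\<Sum>i<m. \<nu> i * B ^ i) = (\<Sum>i<m. \<kappa> i * B ^ i)"
  shows "i < m \<Longrightarrow> \<nu> i = \<kappa> i"
  using assms
proof (induction m arbitrary: \<nu> \<kappa> i)
  case (Suc m)
  have split: "(\<Sum>i<Suc m. f i * B ^ i) = f 0 + B * (\<Sum>i<m. f (Suc i) * B ^ i)" for f :: "nat \<Rightarrow> nat"
    by (simp add: sum.lessThan_Suc_shift sum_distrib_left mult_ac del: sum.lessThan_Suc)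
  have eq: "\<nu> 0 + B * (\<Sum>i<m. \<nu> (Suc i) * B ^ i) = \<kappa> 0 + B * (\<Sum>i<m. \<kappa> (Suc i) * B ^ i)"
    using Suc.prems(4) unfolding split .
  have lt: "\<nu> 0 < B" "\<kappa> 0 < B" using Suc.prems by auto
  then have "\<nu> 0 = \<kappa> 0"
    using arg_cong[OF eq, of "\<lambda>x. x mod B"] by simp
  moreover from this have "(\<Sum>i<m. \<nu> (Suc i) * B ^ i) = (\<Sum>i<m. \<kappa> (Suc i) * B ^ i)"
    using eq lt by simp
  then have "\<nu> (Suc j) = \<kappa> (Suc j)" if "j < m" for j
    using Suc.IH[of j "\<lambda>i. \<nu> (Suc i)" "\<lambda>i. \<kappa> (Suc i)"] Suc.prems that by simp
  ultimately show ?case using Suc.prems(1) by (cases i) auto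
qed simp

lemma poly_eq_if_agree:
  fixes p q :: "'a::idom poly"
  assumes "infinite {s. poly p s = poly q s}"
  shows "p = q"
proof (rule ccontr)
  assume "p \<noteq> q"
  then have "finite {s. poly (p - q) s = 0}" by (intro poly_roots_finite) simp
  then show False using assms by simp
qed

text \<open>Kronecker's substitution \<open>t i = s ^ (B ^ i)\<close>, with \<open>B\<close> larger than all
exponents, turns distinct monomials into distinct powers of a single variable. For \<open>s = 2, 3,
...\<close> the substituted points are nonzero and pairwise different, so it is enough to know the vanishing
at such points; the radial equation below is available only there, because it divides by the differences
\<open>t i - t j\<close>.\<close>

lemma monomials_independent:
  fixes c :: "(nat \<Rightarrow> nat) \<Rightarrow> complex"
  assumes fin: "finite S" and S: "S \<subseteq> exponents m"
    and van: "\<And>t. (\<And>i. i < m \<Longrightarrow> t i \<noteq> 0) \<Longrightarrow> inj_on t {..<m} \<Longrightarrow> (\<Sum>\<nu>\<in>S. c \<nu> * tpow m t \<nu>) = 0"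
    and \<nu>: "\<nu> \<in> S"
  shows "c \<nu> = 0"
proof -
  define B where "B = 2 + (\<Sum>\<nu>\<in>S. \<Sum>i<m. \<nu> i)"
  define h where "h = (\<lambda>\<nu>::nat \<Rightarrow> nat. \<Sum>i<m. \<nu> i * B ^ i)"
  have B: "\<kappa> i < B" if "\<kappa> \<in> S" "i < m" for \<kappa> i
  proof -
    have "\<kappa> i \<le> (\<Sum>i<m. \<kappa> i)" using that by (intro member_le_sum) auto
    also have "\<dots> \<le> (\<Sum>\<nu>\<in>S. \<Sum>i<m. \<nu> i)" using that fin by (intro member_le_sum) auto
    finally show ?thesis by (simp add: B_def)
  qed
  have inj: "\<kappa> = \<nu>" if "\<kappa> \<in> S" "h \<kappa> = h \<nu>" for \<kappa>
  proof (rule exponents_eqI[of _ m])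
    show "\<kappa> \<in> exponents m" "\<nu> \<in> exponents m" using that(1) S \<nu> by auto
    show "\<kappa> i = \<nu> i" if "i < m" for i
      using digits_unique[of m \<kappa> B \<nu> i] B[OF \<open>\<kappa> \<in> S\<close>] B[OF \<nu>] \<open>h \<kappa> = h \<nu>\<close> that by (simp add: h_def)
  qed
  define P where "P = (\<Sum>\<kappa>\<in>S. monom (c \<kappa>) (h \<kappa>))"
  have root: "poly P (of_nat (k + 2)) = 0" for k
  proof -
    define s :: complex where "s = of_nat (k + 2)"
    have "(\<Sum>\<kappa>\<in>S. c \<kappa> * tpow m (\<lambda>i. s ^ B ^ i) \<kappa>) = 0"
    proof (rule van)
      have "s \<noteq> 0" unfolding s_def of_nat_eq_0_iff by simp
      then show "s ^ B ^ i \<noteq> 0" for i by simp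
    next
      show "inj_on (\<lambda>i. s ^ B ^ i) {..<m}"
      proof (rule inj_onI)
        fix i j assume "s ^ B ^ i = s ^ B ^ j"
        then have "(k + 2) ^ B ^ i = (k + 2) ^ B ^ j"
          unfolding s_def by (simp only: of_nat_power[symmetric] of_nat_eq_iff)
        then have "B ^ i = B ^ j" by (rule power_inject_exp[THEN iffD1, rotated]) simp
        then show "i = j" by (rule power_inject_exp[THEN iffD1, rotated]) (simp add: B_def)
      qed
    qed
    moreover have "tpow m (\<lambda>i. s ^ B ^ i) \<kappa> = s ^ h \<kappa>" for \<kappa>
      by (simp add: tpow_def h_def power_sum power_mult[symmetric] mult.commute)
    ultimately show ?thesis by (simp add: P_def poly_sum poly_monom s_def)
  qed
  have "P = 0"
  proof (rule poly_eq_if_agree)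
    have "infinite (range (\<lambda>k. of_nat (k + 2) :: complex))"
      by (rule range_inj_infinite) (auto simp: inj_on_def)
    moreover have "range (\<lambda>k. of_nat (k + 2)) \<subseteq> {s. poly P s = poly 0 s}" using root by auto
    ultimately show "infinite {s. poly P s = poly 0 s}" using infinite_super by blast
  qed
  then have "0 = coeff P (h \<nu>)" by simp
  also have "\<dots> = (\<Sum>\<kappa>\<in>S. if \<kappa> = \<nu> then c \<kappa> else 0)"
    unfolding P_def coeff_sum by (intro sum.cong) (auto dest: inj)
  also have "\<dots> = c \<nu>" using fin \<nu> by simp
  finally show ?thesis by simp
qed

lemma polynomial_fun_sum:
  "(\<And>x. x \<in> X \<Longrightarrow> polynomial_fun m (f x)) \<Longrightarrow> polynomial_fun m (\<lambda>A. \<Sum>x\<in>X. f x A)"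
proof (induction X rule: infinite_finite_induct)
  case (insert x F)
  then show ?case using polynomial_fun.add[of m "f x" "\<lambda>A. \<Sum>x\<in>F. f x A"] by simp
qed (simp_all add: polynomial_fun.const)

lemma polynomial_fun_prod:
  "(\<And>x. x \<in> X \<Longrightarrow> polynomial_fun m (f x)) \<Longrightarrow> polynomial_fun m (\<lambda>A. \<Prod>x\<in>X. f x A)"
proof (induction X rule: infinite_finite_induct)
  case (insert x F)
  then show ?case using polynomial_fun.mult[of m "f x" "\<lambda>A. \<Prod>x\<in>F. f x A"] by simp
qed (simp_all add: polynomial_fun.const)

lemma polynomial_fun_det:
  obtains f where "polynomial_fun m f" "\<And>A. A \<in> carrier_mat m m \<Longrightarrow> f A = det A"
proof -
  let ?f = "\<lambda>A. \<Sum>p | p permutes {0..<m}. signof p * (\<Prod>i = 0..<m. A $$ (i, p i))"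
  have "polynomial_fun m ?f"
    by (intro polynomial_fun_sum polynomial_fun.mult polynomial_fun.const polynomial_fun_prod polynomial_fun.entry)
      (auto simp: permutes_in_image)
  then show ?thesis by (rule that) (rule det_def'[symmetric])
qed

lemma polynomial_fun_on_curve:
  assumes "polynomial_fun m f" and A: "\<And>i j. i < m \<Longrightarrow> j < m \<Longrightarrow> \<exists>p. \<forall>s. A s $$ (i, j) = poly p s"
  shows "\<exists>p. \<forall>s. f (A s) = poly p s"
  using assms(1)
proof induction
  case (const c)
  then show ?case by (intro exI[of _ "[:c:]"]) simp
next
  case (entry i j)
  then show ?case using A by blast
next
  case (add f g)
  then obtain p q where "\<forall>s. f (A s) = poly p s" "\<forall>s. g (A s) = poly q s" by blast
  then show ?case by (intro exI[of _ "p + q"]) simp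
next
  case (mult f g)
  then obtain p q where "\<forall>s. f (A s) = poly p s" "\<forall>s. g (A s) = poly q s" by blast
  then show ?case by (intro exI[of _ "p * q"]) simp
qed

text \<open>The numbers \<open>c i j\<close> are the partial derivatives at the identity. The derivative along
\<open>X\<close> appears as the coefficient of \<open>s\<close> in a polynomial, so that the product rule is
the formula for the coefficients of a product.\<close>

lemma polynomial_fun_first_order:
  assumes "polynomial_fun m f"
  shows "\<exists>c. \<forall>X\<in>carrier_mat m m. \<exists>p. (\<forall>s. f (1\<^sub>m m + s \<cdot>\<^sub>m X) = poly p s) \<and>
    coeff p 1 = (\<Sum>i<m. \<Sum>j<m. c i j * X $$ (i, j))"
  using assms
proof induction
  case (const c)
  show ?case by (intro exI[of _ "\<lambda>i j. 0"] ballI exI[of _ "[:c:]"]) simp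
next
  case (entry i j)
  show ?case
  proof (intro exI[of _ "\<lambda>a b. if a = i \<and> b = j then 1 else 0"] ballI)
    fix X :: "complex mat" assume X: "X \<in> carrier_mat m m"
    have "(\<Sum>a<m. \<Sum>b<m. (if a = i \<and> b = j then 1 else 0) * X $$ (a, b)) =
        (\<Sum>a<m. if a = i then \<Sum>b<m. if b = j then X $$ (a, b) else 0 else 0)"
      by (intro sum.cong refl) (auto intro!: sum.cong simp del: sum.delta sum.delta')
    also have "\<dots> = X $$ (i, j)"
      using entry by (simp only: sum.delta finite_lessThan lessThan_iff if_True)
    finally show "\<exists>p. (\<forall>s. (1\<^sub>m m + s \<cdot>\<^sub>m X) $$ (i, j) = poly p s) \<and>
        coeff p 1 = (\<Sum>a<m. \<Sum>b<m. (if a = i \<and> b = j then 1 else 0) * X $$ (a, b))"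
      using entry X by (intro exI[of _ "[:if i = j then 1 else 0, X $$ (i, j):]"]) (simp add: mult.commute)
  qed
next
  case (add f g)
  then obtain c e where
    c: "\<forall>X\<in>carrier_mat m m. \<exists>p. (\<forall>s. f (1\<^sub>m m + s \<cdot>\<^sub>m X) = poly p s) \<and> coeff p 1 = (\<Sum>i<m. \<Sum>j<m. c i j * X $$ (i, j))" and
    e: "\<forall>X\<in>carrier_mat m m. \<exists>p. (\<forall>s. g (1\<^sub>m m + s \<cdot>\<^sub>m X) = poly p s) \<and> coeff p 1 = (\<Sum>i<m. \<Sum>j<m. e i j * X $$ (i, j))"
    by blast
  show ?case
  proof (intro exI[of _ "\<lambda>i j. c i j + e i j"] ballI)
    fix X :: "complex mat" assume "X \<in> carrier_mat m m"
    then obtain p q where "\<forall>s. f (1\<^sub>m m + s \<cdot>\<^sub>m X) = poly p s" "coeff p 1 = (\<Sum>i<m. \<Sum>j<m. c i j * X $$ (i, j))"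
      "\<forall>s. g (1\<^sub>m m + s \<cdot>\<^sub>m X) = poly q s" "coeff q 1 = (\<Sum>i<m. \<Sum>j<m. e i j * X $$ (i, j))"
      using c e by meson
    then show "\<exists>p. (\<forall>s. f (1\<^sub>m m + s \<cdot>\<^sub>m X) + g (1\<^sub>m m + s \<cdot>\<^sub>m X) = poly p s) \<and>
        coeff p 1 = (\<Sum>i<m. \<Sum>j<m. (c i j + e i j) * X $$ (i, j))"
      by (intro exI[of _ "p + q"]) (simp add: sum.distrib distrib_right)
  qed
next
  case (mult f g)
  then obtain c e where
    c: "\<forall>X\<in>carrier_mat m m. \<exists>p. (\<forall>s. f (1\<^sub>m m + s \<cdot>\<^sub>m X) = poly p s) \<and> coeff p 1 = (\<Sum>i<m. \<Sum>j<m. c i j * X $$ (i, j))" and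
    e: "\<forall>X\<in>carrier_mat m m. \<exists>p. (\<forall>s. g (1\<^sub>m m + s \<cdot>\<^sub>m X) = poly p s) \<and> coeff p 1 = (\<Sum>i<m. \<Sum>j<m. e i j * X $$ (i, j))"
    by blast
  show ?case
  proof (intro exI[of _ "\<lambda>i j. c i j * g (1\<^sub>m m) + f (1\<^sub>m m) * e i j"] ballI)
    fix X :: "complex mat" assume X: "X \<in> carrier_mat m m"
    then obtain p q where pq: "\<forall>s. f (1\<^sub>m m + s \<cdot>\<^sub>m X) = poly p s" "coeff p 1 = (\<Sum>i<m. \<Sum>j<m. c i j * X $$ (i, j))"
      "\<forall>s. g (1\<^sub>m m + s \<cdot>\<^sub>m X) = poly q s" "coeff q 1 = (\<Sum>i<m. \<Sum>j<m. e i j * X $$ (i, j))"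
      using c e by meson
    have z: "1\<^sub>m m + 0 \<cdot>\<^sub>m X = 1\<^sub>m m" using X by (intro eq_matI) auto
    have "coeff p 0 = f (1\<^sub>m m)" "coeff q 0 = g (1\<^sub>m m)"
      using pq(1)[rule_format, of 0] pq(3)[rule_format, of 0] unfolding z by (auto simp: poly_0_coeff_0)
    moreover have "coeff (p * q) 1 = coeff p 0 * coeff q 1 + coeff p 1 * coeff q 0"
      by (simp add: coeff_mult)
    ultimately show "\<exists>p. (\<forall>s. f (1\<^sub>m m + s \<cdot>\<^sub>m X) * g (1\<^sub>m m + s \<cdot>\<^sub>m X) = poly p s) \<and>
        coeff p 1 = (\<Sum>i<m. \<Sum>j<m. (c i j * g (1\<^sub>m m) + f (1\<^sub>m m) * e i j) * X $$ (i, j))"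
      using pq by (intro exI[of _ "p * q"])
        (simp add: sum.distrib sum_distrib_left sum_distrib_right algebra_simps)
  qed
qed

text \<open>Restricted to diagonal matrices, a matrix entry is zero or a coordinate of the torus; in a product
the pairs of monomials are collected by their total exponent.\<close>

lemma polynomial_fun_on_torus:
  assumes "polynomial_fun m f"
  shows "\<exists>S c. finite S \<and> S \<subseteq> exponents m \<and> (\<forall>t. f (mat_diag m t) = (\<Sum>\<nu>\<in>S. c \<nu> * tpow m t \<nu>))"
  using assms
proof induction
  case (const c)
  show ?case by (intro exI[of _ "{\<lambda>i. 0}"] exI[of _ "\<lambda>_. c"]) (auto simp: exponents_def)
next
  case (entry i j)
  show ?case
  proof (cases "i = j")
    case True
    have "tpow m t (\<lambda>a. if a = i then 1 else 0) = t i" for t :: "nat \<Rightarrow> complex"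
    proof -
      have "tpow m t (\<lambda>a. if a = i then 1 else 0) = (\<Prod>a<m. if a = i then t a else 1)"
        unfolding tpow_def by (intro prod.cong) auto
      then show ?thesis using entry by simp
    qed
    then show ?thesis using True entry
      by (intro exI[of _ "{\<lambda>a. if a = i then 1 else 0}"] exI[of _ "\<lambda>_. 1"])
        (auto simp: exponents_def mat_diag_def)
  next
    case False
    then show ?thesis using entry by (intro exI[of _ "{}"]) (auto simp: mat_diag_def)
  qed
next
  case (add f g)
  obtain S c where S: "finite S" "S \<subseteq> exponents m" "\<forall>t. f (mat_diag m t) = (\<Sum>\<nu>\<in>S. c \<nu> * tpow m t \<nu>)"
    using add.IH(1) by blast
  obtain T e where T: "finite T" "T \<subseteq> exponents m" "\<forall>t. g (mat_diag m t) = (\<Sum>\<nu>\<in>T. e \<nu> * tpow m t \<nu>)"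
    using add.IH(2) by blast
  define c' where "c' = (\<lambda>\<nu>. (if \<nu> \<in> S then c \<nu> else 0) + (if \<nu> \<in> T then e \<nu> else 0))"
  have "f (mat_diag m t) + g (mat_diag m t) = (\<Sum>\<nu>\<in>S \<union> T. c' \<nu> * tpow m t \<nu>)" for t
  proof -
    have "(\<Sum>\<nu>\<in>S. c \<nu> * tpow m t \<nu>) = (\<Sum>\<nu>\<in>S \<union> T. (if \<nu> \<in> S then c \<nu> else 0) * tpow m t \<nu>)"
      using S(1) T(1) by (intro sum.mono_neutral_cong_left) auto
    moreover have "(\<Sum>\<nu>\<in>T. e \<nu> * tpow m t \<nu>) = (\<Sum>\<nu>\<in>S \<union> T. (if \<nu> \<in> T then e \<nu> else 0) * tpow m t \<nu>)"
      using S(1) T(1) by (intro sum.mono_neutral_cong_left) auto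
    ultimately show ?thesis unfolding S(3)[rule_format] T(3)[rule_format] c'_def distrib_right sum.distrib by simp
  qed
  then show ?case using S T by (intro exI[of _ "S \<union> T"] exI[of _ c']) auto
next
  case (mult f g)
  obtain S c where S: "finite S" "S \<subseteq> exponents m" "\<forall>t. f (mat_diag m t) = (\<Sum>\<nu>\<in>S. c \<nu> * tpow m t \<nu>)"
    using mult.IH(1) by blast
  obtain T e where T: "finite T" "T \<subseteq> exponents m" "\<forall>t. g (mat_diag m t) = (\<Sum>\<nu>\<in>T. e \<nu> * tpow m t \<nu>)"
    using mult.IH(2) by blast
  define h where "h = (\<lambda>(\<nu> :: nat \<Rightarrow> nat, \<kappa>). (\<lambda>i. \<nu> i + \<kappa> i :: nat))"
  define U where "U = h ` (S \<times> T)"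
  define c' where "c' = (\<lambda>\<eta>. \<Sum>x\<in>{x \<in> S \<times> T. h x = \<eta>}. c (fst x) * e (snd x))"
  have "f (mat_diag m t) * g (mat_diag m t) = (\<Sum>\<eta>\<in>U. c' \<eta> * tpow m t \<eta>)" for t
  proof -
    have "(\<Sum>\<eta>\<in>U. c' \<eta> * tpow m t \<eta>) =
        (\<Sum>\<eta>\<in>U. \<Sum>x\<in>{x \<in> S \<times> T. h x = \<eta>}. c (fst x) * e (snd x) * tpow m t (h x))"
      unfolding c'_def sum_distrib_right by (intro sum.cong refl) auto
    also have "\<dots> = (\<Sum>x\<in>S \<times> T. c (fst x) * e (snd x) * tpow m t (h x))"
      using S(1) T(1) by (intro sum.group) (auto simp: U_def)
    also have "\<dots> = (\<Sum>(\<nu>, \<kappa>)\<in>S \<times> T. (c \<nu> * tpow m t \<nu>) * (e \<kappa> * tpow m t \<kappa>))"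
      by (intro sum.cong refl) (auto simp: h_def tpow_add)
    also have "\<dots> = f (mat_diag m t) * g (mat_diag m t)"
      unfolding S(3)[rule_format] T(3)[rule_format] by (simp add: sum_product sum.cartesian_product)
    finally show ?thesis by simp
  qed
  moreover have "U \<subseteq> exponents m" using S(2) T(2) by (auto simp: U_def h_def exponents_def)
  ultimately show ?case using S T by (intro exI[of _ U] exI[of _ c']) (auto simp: U_def)
qed

lemma GL_iff_det: "A \<in> GL m \<longleftrightarrow> A \<in> carrier_mat m m \<and> det A \<noteq> 0"
proof (intro iffI conjI)
  assume A: "A \<in> GL m"
  then show c: "A \<in> carrier_mat m m" by (simp add: GL_def)
  from A obtain B where B: "A * B = 1\<^sub>m (dim_row A)" "B * A = 1\<^sub>m (dim_row B)"
    by (auto simp: GL_def invertible_mat_def inverts_mat_def)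
  then have "B \<in> carrier_mat m m" using c
    by (metis carrier_matD carrier_matI index_mult_mat(3) index_one_mat(3) index_mult_mat(2) index_one_mat(2))
  then have "det A * det B = 1" using det_mult[OF c, of B] B(1) c by simp
  then show "det A \<noteq> 0" by auto
next
  assume A: "A \<in> carrier_mat m m \<and> det A \<noteq> 0"
  let ?B = "inverse (det A) \<cdot>\<^sub>m adj_mat A"
  have c: "A \<in> carrier_mat m m" "adj_mat A \<in> carrier_mat m m" using A adj_mat(1) by auto
  have "A * ?B = 1\<^sub>m m" "?B * A = 1\<^sub>m m"
    using A adj_mat(2,3)[of A m] mult_smult_distrib[OF c] mult_smult_assoc_mat[OF c(2) c(1)] by auto
  then show "A \<in> GL m" using c
    by (auto simp: GL_def invertible_mat_def inverts_mat_def intro!: exI[of _ ?B])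
qed

lemma GL_carrier: "A \<in> GL m \<Longrightarrow> A \<in> carrier_mat m m"
  by (simp add: GL_def)

lemma GL_mult: "A \<in> GL m \<Longrightarrow> B \<in> GL m \<Longrightarrow> A * B \<in> GL m"
  by (auto simp: GL_iff_det det_mult)

lemma GL_one: "1\<^sub>m m \<in> GL m"
  by (simp add: GL_iff_det)

lemma GL_inverse:
  assumes "A \<in> GL m"
  obtains B where "B \<in> GL m" "A * B = 1\<^sub>m m" "B * A = 1\<^sub>m m"
proof -
  have c: "A \<in> carrier_mat m m" using assms by (rule GL_carrier)
  from assms obtain B where B: "A * B = 1\<^sub>m (dim_row A)" "B * A = 1\<^sub>m (dim_row B)"
    by (auto simp: GL_def invertible_mat_def inverts_mat_def)
  then have Bc: "B \<in> carrier_mat m m" using c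
    by (metis carrier_matD carrier_matI index_mult_mat(3) index_one_mat(3) index_mult_mat(2) index_one_mat(2))
  then have "A * B = 1\<^sub>m m" "B * A = 1\<^sub>m m" using B c by auto
  moreover from this have "B \<in> GL m"
    using Bc c by (auto simp: GL_def invertible_mat_def inverts_mat_def)
  ultimately show ?thesis using that by blast
qed

text \<open>The line through \<open>A\<close> at parameter 0 and the identity at parameter 1. It carries
polynomial identities from invertible matrices, or from matrices close to the identity, to all
matrices.\<close>

definition line_to_one :: "nat \<Rightarrow> complex mat \<Rightarrow> complex \<Rightarrow> complex mat" where
  "line_to_one m A s = mat m m (\<lambda>(i, j). A $$ (i, j) + s * ((if i = j then 1 else 0) - A $$ (i, j)))"

lemma line_to_one_entry:
  "i < m \<Longrightarrow> j < m \<Longrightarrow> \<exists>p. \<forall>s. line_to_one m A s $$ (i, j) = poly p s"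
  by (intro exI[of _ "[:A $$ (i, j), (if i = j then 1 else 0) - A $$ (i, j):]"]) (simp add: line_to_one_def)

lemma line_to_one_0: "A \<in> carrier_mat m m \<Longrightarrow> line_to_one m A 0 = A"
  by (intro eq_matI) (auto simp: line_to_one_def)

lemma line_to_one_1: "line_to_one m A 1 = 1\<^sub>m m"
  by (intro eq_matI) (auto simp: line_to_one_def)

text \<open>Along the line the determinant is a polynomial in the parameter with value 1 at the identity, so
it has finitely many zeros.\<close>

lemma line_to_one_GL: "finite {s. line_to_one m A s \<notin> GL m}"
proof -
  obtain f where f: "polynomial_fun m f" "\<And>A. A \<in> carrier_mat m m \<Longrightarrow> f A = det A"
    using polynomial_fun_det by blast
  obtain p where p: "\<forall>s. f (line_to_one m A s) = poly p s"
    using polynomial_fun_on_curve[OF f(1) line_to_one_entry] by blast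
  have car: "line_to_one m A s \<in> carrier_mat m m" for s by (simp add: line_to_one_def)
  have "poly p 1 = 1" using p[rule_format, of 1] f(2)[of "1\<^sub>m m"] by (simp add: line_to_one_1)
  then have "p \<noteq> 0" by auto
  moreover have "{s. line_to_one m A s \<notin> GL m} = {s. poly p s = 0}"
    using p f(2)[OF car] car by (auto simp: GL_iff_det)
  ultimately show ?thesis by (simp add: poly_roots_finite)
qed

section \<open>Extending a polynomial representation and differentiating it\<close>

definition mat_trace :: "'a::comm_monoid_add mat \<Rightarrow> 'a" where
  "mat_trace A = (\<Sum>i<dim_row A. A $$ (i, i))"

lemma mat_mult_entry:
  "A \<in> carrier_mat a b \<Longrightarrow> B \<in> carrier_mat b c \<Longrightarrow> i < a \<Longrightarrow> j < c \<Longrightarrow>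
    (A * B) $$ (i, j) = (\<Sum>l<b. A $$ (i, l) * B $$ (l, j))"
  by (auto simp: scalar_prod_def atLeast0LessThan)

lemma mat_trace_comm:
  fixes A B :: "'a::comm_semiring_0 mat"
  assumes A: "A \<in> carrier_mat a b" and B: "B \<in> carrier_mat b a"
  shows "mat_trace (A * B) = mat_trace (B * A)"
proof -
  have "mat_trace (A * B) = (\<Sum>i<a. \<Sum>l<b. A $$ (i, l) * B $$ (l, i))"
    unfolding mat_trace_def using A B by (simp add: mat_mult_entry[OF A B] del: index_mult_mat(1))
  also have "\<dots> = (\<Sum>l<b. \<Sum>i<a. B $$ (l, i) * A $$ (i, l))"
    by (subst sum.swap) (simp add: mult.commute)
  also have "\<dots> = mat_trace (B * A)"
    unfolding mat_trace_def using A B by (simp add: mat_mult_entry[OF B A] del: index_mult_mat(1))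
  finally show ?thesis .
qed

lemma mat_trace_add:
  "A \<in> carrier_mat n n \<Longrightarrow> B \<in> carrier_mat n n \<Longrightarrow> mat_trace (A + B) = mat_trace A + mat_trace B"
  by (auto simp: mat_trace_def sum.distrib)

lemma mat_trace_minus:
  "A \<in> carrier_mat n n \<Longrightarrow> B \<in> carrier_mat n n \<Longrightarrow> mat_trace (A - B) = mat_trace A - mat_trace (B :: 'a::ab_group_add mat)"
  by (auto simp: mat_trace_def sum_subtractf)

lemma mat_trace_smult: "mat_trace (c \<cdot>\<^sub>m A) = c * mat_trace (A :: 'a::comm_semiring_0 mat)" if "A \<in> carrier_mat n n"
  using that by (auto simp: mat_trace_def sum_distrib_left)

definition mat_unit :: "nat \<Rightarrow> nat \<Rightarrow> nat \<Rightarrow> complex mat" where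
  "mat_unit m a b = mat m m (\<lambda>(i, j). if i = a \<and> j = b then 1 else 0)"

lemma mat_unit_carrier [simp]: "mat_unit m a b \<in> carrier_mat m m"
  by (simp add: mat_unit_def)

text \<open>Matrices that depend polynomially on one complex parameter: two of them that agree for infinitely
many parameters agree for all, which serves as the density argument throughout.\<close>

definition poly_curve :: "nat \<Rightarrow> nat \<Rightarrow> (complex \<Rightarrow> complex mat) \<Rightarrow> bool" where
  "poly_curve a b A \<longleftrightarrow> (\<forall>s. A s \<in> carrier_mat a b) \<and>
     (\<forall>i<a. \<forall>j<b. \<exists>p. \<forall>s. A s $$ (i, j) = poly p s)"

lemma poly_curve_const: "A \<in> carrier_mat a b \<Longrightarrow> poly_curve a b (\<lambda>s. A)"
  unfolding poly_curve_def by (auto intro: exI[of _ "[:A $$ (_, _):]"])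

lemma poly_curve_mult:
  assumes "poly_curve a b A" "poly_curve b c B"
  shows "poly_curve a c (\<lambda>s. A s * B s)"
  unfolding poly_curve_def
proof (intro conjI allI impI)
  fix s show "A s * B s \<in> carrier_mat a c"
    using assms by (intro mult_carrier_mat[of _ a b]) (auto simp: poly_curve_def)
next
  fix i j assume ij: "i < a" "j < c"
  have "\<forall>l<b. \<exists>p. \<forall>s. A s $$ (i, l) = poly p s" "\<forall>l<b. \<exists>p. \<forall>s. B s $$ (l, j) = poly p s"
    using assms ij by (auto simp: poly_curve_def)
  then obtain p q where pq: "\<forall>l<b. \<forall>s. A s $$ (i, l) = poly (p l) s" "\<forall>l<b. \<forall>s. B s $$ (l, j) = poly (q l) s"
    by metis
  have "(A s * B s) $$ (i, j) = poly (\<Sum>l<b. p l * q l) s" for s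
  proof -
    have "(A s * B s) $$ (i, j) = (\<Sum>l<b. A s $$ (i, l) * B s $$ (l, j))"
      using assms ij by (intro mat_mult_entry) (auto simp: poly_curve_def)
    then show ?thesis using pq by (simp add: poly_sum)
  qed
  then show "\<exists>p. \<forall>s. (A s * B s) $$ (i, j) = poly p s" by blast
qed

lemma poly_curve_eq:
  assumes "poly_curve a b A" "poly_curve a b B" and inf: "infinite {s. A s = B s}"
  shows "A s = B s"
proof (rule eq_matI)
  fix i j assume "i < dim_row (B s)" "j < dim_col (B s)"
  moreover have "B s \<in> carrier_mat a b" using assms(2) by (auto simp: poly_curve_def)
  ultimately have ij: "i < a" "j < b" by auto
  then obtain p q where pq: "\<forall>s. A s $$ (i, j) = poly p s" "\<forall>s. B s $$ (i, j) = poly q s"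
    using assms unfolding poly_curve_def by meson
  then have "{s. A s = B s} \<subseteq> {s. poly p s = poly q s}" by auto metis
  then have "p = q" using inf by (intro poly_eq_if_agree) (metis infinite_super)
  then show "A s $$ (i, j) = B s $$ (i, j)" using pq by simp
next
  have "A s \<in> carrier_mat a b" "B s \<in> carrier_mat a b" using assms by (auto simp: poly_curve_def)
  then show "dim_row (A s) = dim_row (B s)" "dim_col (A s) = dim_col (B s)" by auto
qed

lemma poly_curve_line_to_one: "poly_curve m m (line_to_one m A)"
  unfolding poly_curve_def using line_to_one_entry by (auto simp: line_to_one_def)

lemma coeff_one_plus_power: "coeff ([:1, 1:] ^ k) 1 = (of_nat k :: 'a::comm_ring_1)"
proof (induction k)
  case (Suc k)
  have "coeff ([:1, 1:] ^ k) 0 = (1 :: 'a)" by (induction k) (simp_all add: coeff_mult_0)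
  then show ?case using Suc by (simp add: coeff_pCons)
qed simp

locale polynomial_gl_rep =
  fixes m d :: nat and rho :: "complex mat \<Rightarrow> complex mat"
  assumes rep: "polynomial_rep m (d, rho)"
begin

definition entry_fun :: "nat \<Rightarrow> nat \<Rightarrow> complex mat \<Rightarrow> complex" where
  "entry_fun r c = (SOME f. polynomial_fun m f \<and> (\<forall>A\<in>GL m. rho A $$ (r, c) = f A))"

lemma entry_fun:
  assumes "r < d" "c < d"
  shows "polynomial_fun m (entry_fun r c)" "A \<in> GL m \<Longrightarrow> entry_fun r c A = rho A $$ (r, c)"
proof -
  have "\<exists>f. polynomial_fun m f \<and> (\<forall>A\<in>GL m. rho A $$ (r, c) = f A)"
    using rep assms by (auto simp: polynomial_rep_def)
  then have "polynomial_fun m (entry_fun r c) \<and> (\<forall>A\<in>GL m. rho A $$ (r, c) = entry_fun r c A)"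
    unfolding entry_fun_def by (rule someI_ex)
  then show "polynomial_fun m (entry_fun r c)" "A \<in> GL m \<Longrightarrow> entry_fun r c A = rho A $$ (r, c)" by auto
qed

text \<open>The representation, evaluated through its polynomial entries at singular matrices as well.\<close>

definition polyext :: "complex mat \<Rightarrow> complex mat" where
  "polyext A = mat d d (\<lambda>(r, c). entry_fun r c A)"

lemma polyext_carrier [simp]: "polyext A \<in> carrier_mat d d"
  by (simp add: polyext_def)

lemma polyext_dim [simp]: "dim_row (polyext A) = d" "dim_col (polyext A) = d"
  by (simp_all add: polyext_def)

lemma polyext_GL: "A \<in> GL m \<Longrightarrow> polyext A = rho A"
  using rep entry_fun(2) by (intro eq_matI) (auto simp: polyext_def polynomial_rep_def)

lemma polyext_one [simp]: "polyext (1\<^sub>m m) = 1\<^sub>m d"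
  using polyext_GL[OF GL_one] rep by (simp add: polynomial_rep_def)

lemma poly_curve_polyext:
  assumes "poly_curve m m A"
  shows "poly_curve d d (\<lambda>s. polyext (A s))"
  unfolding poly_curve_def
proof (intro conjI allI impI)
  fix r c assume rc: "r < d" "c < d"
  have "\<exists>p. \<forall>s. entry_fun r c (A s) = poly p s"
    using assms by (intro polynomial_fun_on_curve[OF entry_fun(1)[OF rc]]) (auto simp: poly_curve_def)
  then show "\<exists>p. \<forall>s. polyext (A s) $$ (r, c) = poly p s" using rc by (simp add: polyext_def)
qed simp

text \<open>Both sides are polynomial along the lines from \<open>A\<close> and \<open>B\<close> to the
identity, and they agree whenever both points are invertible, that is, for all but finitely many
parameters.\<close>

lemma polyext_mult:
  assumes A: "A \<in> carrier_mat m m" and B: "B \<in> carrier_mat m m"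
  shows "polyext (A * B) = polyext A * polyext B"
proof -
  let ?A = "line_to_one m A" and ?B = "line_to_one m B"
  have "polyext (?A 0 * ?B 0) = polyext (?A 0) * polyext (?B 0)"
  proof (rule poly_curve_eq[where A = "\<lambda>s. polyext (?A s * ?B s)" and B = "\<lambda>s. polyext (?A s) * polyext (?B s)"])
    show "poly_curve d d (\<lambda>s. polyext (?A s * ?B s))"
      by (intro poly_curve_polyext poly_curve_mult[of _ m] poly_curve_line_to_one)
    show "poly_curve d d (\<lambda>s. polyext (?A s) * polyext (?B s))"
      by (intro poly_curve_polyext poly_curve_mult[of _ d] poly_curve_line_to_one)
    have "- ({s. ?A s \<notin> GL m} \<union> {s. ?B s \<notin> GL m}) \<subseteq> {s. polyext (?A s * ?B s) = polyext (?A s) * polyext (?B s)}"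
      using rep by (auto simp: polyext_GL GL_mult polynomial_rep_def)
    moreover have "finite ({s. ?A s \<notin> GL m} \<union> {s. ?B s \<notin> GL m})"
      using line_to_one_GL[of m A] line_to_one_GL[of m B] by simp
    then have "infinite (- ({s. ?A s \<notin> GL m} \<union> {s. ?B s \<notin> GL m}))"
      unfolding Compl_eq_Diff_UNIV by (rule Diff_infinite_finite) (rule infinite_UNIV_char_0)
    ultimately show "infinite {s. polyext (?A s * ?B s) = polyext (?A s) * polyext (?B s)}"
      by (rule infinite_super)
  qed
  then show ?thesis using A B by (simp add: line_to_one_0)
qed

text \<open>The entries of the representation along \<open>1 + s X\<close> are kept as polynomials in
\<open>s\<close>, so that differentiating an identity between them means comparing the coefficients of
\<open>s\<close>.\<close>

definition near_one :: "complex mat \<Rightarrow> nat \<Rightarrow> nat \<Rightarrow> complex poly" where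
  "near_one X r c = (SOME p. \<forall>s. polyext (1\<^sub>m m + s \<cdot>\<^sub>m X) $$ (r, c) = poly p s)"

text \<open>The derivative of the representation at the identity in direction \<open>X\<close>.\<close>

definition lie :: "complex mat \<Rightarrow> complex mat" where
  "lie X = mat d d (\<lambda>(r, c). coeff (near_one X r c) 1)"

lemma lie_carrier [simp]: "lie X \<in> carrier_mat d d"
  by (simp add: lie_def)

lemma lie_dim [simp]: "dim_row (lie X) = d" "dim_col (lie X) = d"
  by (simp_all add: lie_def)

lemma near_one:
  assumes X: "X \<in> carrier_mat m m" and rc: "r < d" "c < d"
  shows "polyext (1\<^sub>m m + s \<cdot>\<^sub>m X) $$ (r, c) = poly (near_one X r c) s"
    and "coeff (near_one X r c) 0 = (if r = c then 1 else 0)"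
    and "coeff (near_one X r c) 1 = lie X $$ (r, c)"
proof -
  have "\<exists>p. \<forall>s. polyext (1\<^sub>m m + s \<cdot>\<^sub>m X) $$ (r, c) = poly p s"
    using polynomial_fun_first_order[OF entry_fun(1)[OF rc]] X rc by (auto simp: polyext_def)
  then have p: "\<forall>s. polyext (1\<^sub>m m + s \<cdot>\<^sub>m X) $$ (r, c) = poly (near_one X r c) s"
    unfolding near_one_def by (rule someI_ex)
  then show "polyext (1\<^sub>m m + s \<cdot>\<^sub>m X) $$ (r, c) = poly (near_one X r c) s" by simp
  have "1\<^sub>m m + 0 \<cdot>\<^sub>m X = 1\<^sub>m m" using X by (intro eq_matI) auto
  then show "coeff (near_one X r c) 0 = (if r = c then 1 else 0)"
    using p[rule_format, of 0] rc by (simp add: poly_0_coeff_0)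
  show "coeff (near_one X r c) 1 = lie X $$ (r, c)" using rc by (simp add: lie_def)
qed

lemma near_one_unique:
  assumes X: "X \<in> carrier_mat m m" and rc: "r < d" "c < d"
    and p: "\<And>s. polyext (1\<^sub>m m + s \<cdot>\<^sub>m X) $$ (r, c) = poly p s"
  shows "lie X $$ (r, c) = coeff p 1"
proof -
  have "near_one X r c = p"
    using near_one(1)[OF X rc] p by (intro poly_eq_if_agree) (simp add: infinite_UNIV_char_0)
  then show ?thesis using near_one(3)[OF X rc] by simp
qed

text \<open>Linearity of the derivative, in coordinates: the partial derivatives are its values at the matrix
units.\<close>

lemma lie_expand:
  assumes X: "X \<in> carrier_mat m m" and rc: "r < d" "c < d"
  shows "lie X $$ (r, c) = (\<Sum>a<m. \<Sum>b<m. X $$ (a, b) * lie (mat_unit m a b) $$ (r, c))"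
proof -
  obtain e where e: "\<And>X. X \<in> carrier_mat m m \<Longrightarrow> \<exists>p. (\<forall>s. entry_fun r c (1\<^sub>m m + s \<cdot>\<^sub>m X) = poly p s) \<and>
    coeff p 1 = (\<Sum>i<m. \<Sum>j<m. e i j * X $$ (i, j))"
    using polynomial_fun_first_order[OF entry_fun(1)[OF rc]] by blast
  have lie: "lie X $$ (r, c) = (\<Sum>i<m. \<Sum>j<m. e i j * X $$ (i, j))" if X: "X \<in> carrier_mat m m" for X
  proof -
    obtain p where "\<forall>s. entry_fun r c (1\<^sub>m m + s \<cdot>\<^sub>m X) = poly p s" "coeff p 1 = (\<Sum>i<m. \<Sum>j<m. e i j * X $$ (i, j))"
      using e[OF X] by blast
    then show ?thesis using near_one_unique[OF X rc, of p] rc by (simp add: polyext_def)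
  qed
  have "lie (mat_unit m a b) $$ (r, c) = e a b" if "a < m" "b < m" for a b
  proof -
    have "lie (mat_unit m a b) $$ (r, c) = (\<Sum>i<m. \<Sum>j<m. e i j * mat_unit m a b $$ (i, j))"
      by (rule lie) simp
    also have "\<dots> = (\<Sum>i<m. if i = a then \<Sum>j<m. if j = b then e i j else 0 else 0)"
      by (intro sum.cong refl) (auto intro!: sum.cong simp: mat_unit_def simp del: sum.delta sum.delta')
    also have "\<dots> = e a b" using that by (simp only: sum.delta finite_lessThan lessThan_iff if_True)
    finally show ?thesis .
  qed
  then show ?thesis unfolding lie[OF X] by (intro sum.cong refl) auto
qed

text \<open>From \<open>A (1 + s X) = (1 + s Y) A\<close> by comparing coefficients of \<open>s\<close>; since
nothing is inverted, \<open>A\<close> may be any matrix. This one rule yields the equivariance of the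
derivative, its commutation with the torus, and the bracket below.\<close>

lemma lie_intertwine:
  assumes X: "X \<in> carrier_mat m m" and Y: "Y \<in> carrier_mat m m" and A: "A \<in> carrier_mat m m"
    and AX: "A * X = Y * A"
  shows "polyext A * lie X = lie Y * polyext A"
proof (rule eq_matI)
  fix r c assume "r < dim_row (lie Y * polyext A)" "c < dim_col (lie Y * polyext A)"
  then have rc: "r < d" "c < d" by auto
  have "poly (\<Sum>l<d. Polynomial.smult (polyext A $$ (r, l)) (near_one X l c)) s =
      poly (\<Sum>l<d. Polynomial.smult (polyext A $$ (l, c)) (near_one Y r l)) s" for s
  proof -
    have "A * (1\<^sub>m m + s \<cdot>\<^sub>m X) = A + s \<cdot>\<^sub>m (A * X)"
      using A X mult_add_distrib_mat[OF A one_carrier_mat, of "s \<cdot>\<^sub>m X"] mult_smult_distrib[OF A X] by simp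
    also have "\<dots> = (1\<^sub>m m + s \<cdot>\<^sub>m Y) * A"
      unfolding AX using A Y add_mult_distrib_mat[OF one_carrier_mat _ A, of "s \<cdot>\<^sub>m Y"] mult_smult_assoc_mat[OF Y A] by simp
    finally have "polyext A * polyext (1\<^sub>m m + s \<cdot>\<^sub>m X) = polyext (1\<^sub>m m + s \<cdot>\<^sub>m Y) * polyext A"
      using A X Y polyext_mult[of A "1\<^sub>m m + s \<cdot>\<^sub>m X"] polyext_mult[of "1\<^sub>m m + s \<cdot>\<^sub>m Y" A] by simp
    then have "(polyext A * polyext (1\<^sub>m m + s \<cdot>\<^sub>m X)) $$ (r, c) = (polyext (1\<^sub>m m + s \<cdot>\<^sub>m Y) * polyext A) $$ (r, c)" by simp
    then show ?thesis
      using rc X Y by (simp add: mat_mult_entry[of _ d d _ d] poly_sum near_one(1) mult.commute del: index_mult_mat(1))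
  qed
  then have "(\<Sum>l<d. Polynomial.smult (polyext A $$ (r, l)) (near_one X l c)) = (\<Sum>l<d. Polynomial.smult (polyext A $$ (l, c)) (near_one Y r l))"
    by (intro poly_eq_if_agree) (simp add: infinite_UNIV_char_0)
  then have "coeff (\<Sum>l<d. Polynomial.smult (polyext A $$ (r, l)) (near_one X l c)) 1 = coeff (\<Sum>l<d. Polynomial.smult (polyext A $$ (l, c)) (near_one Y r l)) 1"
    by simp
  then show "(polyext A * lie X) $$ (r, c) = (lie Y * polyext A) $$ (r, c)"
    using rc X Y by (simp add: mat_mult_entry[of _ d d _ d] coeff_sum near_one(3)[simplified] mult.commute del: index_mult_mat(1))
qed auto

text \<open>Conjugation by \<open>1 + t E_ij\<close> sends \<open>E_ji\<close> to \<open>E_ji + t (E_ii -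
E_jj) - t^2 E_ij\<close>. The bracket relation is the coefficient of \<open>t\<close> in the resulting
intertwining identity.\<close>

lemma lie_bracket:
  assumes ij: "i < m" "j < m" "i \<noteq> j"
  shows "lie (mat_unit m i j) * lie (mat_unit m j i) =
    lie (mat_unit m j i) * lie (mat_unit m i j) + (lie (mat_unit m i i) - lie (mat_unit m j j))"
proof (rule eq_matI)
  let ?L = "\<lambda>a b. lie (mat_unit m a b)"
  let ?E = "mat_unit m"
  fix r c assume "r < dim_row (?L j i * ?L i j + (?L i i - ?L j j))" "c < dim_col (?L j i * ?L i j + (?L i i - ?L j j))"
  then have rc: "r < d" "c < d" by auto
  \<comment> \<open>the conjugate of \<open>E_ji\<close> by \<open>1 + t E_ij\<close>\<close>
  define Y where "Y = (\<lambda>t::complex. mat m m (\<lambda>(a, b). (if a = j \<and> b = i then 1 else 0) +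
     t * ((if a = i \<and> b = i then 1 else 0) - (if a = j \<and> b = j then 1 else 0)) - t\<^sup>2 * (if a = i \<and> b = j then 1 else 0)))"
  have Yc: "Y t \<in> carrier_mat m m" for t by (simp add: Y_def)
  have lieY: "lie (Y t) $$ (r', c') = ?L j i $$ (r', c') + t * (?L i i $$ (r', c') - ?L j j $$ (r', c')) - t\<^sup>2 * ?L i j $$ (r', c')"
    if "r' < d" "c' < d" for t r' c'
  proof -
    have pick: "(\<Sum>a<m. \<Sum>b<m. (if a = x \<and> b = y then 1 else 0) * g a b) = g x y"
      if "x < m" "y < m" for x y and g :: "nat \<Rightarrow> nat \<Rightarrow> complex"
    proof -
      have "(\<Sum>a<m. \<Sum>b<m. (if a = x \<and> b = y then 1 else 0) * g a b) =
          (\<Sum>a<m. if a = x then \<Sum>b<m. if b = y then g a b else 0 else 0)"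
        by (intro sum.cong refl) (auto intro!: sum.cong simp del: sum.delta sum.delta')
      also have "\<dots> = g x y" using that by (simp only: sum.delta finite_lessThan lessThan_iff if_True)
      finally show ?thesis .
    qed
    let ?i = "\<lambda>x y a b. (if a = x \<and> b = y then 1 else 0) :: complex"
    let ?g = "\<lambda>a b. ?L a b $$ (r', c')"
    have "lie (Y t) $$ (r', c') = (\<Sum>a<m. \<Sum>b<m. (?i j i a b + t * (?i i i a b - ?i j j a b) - t\<^sup>2 * ?i i j a b) * ?g a b)"
      unfolding lie_expand[OF Yc that] by (intro sum.cong refl) (simp add: Y_def)
    also have "\<dots> = (\<Sum>a<m. \<Sum>b<m. ?i j i a b * ?g a b) + t * ((\<Sum>a<m. \<Sum>b<m. ?i i i a b * ?g a b) - (\<Sum>a<m. \<Sum>b<m. ?i j j a b * ?g a b))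
        - t\<^sup>2 * (\<Sum>a<m. \<Sum>b<m. ?i i j a b * ?g a b)"
      unfolding sum_distrib_left sum_subtractf[symmetric] sum.distrib[symmetric]
      by (intro sum.cong refl) (simp only: ring_distribs mult.assoc)
    finally show ?thesis using ij by (simp only: pick)
  qed
  have key: "poly (\<Sum>l<d. Polynomial.smult (?L j i $$ (l, c)) (near_one (?E i j) r l)) t =
     poly (\<Sum>l<d. [:?L j i $$ (r, l), ?L i i $$ (r, l) - ?L j j $$ (r, l), - ?L i j $$ (r, l):] * near_one (?E i j) l c) t" for t
  proof -
    let ?A = "1\<^sub>m m + t \<cdot>\<^sub>m ?E i j"
    have "?A * ?E j i = Y t * ?A"
    proof (rule eq_matI)
      fix a b assume "a < dim_row (Y t * ?A)" "b < dim_col (Y t * ?A)"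
      then have ab: "a < m" "b < m" by (auto simp: Y_def mat_unit_def)
      have pick1: "(\<Sum>l<m. ((if a = l then 1 else 0) + t * (if a = i \<and> l = j then 1 else 0)) * (if l = j \<and> b = i then 1 else 0)) =
          ((if a = j then 1 else 0) + t * (if a = i then 1 else 0)) * (if b = i then 1 else 0)"
        using ij by (subst sum.remove[of _ j]) (auto intro!: sum.neutral)
      have pick2: "(\<Sum>l<m. Y t $$ (a, l) * ((if l = b then 1 else 0) + t * (if l = i \<and> b = j then 1 else 0))) =
          Y t $$ (a, b) + (if b = j then t * Y t $$ (a, i) else 0)"
      proof -
        have "(\<Sum>l<m. Y t $$ (a, l) * ((if l = b then 1 else 0) + t * (if l = i \<and> b = j then 1 else 0))) =
          (\<Sum>l<m. if l = b then Y t $$ (a, l) else 0) + (\<Sum>l<m. if l = i then (if b = j then t * Y t $$ (a, l) else 0) else 0)"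
          unfolding sum.distrib[symmetric] by (intro sum.cong refl) (auto simp: algebra_simps)
        then show ?thesis using ab ij by (simp only: sum.delta finite_lessThan lessThan_iff if_True)
      qed
      show "(?A * ?E j i) $$ (a, b) = (Y t * ?A) $$ (a, b)"
        using ab ij pick1 pick2
        by (simp add: mat_mult_entry[of _ m m _ m] Yc mat_unit_def del: index_mult_mat(1))
          (auto simp: Y_def power2_eq_square)
    qed (auto simp: Y_def mat_unit_def)
    then have "(polyext ?A * ?L j i) $$ (r, c) = (lie (Y t) * polyext ?A) $$ (r, c)"
      using lie_intertwine[of "?E j i" "Y t" ?A] Yc by simp
    then have "(\<Sum>l<d. polyext ?A $$ (r, l) * ?L j i $$ (l, c)) = (\<Sum>l<d. lie (Y t) $$ (r, l) * polyext ?A $$ (l, c))"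
      using rc by (simp add: mat_mult_entry[of _ d d _ d] del: index_mult_mat(1))
    then show ?thesis
      using rc by (simp add: near_one(1) lieY poly_sum power2_eq_square algebra_simps sum.distrib sum_subtractf)
  qed
  have "(\<Sum>l<d. Polynomial.smult (?L j i $$ (l, c)) (near_one (?E i j) r l)) =
     (\<Sum>l<d. [:?L j i $$ (r, l), ?L i i $$ (r, l) - ?L j j $$ (r, l), - ?L i j $$ (r, l):] * near_one (?E i j) l c)"
    using key by (intro poly_eq_if_agree) (simp add: infinite_UNIV_char_0)
  then have "coeff (\<Sum>l<d. Polynomial.smult (?L j i $$ (l, c)) (near_one (?E i j) r l)) 1 =
     coeff (\<Sum>l<d. [:?L j i $$ (r, l), ?L i i $$ (r, l) - ?L j j $$ (r, l), - ?L i j $$ (r, l):] * near_one (?E i j) l c) 1"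
    by (rule arg_cong)
  moreover have "coeff ([:x, y, z:] * p) 1 = x * coeff p 1 + y * coeff p 0" for x y z :: complex and p
    by (simp add: coeff_mult)
  ultimately have h: "(\<Sum>l<d. ?L j i $$ (l, c) * coeff (near_one (?E i j) r l) 1) =
     (\<Sum>l<d. ?L j i $$ (r, l) * coeff (near_one (?E i j) l c) 1 +
       (?L i i $$ (r, l) - ?L j j $$ (r, l)) * coeff (near_one (?E i j) l c) 0)"
    by (simp only: coeff_sum coeff_smult)
  have "(\<Sum>l<d. ?L j i $$ (l, c) * ?L i j $$ (r, l)) = (\<Sum>l<d. ?L j i $$ (l, c) * coeff (near_one (?E i j) r l) 1)"
    by (intro sum.cong refl) (use rc in \<open>simp add: near_one(3)[simplified]\<close>)
  also note h
  also have "(\<Sum>l<d. ?L j i $$ (r, l) * coeff (near_one (?E i j) l c) 1 +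
       (?L i i $$ (r, l) - ?L j j $$ (r, l)) * coeff (near_one (?E i j) l c) 0) =
     (\<Sum>l<d. ?L j i $$ (r, l) * ?L i j $$ (l, c) + (?L i i $$ (r, l) - ?L j j $$ (r, l)) * (if l = c then 1 else 0))"
    by (intro sum.cong refl) (use rc in \<open>simp add: near_one(2) near_one(3)[simplified]\<close>)
  also have "\<dots> = (\<Sum>l<d. ?L j i $$ (r, l) * ?L i j $$ (l, c)) + (\<Sum>l<d. if l = c then ?L i i $$ (r, l) - ?L j j $$ (r, l) else 0)"
    unfolding sum.distrib[symmetric] by (intro sum.cong refl) auto
  also have "(\<Sum>l<d. if l = c then ?L i i $$ (r, l) - ?L j j $$ (r, l) else 0) = ?L i i $$ (r, c) - ?L j j $$ (r, c)"
    using rc by (simp only: sum.delta finite_lessThan lessThan_iff if_True)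
  finally show "(?L i j * ?L j i) $$ (r, c) = (?L j i * ?L i j + (?L i i - ?L j j)) $$ (r, c)"
    using rc by (simp add: mat_mult_entry[of _ d d _ d] mult.commute del: index_mult_mat(1))
qed auto

end

section \<open>Weight decomposition under the diagonal torus\<close>

lemma smult_mult_mat_vec:
  fixes A :: "'a::comm_semiring_0 mat"
  assumes "A \<in> carrier_mat n k" "v \<in> carrier_vec k"
  shows "(c \<cdot>\<^sub>m A) *\<^sub>v v = c \<cdot>\<^sub>v (A *\<^sub>v v)"
  using assms by (intro eq_vecI) (auto simp: scalar_prod_def sum_distrib_left mult_ac)

text \<open>The rank of an idempotent is its trace. Expand the columns of \<open>P\<close> in a basis
\<open>B\<close> of its range, with coefficients \<open>a c b\<close>. Since \<open>P b = b\<close>,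
independence forces \<open>\<Sum>c. a c b * b $ c = 1\<close> for every \<open>b\<close> in \<open>B\<close>,
and the trace is the sum of these ones.\<close>

lemma dim_idempotent_range:
  fixes P :: "complex mat"
  assumes P: "P \<in> carrier_mat d d" and idem: "P * P = P"
  shows "of_nat (vectorspace.dim class_ring
     ((module_vec TYPE(complex) d)\<lparr>carrier := {w \<in> carrier_vec d. P *\<^sub>v w = w}\<rparr>)) = mat_trace P"
proof -
  define A where "A = 1\<^sub>m d - P"
  have A: "A \<in> carrier_mat d d" using P by (simp add: A_def minus_carrier_mat)
  interpret kernel d d A by unfold_locales (rule A)
  have Aw: "A *\<^sub>v w = w - P *\<^sub>v w" if "w \<in> carrier_vec d" for w
    using that P unfolding A_def by (simp add: minus_mult_distrib_mat_vec[of _ d d])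
  have ker: "mat_kernel A = {w \<in> carrier_vec d. P *\<^sub>v w = w}"
  proof (intro equalityI subsetI)
    fix w assume "w \<in> mat_kernel A"
    then have w: "w \<in> carrier_vec d" "w - P *\<^sub>v w = 0\<^sub>v d" using Aw A by (auto simp: mat_kernel_def)
    have "P *\<^sub>v w = w"
    proof (rule eq_vecI)
      fix i assume "i < dim_vec w"
      then have i: "i < d" using w by simp
      have "(w - P *\<^sub>v w) $ i = 0" using w(2) i by simp
      then show "(P *\<^sub>v w) $ i = w $ i" using i w(1) P by simp
    qed (use w P in auto)
    then show "w \<in> {w \<in> carrier_vec d. P *\<^sub>v w = w}" using w by simp
  next
    fix w assume "w \<in> {w \<in> carrier_vec d. P *\<^sub>v w = w}"
    then show "w \<in> mat_kernel A" using Aw A by (auto simp: mat_kernel_def)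
  qed
  obtain B where B: "finite B" "basis B" using kernel_basis_exists[OF A] by blast
  have sub: "B \<subseteq> mat_kernel A" and li: "lin_indpt B" and span: "span B = mat_kernel A"
    using B(2) by (auto simp: Ker.basis_def)
  have dim: "dim = card B" by (rule Ker.dim_basis[OF B])
  have "\<exists>a. lincomb a B = col P c" if c: "c < d" for c
  proof -
    have "P *\<^sub>v col P c = col P c"
      using idem P c by (metis col_mult2)
    then have "col P c \<in> mat_kernel A" using c P by (auto simp: ker)
    then have "col P c \<in> span B" unfolding span .
    then show ?thesis using Ker.finite_in_span[OF B(1)] sub by blast
  qed
  then obtain a where a: "\<And>c. c < d \<Longrightarrow> lincomb (a c) B = col P c" by metis
  have Pent: "P $$ (i, c) = (\<Sum>b\<in>B. a c b * b $ i)" if "i < d" "c < d" for i c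
  proof -
    have "P $$ (i, c) = lincomb (a c) B $ i" using that P by (simp add: a)
    then show ?thesis using lincomb_index[OF that(1) sub] by simp
  qed
  have coef: "(\<Sum>c<d. a c b * b $ c) = 1" if b: "b \<in> B" for b
  proof -
    have bc: "b \<in> carrier_vec d" "P *\<^sub>v b = b" using b sub ker by auto
    define e where "e = (\<lambda>b'. (\<Sum>c<d. a c b' * b $ c) - (if b' = b then 1 else 0))"
    have "lincomb e B = 0\<^sub>v d"
    proof (rule eq_vecI)
      fix i assume "i < dim_vec (0\<^sub>v d :: complex vec)"
      then have i: "i < d" by simp
      have "lincomb e B $ i = (\<Sum>b'\<in>B. e b' * b' $ i)" by (rule lincomb_index[OF i sub])
      also have "\<dots> = (\<Sum>b'\<in>B. \<Sum>c<d. a c b' * b $ c * b' $ i) - (\<Sum>b'\<in>B. if b' = b then b' $ i else 0)"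
        unfolding sum_subtractf[symmetric] e_def by (intro sum.cong refl) (auto simp: left_diff_distrib sum_distrib_right)
      also have "(\<Sum>b'\<in>B. if b' = b then b' $ i else 0) = b $ i" using b B(1) by simp
      also have "(\<Sum>b'\<in>B. \<Sum>c<d. a c b' * b $ c * b' $ i) = (\<Sum>c<d. P $$ (i, c) * b $ c)"
        by (subst sum.swap) (auto simp: Pent i sum_distrib_left sum_distrib_right mult_ac intro!: sum.cong)
      also have "\<dots> = (P *\<^sub>v b) $ i" using P bc(1) i by (simp add: scalar_prod_def atLeast0LessThan)
      finally show "lincomb e B $ i = 0\<^sub>v d $ i" using bc i by simp
    next
      show "dim_vec (lincomb e B) = dim_vec (0\<^sub>v d :: complex vec)"
        using Ker.lincomb_closed[of B e] sub A by (auto simp: mat_kernel_def)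
    qed
    then have "e b = 0" using Ker.lin_dep_crit[OF B(1) subset_refl _ b, of e] li by auto
    then show ?thesis by (simp add: e_def)
  qed
  have "mat_trace P = (\<Sum>i<d. \<Sum>b\<in>B. a i b * b $ i)" using P by (simp add: mat_trace_def Pent)
  also have "\<dots> = (\<Sum>b\<in>B. \<Sum>i<d. a i b * b $ i)" by (rule sum.swap)
  also have "\<dots> = of_nat (card B)" using coef by simp
  finally show ?thesis using dim unfolding ker by simp
qed

context polynomial_gl_rep
begin

text \<open>The action of the torus as a matrix-valued polynomial \<open>\<Sum>\<nu>. t^\<nu> M \<nu>\<close>.
Its coefficients are the projections onto the weight spaces, and \<open>S\<close> is the set of
weights.\<close>

definition torus_decomposition :: "(nat \<Rightarrow> nat) set \<Rightarrow> ((nat \<Rightarrow> nat) \<Rightarrow> complex mat) \<Rightarrow> bool" where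
  "torus_decomposition S M \<longleftrightarrow> finite S \<and> S \<subseteq> exponents m \<and> (\<forall>\<nu>. M \<nu> \<in> carrier_mat d d) \<and>
     (\<forall>\<nu>\<in>S. M \<nu> \<noteq> 0\<^sub>m d d) \<and>
     (\<forall>t. polyext (mat_diag m t) = mat d d (\<lambda>(r, c). \<Sum>\<nu>\<in>S. tpow m t \<nu> * M \<nu> $$ (r, c)))"

lemma torus_decomposition_exists: "\<exists>S M. torus_decomposition S M"
proof -
  have "\<exists>S c'. finite S \<and> S \<subseteq> exponents m \<and> (\<forall>t. entry_fun r c (mat_diag m t) = (\<Sum>\<nu>\<in>S. c' \<nu> * tpow m t \<nu>))"
    if "r < d" "c < d" for r c
    by (rule polynomial_fun_on_torus[OF entry_fun(1)[OF that]])
  then obtain S e where S: "\<And>r c. r < d \<Longrightarrow> c < d \<Longrightarrow> finite (S r c)" "\<And>r c. r < d \<Longrightarrow> c < d \<Longrightarrow> S r c \<subseteq> exponents m"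
    and e: "\<And>r c t. r < d \<Longrightarrow> c < d \<Longrightarrow> entry_fun r c (mat_diag m t) = (\<Sum>\<nu>\<in>S r c. e r c \<nu> * tpow m t \<nu>)"
    by metis
  define U where "U = (\<Union>r<d. \<Union>c<d. S r c)"
  define M where "M = (\<lambda>\<nu>. mat d d (\<lambda>(r, c). if \<nu> \<in> S r c then e r c \<nu> else 0))"
  define T where "T = {\<nu> \<in> U. M \<nu> \<noteq> 0\<^sub>m d d}"
  have U: "finite U" "U \<subseteq> exponents m" using S unfolding U_def by auto blast
  have "polyext (mat_diag m t) = mat d d (\<lambda>(r, c). \<Sum>\<nu>\<in>T. tpow m t \<nu> * M \<nu> $$ (r, c))" for t
  proof (rule eq_matI)
    fix r c assume "r < dim_row (mat d d (\<lambda>(r, c). \<Sum>\<nu>\<in>T. tpow m t \<nu> * M \<nu> $$ (r, c)))"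
      "c < dim_col (mat d d (\<lambda>(r, c). \<Sum>\<nu>\<in>T. tpow m t \<nu> * M \<nu> $$ (r, c)))"
    then have rc: "r < d" "c < d" by auto
    have "polyext (mat_diag m t) $$ (r, c) = (\<Sum>\<nu>\<in>S r c. e r c \<nu> * tpow m t \<nu>)" using rc e by (simp add: polyext_def)
    also have "\<dots> = (\<Sum>\<nu>\<in>U. tpow m t \<nu> * M \<nu> $$ (r, c))"
      using rc U(1) by (intro sum.mono_neutral_cong_left) (auto simp: U_def M_def)
    also have "\<dots> = (\<Sum>\<nu>\<in>T. tpow m t \<nu> * M \<nu> $$ (r, c))"
      using rc U(1) by (intro sum.mono_neutral_right) (auto simp: T_def)
    finally show "polyext (mat_diag m t) $$ (r, c) = mat d d (\<lambda>(r, c). \<Sum>\<nu>\<in>T. tpow m t \<nu> * M \<nu> $$ (r, c)) $$ (r, c)"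
      using rc by simp
  qed auto
  then have "torus_decomposition T M" using U unfolding torus_decomposition_def by (auto simp: T_def M_def)
  then show ?thesis by blast
qed

definition torus_choice :: "(nat \<Rightarrow> nat) set \<times> ((nat \<Rightarrow> nat) \<Rightarrow> complex mat)" where
  "torus_choice = (SOME x. torus_decomposition (fst x) (snd x))"

definition wts :: "(nat \<Rightarrow> nat) set" where "wts = fst torus_choice"

definition wproj :: "(nat \<Rightarrow> nat) \<Rightarrow> complex mat" where "wproj = snd torus_choice"

lemma torus_decomposition: "torus_decomposition wts wproj"
  unfolding wts_def wproj_def torus_choice_def
  by (rule someI_ex[of "\<lambda>x. torus_decomposition (fst x) (snd x)"]) (use torus_decomposition_exists in auto)

lemma finite_wts: "finite wts" and wts_exponents: "wts \<subseteq> exponents m"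
  and wproj_carrier [simp]: "wproj \<nu> \<in> carrier_mat d d"
  and wproj_nonzero: "\<nu> \<in> wts \<Longrightarrow> wproj \<nu> \<noteq> 0\<^sub>m d d"
  using torus_decomposition by (auto simp: torus_decomposition_def)

lemma wproj_dim [simp]: "dim_row (wproj \<nu>) = d" "dim_col (wproj \<nu>) = d"
  using carrier_matD[OF wproj_carrier[of \<nu>]] by auto

text \<open>The operator that acts as the scalar \<open>f \<nu>\<close> on the weight space of
\<open>\<nu>\<close>.\<close>

definition msum :: "((nat \<Rightarrow> nat) \<Rightarrow> complex) \<Rightarrow> complex mat" where
  "msum f = mat d d (\<lambda>(r, c). \<Sum>\<nu>\<in>wts. f \<nu> * wproj \<nu> $$ (r, c))"

lemma msum_carrier [simp]: "msum f \<in> carrier_mat d d"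
  by (simp add: msum_def)

lemma polyext_torus: "polyext (mat_diag m t) = msum (tpow m t)"
  using torus_decomposition by (simp add: torus_decomposition_def msum_def)

text \<open>Compare the coefficients of \<open>t^\<nu> s^\<kappa>\<close> in the multiplicativity of the torus
action at \<open>diag t\<close> and \<open>diag s\<close>.\<close>

lemma wproj_mult:
  assumes "\<nu> \<in> wts" "\<kappa> \<in> wts"
  shows "wproj \<nu> * wproj \<kappa> = (if \<nu> = \<kappa> then wproj \<nu> else 0\<^sub>m d d)"
proof (rule eq_matI)
  fix r c assume "r < dim_row (if \<nu> = \<kappa> then wproj \<nu> else 0\<^sub>m d d)" "c < dim_col (if \<nu> = \<kappa> then wproj \<nu> else 0\<^sub>m d d)"
  then have rc: "r < d" "c < d" by (auto split: if_splits)
  let ?M = "\<lambda>\<nu> \<kappa>. (wproj \<nu> * wproj \<kappa>) $$ (r, c)"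
  have two: "(\<Sum>\<nu>\<in>wts. (\<Sum>\<kappa>\<in>wts. ?M \<nu> \<kappa> * tpow m s \<kappa>) * tpow m t \<nu>) = (\<Sum>\<nu>\<in>wts. wproj \<nu> $$ (r, c) * tpow m s \<nu> * tpow m t \<nu>)" for s t
  proof -
    have "polyext (mat_diag m (\<lambda>i. t i * s i)) = polyext (mat_diag m t) * polyext (mat_diag m s)"
      using polyext_mult[of "mat_diag m t" "mat_diag m s"] by simp
    then have f1: "msum (tpow m (\<lambda>i. t i * s i)) $$ (r, c) = (msum (tpow m t) * msum (tpow m s)) $$ (r, c)"
      unfolding polyext_torus by simp
    have "(msum (tpow m t) * msum (tpow m s)) $$ (r, c) =
        (\<Sum>l<d. (\<Sum>\<nu>\<in>wts. tpow m t \<nu> * wproj \<nu> $$ (r, l)) * (\<Sum>\<kappa>\<in>wts. tpow m s \<kappa> * wproj \<kappa> $$ (l, c)))"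
      using rc by (simp add: mat_mult_entry[of _ d d _ d] msum_def del: index_mult_mat(1))
    also have "\<dots> = (\<Sum>l<d. \<Sum>\<nu>\<in>wts. \<Sum>\<kappa>\<in>wts. (tpow m t \<nu> * wproj \<nu> $$ (r, l)) * (tpow m s \<kappa> * wproj \<kappa> $$ (l, c)))"
      by (simp only: sum_product)
    also have "\<dots> = (\<Sum>\<nu>\<in>wts. \<Sum>l<d. \<Sum>\<kappa>\<in>wts. (tpow m t \<nu> * wproj \<nu> $$ (r, l)) * (tpow m s \<kappa> * wproj \<kappa> $$ (l, c)))"
      by (rule sum.swap)
    also have "\<dots> = (\<Sum>\<nu>\<in>wts. \<Sum>\<kappa>\<in>wts. \<Sum>l<d. (tpow m t \<nu> * wproj \<nu> $$ (r, l)) * (tpow m s \<kappa> * wproj \<kappa> $$ (l, c)))"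
      by (intro sum.cong refl) (rule sum.swap)
    also have "\<dots> = (\<Sum>\<nu>\<in>wts. (\<Sum>\<kappa>\<in>wts. ?M \<nu> \<kappa> * tpow m s \<kappa>) * tpow m t \<nu>)"
      using rc by (simp add: mat_mult_entry[of _ d d _ d] sum_distrib_left sum_distrib_right mult_ac del: index_mult_mat(1))
    finally have "(msum (tpow m t) * msum (tpow m s)) $$ (r, c) = (\<Sum>\<nu>\<in>wts. (\<Sum>\<kappa>\<in>wts. ?M \<nu> \<kappa> * tpow m s \<kappa>) * tpow m t \<nu>)" .
    moreover have "msum (tpow m (\<lambda>i. t i * s i)) $$ (r, c) = (\<Sum>\<nu>\<in>wts. wproj \<nu> $$ (r, c) * tpow m s \<nu> * tpow m t \<nu>)"
      using rc by (simp add: msum_def tpow_mult mult_ac)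
    ultimately show ?thesis using f1 by simp
  qed
  have one: "(\<Sum>\<kappa>\<in>wts. ?M \<nu> \<kappa> * tpow m s \<kappa>) - wproj \<nu> $$ (r, c) * tpow m s \<nu> = 0" for s
    by (rule monomials_independent[OF finite_wts wts_exponents _ assms(1)])
      (simp add: left_diff_distrib sum_subtractf two)
  have "?M \<nu> \<kappa> - (if \<kappa> = \<nu> then wproj \<nu> $$ (r, c) else 0) = 0"
  proof (rule monomials_independent[OF finite_wts wts_exponents _ assms(2)])
    fix t :: "nat \<Rightarrow> complex"
    have "(\<Sum>\<kappa>\<in>wts. (?M \<nu> \<kappa> - (if \<kappa> = \<nu> then wproj \<nu> $$ (r, c) else 0)) * tpow m t \<kappa>) =
        (\<Sum>\<kappa>\<in>wts. ?M \<nu> \<kappa> * tpow m t \<kappa>) - (\<Sum>\<kappa>\<in>wts. if \<kappa> = \<nu> then wproj \<nu> $$ (r, c) * tpow m t \<kappa> else 0)"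
      unfolding sum_subtractf[symmetric] by (intro sum.cong refl) (auto simp: left_diff_distrib)
    also have "\<dots> = 0" using one[of t] finite_wts assms(1) by simp
    finally show "(\<Sum>\<kappa>\<in>wts. (?M \<nu> \<kappa> - (if \<kappa> = \<nu> then wproj \<nu> $$ (r, c) else 0)) * tpow m t \<kappa>) = 0" .
  qed
  then show "(wproj \<nu> * wproj \<kappa>) $$ (r, c) = (if \<nu> = \<kappa> then wproj \<nu> else 0\<^sub>m d d) $$ (r, c)"
    using rc by (simp split: if_splits)
qed (use wproj_carrier[of \<nu>] wproj_carrier[of \<kappa>] in auto)

lemma msum_mult: "msum f * msum g = msum (\<lambda>\<nu>. f \<nu> * g \<nu>)"
proof (rule eq_matI)
  fix r c assume "r < dim_row (msum (\<lambda>\<nu>. f \<nu> * g \<nu>))" "c < dim_col (msum (\<lambda>\<nu>. f \<nu> * g \<nu>))"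
  then have rc: "r < d" "c < d" by (auto simp: msum_def)
  have "(msum f * msum g) $$ (r, c) =
      (\<Sum>l<d. (\<Sum>\<nu>\<in>wts. f \<nu> * wproj \<nu> $$ (r, l)) * (\<Sum>\<kappa>\<in>wts. g \<kappa> * wproj \<kappa> $$ (l, c)))"
    using rc by (simp add: mat_mult_entry[of _ d d _ d] msum_def del: index_mult_mat(1))
  also have "\<dots> = (\<Sum>l<d. \<Sum>\<nu>\<in>wts. \<Sum>\<kappa>\<in>wts. (f \<nu> * wproj \<nu> $$ (r, l)) * (g \<kappa> * wproj \<kappa> $$ (l, c)))"
    by (simp only: sum_product)
  also have "\<dots> = (\<Sum>\<nu>\<in>wts. \<Sum>l<d. \<Sum>\<kappa>\<in>wts. (f \<nu> * wproj \<nu> $$ (r, l)) * (g \<kappa> * wproj \<kappa> $$ (l, c)))"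
    by (rule sum.swap)
  also have "\<dots> = (\<Sum>\<nu>\<in>wts. \<Sum>\<kappa>\<in>wts. \<Sum>l<d. (f \<nu> * wproj \<nu> $$ (r, l)) * (g \<kappa> * wproj \<kappa> $$ (l, c)))"
    by (intro sum.cong refl) (rule sum.swap)
  also have "\<dots> = (\<Sum>\<nu>\<in>wts. \<Sum>\<kappa>\<in>wts. f \<nu> * g \<kappa> * (wproj \<nu> * wproj \<kappa>) $$ (r, c))"
    using rc by (simp add: mat_mult_entry[of _ d d _ d] sum_distrib_left mult_ac del: index_mult_mat(1))
  also have "\<dots> = (\<Sum>\<nu>\<in>wts. \<Sum>\<kappa>\<in>wts. if \<kappa> = \<nu> then f \<nu> * g \<nu> * wproj \<nu> $$ (r, c) else 0)"
  proof (intro sum.cong refl)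
    fix \<nu> \<kappa> assume "\<nu> \<in> wts" "\<kappa> \<in> wts"
    then show "f \<nu> * g \<kappa> * (wproj \<nu> * wproj \<kappa>) $$ (r, c) = (if \<kappa> = \<nu> then f \<nu> * g \<nu> * wproj \<nu> $$ (r, c) else 0)"
      using rc unfolding wproj_mult[OF \<open>\<nu> \<in> wts\<close> \<open>\<kappa> \<in> wts\<close>] by auto
  qed
  also have "\<dots> = msum (\<lambda>\<nu>. f \<nu> * g \<nu>) $$ (r, c)" using rc finite_wts by (simp add: msum_def)
  finally show "(msum f * msum g) $$ (r, c) = msum (\<lambda>\<nu>. f \<nu> * g \<nu>) $$ (r, c)" .
qed (auto simp: msum_def)

lemma wproj_msum:
  assumes "\<nu> \<in> wts"
  shows "wproj \<nu> = msum (\<lambda>\<kappa>. if \<kappa> = \<nu> then 1 else 0)"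
proof (rule eq_matI)
  fix r c assume "r < dim_row (msum (\<lambda>\<kappa>. if \<kappa> = \<nu> then 1 else 0))" "c < dim_col (msum (\<lambda>\<kappa>. if \<kappa> = \<nu> then 1 else 0))"
  then have rc: "r < d" "c < d" by (auto simp: msum_def)
  have "(\<Sum>\<kappa>\<in>wts. (if \<kappa> = \<nu> then 1 else 0) * wproj \<kappa> $$ (r, c)) = (\<Sum>\<kappa>\<in>wts. if \<kappa> = \<nu> then wproj \<kappa> $$ (r, c) else 0)"
    by (intro sum.cong) auto
  then show "wproj \<nu> $$ (r, c) = msum (\<lambda>\<kappa>. if \<kappa> = \<nu> then 1 else 0) $$ (r, c)"
    using rc assms finite_wts by (simp add: msum_def)
qed (use wproj_carrier[of \<nu>] in \<open>auto simp: msum_def\<close>)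

lemma msum_scale: "(\<And>\<nu>. \<nu> \<in> wts \<Longrightarrow> f \<nu> = a * g \<nu>) \<Longrightarrow> msum f = a \<cdot>\<^sub>m msum g"
  by (rule eq_matI) (auto simp: msum_def sum_distrib_left mult_ac)

lemma polyext_torus_wproj:
  assumes "\<nu> \<in> wts"
  shows "polyext (mat_diag m t) * wproj \<nu> = tpow m t \<nu> \<cdot>\<^sub>m wproj \<nu>"
    "wproj \<nu> * polyext (mat_diag m t) = tpow m t \<nu> \<cdot>\<^sub>m wproj \<nu>"
  unfolding polyext_torus wproj_msum[OF assms] msum_mult by (rule msum_scale; simp)+

lemma mat_trace_msum: "mat_trace (msum f) = (\<Sum>\<nu>\<in>wts. f \<nu> * mat_trace (wproj \<nu>))"
proof -
  have "mat_trace (msum f) = (\<Sum>i<d. \<Sum>\<nu>\<in>wts. f \<nu> * wproj \<nu> $$ (i, i))" by (simp add: mat_trace_def msum_def)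
  also have "\<dots> = (\<Sum>\<nu>\<in>wts. f \<nu> * mat_trace (wproj \<nu>))"
    by (subst sum.swap) (simp add: mat_trace_def sum_distrib_left)
  finally show ?thesis .
qed

text \<open>Along \<open>1 + s E_ii\<close> the torus acts on the weight space of \<open>\<nu>\<close> by
\<open>(1 + s) ^ \<nu> i\<close>, whose coefficient of \<open>s\<close> is \<open>\<nu> i\<close>.\<close>

lemma lie_diagonal:
  assumes i: "i < m"
  shows "lie (mat_unit m i i) = msum (\<lambda>\<nu>. of_nat (\<nu> i))"
proof (rule eq_matI)
  fix r c assume "r < dim_row (msum (\<lambda>\<nu>. of_nat (\<nu> i)))" "c < dim_col (msum (\<lambda>\<nu>. of_nat (\<nu> i)))"
  then have rc: "r < d" "c < d" by (auto simp: msum_def)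
  have "lie (mat_unit m i i) $$ (r, c) = coeff (\<Sum>\<nu>\<in>wts. Polynomial.smult (wproj \<nu> $$ (r, c)) ([:1, 1:] ^ \<nu> i)) 1"
  proof (rule near_one_unique[OF mat_unit_carrier rc])
    fix s
    have "1\<^sub>m m + s \<cdot>\<^sub>m mat_unit m i i = mat_diag m (\<lambda>a. if a = i then 1 + s else 1)"
      by (rule eq_matI) (auto simp: mat_unit_def mat_diag_def)
    moreover have "tpow m (\<lambda>a. if a = i then 1 + s else 1) \<nu> = (1 + s) ^ \<nu> i" for \<nu>
    proof -
      have "tpow m (\<lambda>a. if a = i then 1 + s else 1) \<nu> = (\<Prod>a<m. if a = i then (1 + s) ^ \<nu> a else 1)"
        unfolding tpow_def by (intro prod.cong) auto
      then show ?thesis using i by simp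
    qed
    ultimately show "polyext (1\<^sub>m m + s \<cdot>\<^sub>m mat_unit m i i) $$ (r, c) =
        poly (\<Sum>\<nu>\<in>wts. Polynomial.smult (wproj \<nu> $$ (r, c)) ([:1, 1:] ^ \<nu> i)) s"
      using rc by (simp add: polyext_torus msum_def poly_sum mult.commute)
  qed
  also have "\<dots> = msum (\<lambda>\<nu>. of_nat (\<nu> i)) $$ (r, c)"
    using rc unfolding coeff_sum coeff_smult coeff_one_plus_power by (simp add: msum_def mult.commute)
  finally show "lie (mat_unit m i i) $$ (r, c) = msum (\<lambda>\<nu>. of_nat (\<nu> i)) $$ (r, c)" .
qed (auto simp: msum_def)

text \<open>A vector of weight \<open>\<nu>\<close> lies in the range of the projection for
\<open>\<nu>\<close>, and vanishes if \<open>\<nu>\<close> is not among the weights. Both cases are contained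
in this sum over at most one index. As \<open>\<nu>\<close> may have negative entries, all exponents are first
raised by a common amount \<open>N\<close>, which allows coefficients of monomials to be compared.\<close>

lemma weight_vector_projections:
  assumes w: "w \<in> weight_space m (d, rho) \<nu>" and r: "r < d"
  shows "(\<Sum>\<eta>\<in>{\<eta> \<in> wts. \<forall>i<m. int (\<eta> i) = \<nu> i}. (wproj \<eta> *\<^sub>v w) $ r) = w $ r"
proof -
  \<comment> \<open>\<open>sh\<close> shifts exponents by \<open>N\<close>, and \<open>\<mu>\<close> is the shift of \<open>\<nu>\<close>\<close>
  define N where "N = (\<Sum>i<m. nat \<bar>\<nu> i\<bar>)"
  define sh where "sh = (\<lambda>\<eta> :: nat \<Rightarrow> nat. \<lambda>i. if i < m then \<eta> i + N else 0)"
  define \<mu> where "\<mu> = (\<lambda>i. if i < m then nat (\<nu> i + int N) else 0)"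
  have N: "\<nu> i + int N \<ge> 0" if "i < m" for i
  proof -
    have "nat \<bar>\<nu> i\<bar> \<le> N" unfolding N_def using that by (intro member_le_sum) auto
    then show ?thesis by linarith
  qed
  have wc: "w \<in> carrier_vec d" using w by (simp add: weight_space_def)
  define T where "T = insert \<mu> (sh ` wts)"
  define e where "e = (\<lambda>\<zeta>. (\<Sum>\<eta>\<in>{\<eta> \<in> wts. sh \<eta> = \<zeta>}. (wproj \<eta> *\<^sub>v w) $ r) - (if \<zeta> = \<mu> then w $ r else 0))"
  have fin: "finite T" using finite_wts by (simp add: T_def)
  have "e \<mu> = 0"
  proof (rule monomials_independent[OF fin, where m = m and c = e and \<nu> = \<mu>])
    show "T \<subseteq> exponents m" by (auto simp: T_def exponents_def \<mu>_def sh_def)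
    show "\<mu> \<in> T" by (simp add: T_def)
    fix t :: "nat \<Rightarrow> complex" assume t: "\<And>i. i < m \<Longrightarrow> t i \<noteq> 0"
    define s where "s = (\<Prod>i<m. t i ^ N)"
    have tsh: "tpow m t (sh \<eta>) = s * tpow m t \<eta>" for \<eta>
      by (simp add: tpow_def sh_def s_def power_add prod.distrib mult.commute)
    have t\<mu>: "tpow m t \<mu> = s * (\<Prod>i<m. t i powi \<nu> i)"
      unfolding tpow_def s_def prod.distrib[symmetric]
    proof (intro prod.cong refl)
      fix i assume "i \<in> {..<m}"
      then have i: "i < m" by simp
      have "t i ^ \<mu> i = t i powi (\<nu> i + int N)"
        using N[OF i] i by (simp add: \<mu>_def power_int_def)
      also have "\<dots> = t i ^ N * t i powi \<nu> i" using t[OF i] by (simp add: power_int_add)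
      finally show "t i ^ \<mu> i = t i ^ N * t i powi \<nu> i" .
    qed
    have det: "det (mat_diag m t) = (\<Prod>i<m. t i)"
      by (subst det_lower_triangular[of m]) (auto simp: mat_diag_def prod_list_diag_prod atLeast0LessThan)
    then have GL: "mat_diag m t \<in> GL m" using t by (simp add: GL_iff_det)
    have "rho (mat_diag m t) *\<^sub>v w = (\<Prod>i<m. (mat_diag m t) $$ (i, i) powi \<nu> i) \<cdot>\<^sub>v w"
      using w GL by (simp add: weight_space_def diagonal_mat_def mat_diag_def)
    also have "(\<Prod>i<m. (mat_diag m t) $$ (i, i) powi \<nu> i) = (\<Prod>i<m. t i powi \<nu> i)"
      by (intro prod.cong) (auto simp: mat_diag_def)
    finally have "msum (tpow m t) *\<^sub>v w = (\<Prod>i<m. t i powi \<nu> i) \<cdot>\<^sub>v w"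
      using polyext_GL[OF GL] by (simp add: polyext_torus)
    then have "(msum (tpow m t) *\<^sub>v w) $ r = (\<Prod>i<m. t i powi \<nu> i) * w $ r"
      using wc r by simp
    moreover have "(msum (tpow m t) *\<^sub>v w) $ r = (\<Sum>\<eta>\<in>wts. tpow m t \<eta> * (wproj \<eta> *\<^sub>v w) $ r)"
    proof -
      have "(msum (tpow m t) *\<^sub>v w) $ r = (\<Sum>l<d. (\<Sum>\<eta>\<in>wts. tpow m t \<eta> * wproj \<eta> $$ (r, l)) * w $ l)"
        using wc r by (simp add: msum_def scalar_prod_def atLeast0LessThan)
      also have "\<dots> = (\<Sum>\<eta>\<in>wts. \<Sum>l<d. tpow m t \<eta> * wproj \<eta> $$ (r, l) * w $ l)"
        unfolding sum_distrib_right by (rule sum.swap)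
      also have "\<dots> = (\<Sum>\<eta>\<in>wts. tpow m t \<eta> * (wproj \<eta> *\<^sub>v w) $ r)"
      proof (intro sum.cong refl)
        fix \<eta>
        show "(\<Sum>l<d. tpow m t \<eta> * wproj \<eta> $$ (r, l) * w $ l) = tpow m t \<eta> * (wproj \<eta> *\<^sub>v w) $ r"
          using wc r wproj_carrier[of \<eta>] by (auto simp: scalar_prod_def atLeast0LessThan sum_distrib_left mult_ac)
      qed
      finally show ?thesis .
    qed
    ultimately have main: "(\<Sum>\<eta>\<in>wts. tpow m t \<eta> * (wproj \<eta> *\<^sub>v w) $ r) = (\<Prod>i<m. t i powi \<nu> i) * w $ r" by simp
    have "(\<Sum>\<zeta>\<in>T. e \<zeta> * tpow m t \<zeta>) =
       (\<Sum>\<zeta>\<in>T. \<Sum>\<eta>\<in>{\<eta> \<in> wts. sh \<eta> = \<zeta>}. (wproj \<eta> *\<^sub>v w) $ r * tpow m t (sh \<eta>)) - (\<Sum>\<zeta>\<in>T. if \<zeta> = \<mu> then w $ r * tpow m t \<zeta> else 0)"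
      unfolding sum_subtractf[symmetric] e_def
      by (intro sum.cong refl) (auto simp: left_diff_distrib sum_distrib_right)
    also have "(\<Sum>\<zeta>\<in>T. \<Sum>\<eta>\<in>{\<eta> \<in> wts. sh \<eta> = \<zeta>}. (wproj \<eta> *\<^sub>v w) $ r * tpow m t (sh \<eta>)) =
       (\<Sum>\<eta>\<in>wts. (wproj \<eta> *\<^sub>v w) $ r * tpow m t (sh \<eta>))"
      by (intro sum.group finite_wts fin) (auto simp: T_def)
    also have "\<dots> = s * ((\<Prod>i<m. t i powi \<nu> i) * w $ r)"
      unfolding main[symmetric] tsh by (simp add: sum_distrib_left mult_ac)
    also have "(\<Sum>\<zeta>\<in>T. if \<zeta> = \<mu> then w $ r * tpow m t \<zeta> else 0) = w $ r * tpow m t \<mu>"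
      using fin by (simp add: T_def)
    finally show "(\<Sum>\<zeta>\<in>T. e \<zeta> * tpow m t \<zeta>) = 0" by (simp add: t\<mu>)
  qed
  moreover have "{\<eta> \<in> wts. sh \<eta> = \<mu>} = {\<eta> \<in> wts. \<forall>i<m. int (\<eta> i) = \<nu> i}"
  proof -
    have "sh \<eta> = \<mu> \<longleftrightarrow> (\<forall>i<m. int (\<eta> i) = \<nu> i)" for \<eta>
    proof
      assume h: "sh \<eta> = \<mu>"
      show "\<forall>i<m. int (\<eta> i) = \<nu> i"
      proof (intro allI impI)
        fix i assume "i < m"
        then have "\<eta> i + N = nat (\<nu> i + int N)" using fun_cong[OF h, of i] by (simp add: sh_def \<mu>_def)
        then show "int (\<eta> i) = \<nu> i" using N[OF \<open>i < m\<close>] by linarith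
      qed
    next
      assume h: "\<forall>i<m. int (\<eta> i) = \<nu> i"
      show "sh \<eta> = \<mu>"
      proof
        fix i show "sh \<eta> i = \<mu> i"
          using h[rule_format, of i, symmetric] by (auto simp: sh_def \<mu>_def nat_int_add)
      qed
    qed
    then show ?thesis by blast
  qed
  ultimately show ?thesis by (simp add: e_def)
qed

lemma weight_multiplicity_eq:
  assumes \<kappa>: "\<kappa> \<in> wts" and \<nu>: "\<And>i. i < m \<Longrightarrow> \<nu> i = int (\<kappa> i)"
  shows "of_nat (weight_multiplicity m (d, rho) \<nu>) = mat_trace (wproj \<kappa>)"
proof -
  have "weight_space m (d, rho) \<nu> = {w \<in> carrier_vec d. wproj \<kappa> *\<^sub>v w = w}"
  proof (intro equalityI subsetI)
    fix w assume w: "w \<in> weight_space m (d, rho) \<nu>"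
    have "{\<eta> \<in> wts. \<forall>i<m. int (\<eta> i) = \<nu> i} = {\<kappa>}"
      using \<kappa> \<nu> wts_exponents by (auto intro: exponents_eqI[of _ m])
    moreover have wc: "w \<in> carrier_vec d" using w by (simp add: weight_space_def)
    ultimately have "wproj \<kappa> *\<^sub>v w = w"
      using weight_vector_projections[OF w] wproj_carrier[of \<kappa>] by (intro eq_vecI) auto
    then show "w \<in> {w \<in> carrier_vec d. wproj \<kappa> *\<^sub>v w = w}" using wc by simp
  next
    fix w assume "w \<in> {w \<in> carrier_vec d. wproj \<kappa> *\<^sub>v w = w}"
    then have w: "w \<in> carrier_vec d" "wproj \<kappa> *\<^sub>v w = w" by auto
    have "rho T *\<^sub>v w = (\<Prod>i<m. T $$ (i, i) powi \<nu> i) \<cdot>\<^sub>v w" if T: "T \<in> GL m" "diagonal_mat T" for T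
    proof -
      let ?t = "\<lambda>i. T $$ (i, i)"
      have Tc: "T \<in> carrier_mat m m" using T by (simp add: GL_def)
      have Td: "T = mat_diag m ?t"
        using T Tc by (intro eq_matI) (auto simp: mat_diag_def diagonal_mat_def)
      have "rho T *\<^sub>v w = polyext (mat_diag m ?t) *\<^sub>v (wproj \<kappa> *\<^sub>v w)" using w polyext_GL[OF T(1)] Td by metis
      also have "\<dots> = (polyext (mat_diag m ?t) * wproj \<kappa>) *\<^sub>v w"
        using w by (intro assoc_mult_mat_vec[of _ d d _ d, symmetric]) auto
      also have "\<dots> = tpow m ?t \<kappa> \<cdot>\<^sub>v w"
        unfolding polyext_torus_wproj[OF \<kappa>] using w smult_mult_mat_vec[OF wproj_carrier w(1)] by simp
      also have "tpow m ?t \<kappa> = (\<Prod>i<m. T $$ (i, i) powi \<nu> i)"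
        unfolding tpow_def by (intro prod.cong) (auto simp: \<nu>)
      finally show ?thesis .
    qed
    then show "w \<in> weight_space m (d, rho) \<nu>" using w by (simp add: weight_space_def)
  qed
  then show ?thesis
    using dim_idempotent_range[OF wproj_carrier, of \<kappa>] wproj_mult[OF \<kappa> \<kappa>] by (simp add: weight_multiplicity_def)
qed

lemma weight_multiplicity_zero:
  assumes "\<And>\<kappa>. \<kappa> \<in> wts \<Longrightarrow> \<exists>i<m. \<nu> i \<noteq> int (\<kappa> i)"
  shows "weight_multiplicity m (d, rho) \<nu> = 0"
proof -
  have "weight_space m (d, rho) \<nu> = {w \<in> carrier_vec d. (0\<^sub>m d d :: complex mat) *\<^sub>v w = w}"
  proof (intro equalityI subsetI)
    fix w assume w: "w \<in> weight_space m (d, rho) \<nu>"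
    have wc: "w \<in> carrier_vec d" using w by (simp add: weight_space_def)
    have none: "{\<eta> \<in> wts. \<forall>i<m. int (\<eta> i) = \<nu> i} = {}" using assms by force
    have "w $ r = 0" if "r < d" for r using weight_vector_projections[OF w that] unfolding none by simp
    then show "w \<in> {w \<in> carrier_vec d. 0\<^sub>m d d *\<^sub>v w = w}" using wc by (auto intro!: eq_vecI)
  next
    fix w :: "complex vec" assume "w \<in> {w \<in> carrier_vec d. 0\<^sub>m d d *\<^sub>v w = w}"
    then have w0: "w \<in> carrier_vec d" "0\<^sub>m d d *\<^sub>v w = w" by auto
    have "0\<^sub>m d d *\<^sub>v w = 0\<^sub>v d" using w0(1) by (intro eq_vecI) (auto simp: scalar_prod_def)
    then have w: "w \<in> carrier_vec d" "w = 0\<^sub>v d" using w0 by auto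
    have "rho T *\<^sub>v w = (\<Prod>i<m. T $$ (i, i) powi \<nu> i) \<cdot>\<^sub>v w" if T: "T \<in> GL m" for T
      using polyext_GL[OF T, symmetric] polyext_carrier[of T] w(2) by (auto intro!: eq_vecI)
    then show "w \<in> weight_space m (d, rho) \<nu>" using w by (simp add: weight_space_def)
  qed
  then have "of_nat (weight_multiplicity m (d, rho) \<nu>) = mat_trace (0\<^sub>m d d :: complex mat)"
    using dim_idempotent_range[of "0\<^sub>m d d" d] by (simp add: weight_multiplicity_def)
  then show ?thesis by (simp add: mat_trace_def)
qed

text \<open>Permutation matrices conjugate the torus to itself by permuting its coordinates.\<close>

lemma mat_trace_torus_permute:
  assumes p: "p permutes {..<m}"
  shows "mat_trace (polyext (mat_diag m (\<lambda>i. t (p i)))) = mat_trace (polyext (mat_diag m t))"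
proof -
  define P where "P = mat m m (\<lambda>(i, j). if j = p i then 1 else 0 :: complex)"
  define Q where "Q = mat m m (\<lambda>(i, j). if i = p j then 1 else 0 :: complex)"
  have c: "P \<in> carrier_mat m m" "Q \<in> carrier_mat m m" by (auto simp: P_def Q_def)
  have pm: "p i < m" if "i < m" for i using permutes_in_image[OF p, of i] that by simp
  have PQ: "P * Q = 1\<^sub>m m"
  proof (rule eq_matI)
    fix i j assume "i < dim_row (1\<^sub>m m :: complex mat)" "j < dim_col (1\<^sub>m m :: complex mat)"
    then have ij: "i < m" "j < m" by auto
    have "(P * Q) $$ (i, j) = (\<Sum>l<m. (if l = p i then 1 else 0) * (if l = p j then 1 else 0))"
      using ij c by (simp add: mat_mult_entry[of _ m m _ m] P_def Q_def del: index_mult_mat(1))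
    also have "\<dots> = (\<Sum>l<m. if l = p i then (if l = p j then 1 else 0) else 0)" by (intro sum.cong) auto
    also have "\<dots> = (if p i = p j then 1 else 0)" using pm[OF ij(1)] by (simp only: sum.delta finite_lessThan lessThan_iff if_True)
    finally show "(P * Q) $$ (i, j) = 1\<^sub>m m $$ (i, j)" using ij permutes_inj[OF p] by (simp add: inj_eq)
  qed (use c in auto)
  have QP: "Q * P = 1\<^sub>m m" by (rule mat_mult_left_right_inverse[OF c PQ])
  have "P * mat_diag m t = mat_diag m (\<lambda>i. t (p i)) * P"
    by (subst mat_diag_mult_right[OF c(1)], subst mat_diag_mult_left[OF c(1)]) (auto simp: P_def)
  then have "mat_diag m (\<lambda>i. t (p i)) = P * (mat_diag m t * Q)"
    using c PQ assoc_mult_mat[of P m m "mat_diag m t" m Q m] assoc_mult_mat[of "mat_diag m (\<lambda>i. t (p i))" m m P m Q m]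
      right_mult_one_mat[of "mat_diag m (\<lambda>i. t (p i))" m m]
    by simp
  then have "polyext (mat_diag m (\<lambda>i. t (p i))) = polyext P * (polyext (mat_diag m t) * polyext Q)"
    using c polyext_mult by (metis mat_diag_dim mult_carrier_mat)
  then have "mat_trace (polyext (mat_diag m (\<lambda>i. t (p i)))) = mat_trace ((polyext (mat_diag m t) * polyext Q) * polyext P)"
    using mat_trace_comm[OF polyext_carrier mult_carrier_mat[OF polyext_carrier polyext_carrier], of P "mat_diag m t" Q] by simp
  also have "(polyext (mat_diag m t) * polyext Q) * polyext P = polyext (mat_diag m t) * polyext (Q * P)"
    using c by (simp add: polyext_mult assoc_mult_mat[of _ d d _ d _ d])
  also have "\<dots> = polyext (mat_diag m t)" unfolding QP by simp
  finally show ?thesis .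
qed

definition wmult :: "(nat \<Rightarrow> nat) \<Rightarrow> complex" where
  "wmult \<nu> = (if \<nu> \<in> wts then mat_trace (wproj \<nu>) else 0)"

lemma mat_trace_ext_torus: "mat_trace (polyext (mat_diag m t)) = (\<Sum>\<nu>\<in>wts. wmult \<nu> * tpow m t \<nu>)"
  unfolding polyext_torus mat_trace_msum by (auto simp: wmult_def mult.commute intro!: sum.cong)

text \<open>The character is a symmetric function of the torus coordinates; compare coefficients.\<close>

lemma wmult_permute:
  assumes p: "p permutes {..<m}"
  shows "wmult (\<nu> \<circ> p) = wmult \<nu>"
proof (cases "\<nu> \<in> exponents m")
  case \<nu>: True
  define T where "T = {\<eta> \<in> exponents m. \<eta> \<in> wts \<or> \<eta> \<circ> p \<in> wts}"
  define r where "r = inv_into UNIV p"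
  have r: "r permutes {..<m}" "p (r i) = i" "r (p i) = i" for i
    using permutes_inv[OF p] permutes_inverses[OF p] by (auto simp: r_def)
  have pm: "p i < m \<longleftrightarrow> i < m" for i using permutes_in_image[OF p, of i] by simp
  have comp_exp: "\<eta> \<circ> p \<in> exponents m \<longleftrightarrow> \<eta> \<in> exponents m" for \<eta>
    unfolding exponents_def using pm r(2) by (auto simp: not_less[symmetric]) metis
  have bij: "bij_betw (\<lambda>\<eta>. \<eta> \<circ> p) {\<eta> \<in> exponents m. \<eta> \<circ> p \<in> wts} wts"
  proof (rule bij_betwI[where g = "\<lambda>\<eta>. \<eta> \<circ> r"])
    show "(\<lambda>\<eta>. \<eta> \<circ> r) \<in> wts \<rightarrow> {\<eta> \<in> exponents m. \<eta> \<circ> p \<in> wts}"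
    proof
      fix \<eta> assume "\<eta> \<in> wts"
      moreover have "(\<eta> \<circ> r) \<circ> p = \<eta>" using r by (auto simp: comp_def)
      ultimately show "\<eta> \<circ> r \<in> {\<eta> \<in> exponents m. \<eta> \<circ> p \<in> wts}"
        using wts_exponents comp_exp[of "\<eta> \<circ> r"] by auto
    qed
  qed (auto simp: comp_def r)
  have finT: "finite T"
  proof -
    have "T \<subseteq> wts \<union> {\<eta> \<in> exponents m. \<eta> \<circ> p \<in> wts}" by (auto simp: T_def)
    moreover have "finite {\<eta> \<in> exponents m. \<eta> \<circ> p \<in> wts}" using bij_betw_finite[OF bij] finite_wts by simp
    ultimately show ?thesis using finite_wts finite_subset by blast
  qed
  show ?thesis
  proof (cases "\<nu> \<in> T")
    case True
    have "wmult (\<nu> \<circ> p) - wmult \<nu> = 0"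
    proof (rule monomials_independent[OF finT _ _ True, of m])
      show "T \<subseteq> exponents m" by (auto simp: T_def)
      fix t :: "nat \<Rightarrow> complex"
      have "(\<Sum>\<eta>\<in>T. wmult \<eta> * tpow m t \<eta>) = (\<Sum>\<eta>\<in>wts. wmult \<eta> * tpow m t \<eta>)"
        using finT wts_exponents by (intro sum.mono_neutral_right) (auto simp: T_def wmult_def)
      also have "\<dots> = mat_trace (polyext (mat_diag m (\<lambda>i. t (p i))))"
        unfolding mat_trace_torus_permute[OF p] by (rule mat_trace_ext_torus[symmetric])
      also have "\<dots> = (\<Sum>\<eta>\<in>wts. wmult \<eta> * tpow m (\<lambda>i. t (p i)) \<eta>)" by (rule mat_trace_ext_torus)
      also have "\<dots> = (\<Sum>\<eta>\<in>{\<eta> \<in> exponents m. \<eta> \<circ> p \<in> wts}. wmult (\<eta> \<circ> p) * tpow m (\<lambda>i. t (p i)) (\<eta> \<circ> p))"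
        by (rule sum.reindex_bij_betw[OF bij, symmetric])
      also have "\<dots> = (\<Sum>\<eta>\<in>T. wmult (\<eta> \<circ> p) * tpow m (\<lambda>i. t (p i)) (\<eta> \<circ> p))"
        using finT by (intro sum.mono_neutral_left) (auto simp: T_def wmult_def)
      also have "\<dots> = (\<Sum>\<eta>\<in>T. wmult (\<eta> \<circ> p) * tpow m t \<eta>)"
      proof (intro sum.cong refl)
        fix \<eta>
        have "tpow m (\<lambda>i. t (p i)) (\<eta> \<circ> p) = tpow m t \<eta>"
          unfolding tpow_def using prod.permute[OF p, of "\<lambda>i. t i ^ \<eta> i"] by (simp add: comp_def)
        then show "wmult (\<eta> \<circ> p) * tpow m (\<lambda>i. t (p i)) (\<eta> \<circ> p) = wmult (\<eta> \<circ> p) * tpow m t \<eta>" by simp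
      qed
      finally show "(\<Sum>\<eta>\<in>T. (wmult (\<eta> \<circ> p) - wmult \<eta>) * tpow m t \<eta>) = 0"
        by (simp add: left_diff_distrib sum_subtractf)
    qed
    then show ?thesis by simp
  next
    case False
    then show ?thesis using \<nu> by (auto simp: T_def wmult_def)
  qed
next
  case False
  have "\<nu> \<circ> p \<notin> exponents m"
  proof
    assume "\<nu> \<circ> p \<in> exponents m"
    moreover have "p i = i" if "i \<ge> m" for i using permutes_not_in[OF p, of i] that by simp
    ultimately have "\<nu> \<in> exponents m" by (auto simp: exponents_def)
    then show False using False by simp
  qed
  then show ?thesis using False wts_exponents by (auto simp: wmult_def)
qed

end

section \<open>Highest weight theory of an irreducible representation\<close>

definition lower_unitriangular :: "nat \<Rightarrow> complex mat \<Rightarrow> bool" where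
  "lower_unitriangular m L \<longleftrightarrow> L \<in> carrier_mat m m \<and>
     (\<forall>i<m. \<forall>j<m. i < j \<longrightarrow> L $$ (i, j) = 0) \<and> (\<forall>i<m. L $$ (i, i) = 1)"

text \<open>One step of Gaussian elimination at most triples the distance to the identity.\<close>

lemma schur_complement_bound:
  fixes D a b c :: complex and \<epsilon> :: real
  assumes "cmod D \<le> \<epsilon>" "cmod (a - 1) \<le> \<epsilon>" "cmod b \<le> \<epsilon>" "cmod c \<le> \<epsilon>" "\<epsilon> \<le> 1/6"
  shows "cmod (D - c * b / a) \<le> 3 * \<epsilon>"
proof -
  have e: "\<epsilon> \<ge> 0" using assms(1) norm_ge_zero order_trans by blast
  have "cmod 1 \<le> cmod a + cmod (1 - a)" by (metis add.commute diff_add_cancel norm_triangle_ineq)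
  then have a: "cmod a \<ge> 1/2" using assms(2,5) by (simp add: norm_minus_commute)
  have "cmod (c * b / a) \<le> \<epsilon> * \<epsilon> / (1/2)"
    unfolding norm_divide norm_mult using assms a e by (intro frac_le mult_mono) auto
  also have "\<dots> \<le> \<epsilon>" using mult_left_mono[OF assms(5) e] e by simp
  finally have "cmod (D - c * b / a) \<le> \<epsilon> + \<epsilon>" using assms(1) norm_triangle_ineq4[of D "c * b / a"] by linarith
  then show ?thesis using e by simp
qed

text \<open>Gaussian elimination without pivoting, by induction on the Schur complement of the first entry.
The tolerance contains the factor \<open>3 ^ m\<close> because each step may triple the deviation.\<close>

lemma lu_near_identity:
  assumes "A \<in> carrier_mat m m"
    and "\<And>i j. i < m \<Longrightarrow> j < m \<Longrightarrow> cmod (A $$ (i, j) - (if i = j then 1 else 0)) \<le> 1 / (2 * 3 ^ m)"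
  shows "\<exists>L U. lower_unitriangular m L \<and> U \<in> GL m \<and> upper_triangular U \<and> A = L * U"
  using assms
proof (induction m arbitrary: A)
  case 0
  then show ?case
    by (intro exI[of _ "1\<^sub>m 0"]) (auto simp: lower_unitriangular_def GL_iff_det upper_triangular_def intro!: eq_matI)
next
  case (Suc m)
  define \<epsilon> :: real where "\<epsilon> = 1 / (2 * 3 ^ Suc m)"
  have e: "\<epsilon> > 0" "\<epsilon> \<le> 1/6" by (auto simp: \<epsilon>_def field_simps)
  define a where "a = A $$ (0, 0)"
  have a1: "cmod (a - 1) \<le> \<epsilon>" using Suc.prems(2)[of 0 0] by (simp add: a_def \<epsilon>_def)
  have a0: "a \<noteq> 0" using a1 e by auto
  define S where "S = mat m m (\<lambda>(i, j). A $$ (Suc i, Suc j) - A $$ (Suc i, 0) * A $$ (0, Suc j) / a)"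
  have "\<exists>L U. lower_unitriangular m L \<and> U \<in> GL m \<and> upper_triangular U \<and> S = L * U"
  proof (rule Suc.IH)
    show "S \<in> carrier_mat m m" by (simp add: S_def)
    fix i j assume ij: "i < m" "j < m"
    let ?D = "A $$ (Suc i, Suc j) - (if i = j then 1 else 0)"
    have "cmod (?D - A $$ (Suc i, 0) * A $$ (0, Suc j) / a) \<le> 3 * \<epsilon>"
      using Suc.prems(2)[of "Suc i" "Suc j"] Suc.prems(2)[of "Suc i" 0] Suc.prems(2)[of 0 "Suc j"] ij a1 e
      by (intro schur_complement_bound) (auto simp: \<epsilon>_def split: if_splits)
    moreover have "?D - A $$ (Suc i, 0) * A $$ (0, Suc j) / a = S $$ (i, j) - (if i = j then 1 else 0)"
      using ij by (simp add: S_def)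
    ultimately show "cmod (S $$ (i, j) - (if i = j then 1 else 0)) \<le> 1 / (2 * 3 ^ m)"
      by (simp add: \<epsilon>_def)
  qed
  then obtain L' U' where L': "lower_unitriangular m L'" and U': "U' \<in> GL m" "upper_triangular U'" and S: "S = L' * U'"
    by blast
  have c': "L' \<in> carrier_mat m m" "U' \<in> carrier_mat m m" using L' U' by (auto simp: lower_unitriangular_def GL_def)
  define L where "L = mat (Suc m) (Suc m) (\<lambda>(i, j). if i = 0 then (if j = 0 then 1 else 0)
     else if j = 0 then A $$ (i, 0) / a else L' $$ (i - 1, j - 1))"
  define U where "U = mat (Suc m) (Suc m) (\<lambda>(i, j). if i = 0 then A $$ (0, j)
     else if j = 0 then 0 else U' $$ (i - 1, j - 1))"
  have "lower_unitriangular (Suc m) L"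
    using L' unfolding lower_unitriangular_def L_def by (auto simp: less_Suc_eq_0_disj)
  moreover have Ut: "upper_triangular U"
    using U'(2) c' unfolding upper_triangular_def U_def by (auto simp: less_Suc_eq_0_disj)
  moreover have "det U \<noteq> 0"
  proof -
    have Uc: "U \<in> carrier_mat (Suc m) (Suc m)" by (simp add: U_def)
    have "det U = (\<Prod>i = 0..<Suc m. U $$ (i, i))"
      using det_upper_triangular[OF Ut Uc] Uc by (simp add: prod_list_diag_prod)
    also have "\<dots> = a * (\<Prod>i = 0..<m. U' $$ (i, i))"
      by (subst prod.atLeast0_lessThan_Suc_shift) (simp add: U_def a_def)
    also have "(\<Prod>i = 0..<m. U' $$ (i, i)) = det U'"
      using det_upper_triangular[OF U'(2) c'(2)] c' by (simp add: prod_list_diag_prod)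
    finally show ?thesis using a0 U'(1) by (simp add: GL_iff_det)
  qed
  then have "U \<in> GL (Suc m)" by (simp add: GL_iff_det U_def)
  moreover have "A = L * U"
  proof (rule eq_matI)
    fix i j assume "i < dim_row (L * U)" "j < dim_col (L * U)"
    then have ij: "i < Suc m" "j < Suc m" by (auto simp: L_def U_def)
    have "(L * U) $$ (i, j) = (\<Sum>l<Suc m. L $$ (i, l) * U $$ (l, j))"
      using ij by (intro mat_mult_entry) (auto simp: L_def U_def)
    also have "\<dots> = L $$ (i, 0) * U $$ (0, j) + (\<Sum>l<m. L $$ (i, Suc l) * U $$ (Suc l, j))"
      by (rule sum.lessThan_Suc_shift)
    also have "\<dots> = A $$ (i, j)"
    proof (cases "i = 0")
      case True
      then show ?thesis using ij by (simp add: L_def U_def)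
    next
      case False
      then obtain i' where i': "i = Suc i'" "i' < m" using ij by (cases i) auto
      show ?thesis
      proof (cases "j = 0")
        case True
        then show ?thesis using i' a0 by (simp add: L_def U_def a_def)
      next
        case False
        then obtain j' where j': "j = Suc j'" "j' < m" using ij by (cases j) auto
        have "S $$ (i', j') = (\<Sum>l<m. L' $$ (i', l) * U' $$ (l, j'))"
          unfolding S using c' i' j' by (intro mat_mult_entry) auto
        then show ?thesis using i' j' by (simp add: L_def U_def S_def diff_eq_eq add.commute)
      qed
    qed
    finally show "A $$ (i, j) = (L * U) $$ (i, j)" by simp
  qed (use Suc.prems(1) in \<open>auto simp: L_def U_def\<close>)
  ultimately show ?case by blast
qed

locale gl_irrep = polynomial_gl_rep +
  fixes mu :: "nat list"
  assumes irr: "irreducible_rep m (d, rho)"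
    and hw: "has_highest_weight m (d, rho) mu"
begin

definition hv :: "complex vec" where
  "hv = (SOME v. v \<in> carrier_vec d \<and> v \<noteq> 0\<^sub>v d \<and> (\<forall>B\<in>GL m. upper_triangular B \<longrightarrow>
           rho B *\<^sub>v v = (\<Prod>i<m. (B $$ (i, i)) ^ (mu ! i)) \<cdot>\<^sub>v v))"

lemma hv: "hv \<in> carrier_vec d" "hv \<noteq> 0\<^sub>v d"
  "B \<in> GL m \<Longrightarrow> upper_triangular B \<Longrightarrow> polyext B *\<^sub>v hv = (\<Prod>i<m. (B $$ (i, i)) ^ (mu ! i)) \<cdot>\<^sub>v hv"
proof -
  have "\<exists>v. v \<in> carrier_vec d \<and> v \<noteq> 0\<^sub>v d \<and> (\<forall>B\<in>GL m. upper_triangular B \<longrightarrow>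
           rho B *\<^sub>v v = (\<Prod>i<m. (B $$ (i, i)) ^ (mu ! i)) \<cdot>\<^sub>v v)"
    using hw by (auto simp: has_highest_weight_def)
  then have h: "hv \<in> carrier_vec d \<and> hv \<noteq> 0\<^sub>v d \<and> (\<forall>B\<in>GL m. upper_triangular B \<longrightarrow>
           rho B *\<^sub>v hv = (\<Prod>i<m. (B $$ (i, i)) ^ (mu ! i)) \<cdot>\<^sub>v hv)"
    unfolding hv_def by (rule someI_ex)
  then show "hv \<in> carrier_vec d" "hv \<noteq> 0\<^sub>v d" by auto
  show "B \<in> GL m \<Longrightarrow> upper_triangular B \<Longrightarrow> polyext B *\<^sub>v hv = (\<Prod>i<m. (B $$ (i, i)) ^ (mu ! i)) \<cdot>\<^sub>v hv"
    using h polyext_GL[of B] by simp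
qed

lemma polyext_vec_closed [simp]: "w \<in> carrier_vec d \<Longrightarrow> polyext A *\<^sub>v w \<in> carrier_vec d"
  by (rule mult_mat_vec_carrier[OF polyext_carrier])

lemma invariant_subspace_total:
  assumes sub: "U \<subseteq> carrier_vec d"
    and add: "\<And>v w. v \<in> U \<Longrightarrow> w \<in> U \<Longrightarrow> v + w \<in> U"
    and scale: "\<And>a v. v \<in> U \<Longrightarrow> a \<cdot>\<^sub>v v \<in> U"
    and inv: "\<And>A v. A \<in> GL m \<Longrightarrow> v \<in> U \<Longrightarrow> polyext A *\<^sub>v v \<in> U"
    and v: "v \<in> U" "v \<noteq> 0\<^sub>v d"
  shows "U = carrier_vec d"
proof -
  have "0 \<cdot>\<^sub>v v = 0\<^sub>v d" using v(1) sub by (intro eq_vecI) auto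
  then have zero: "0\<^sub>v d \<in> U" using scale[OF v(1), of 0] by simp
  have "VectorSpace.subspace class_ring U (module_vec TYPE(complex) d)"
    unfolding VectorSpace.subspace_def submodule_def
    using vec_vs vec_module sub add scale zero by (auto simp: module_vec_simps)
  moreover have "\<forall>A\<in>GL m. \<forall>v\<in>U. rho A *\<^sub>v v \<in> U" using inv polyext_GL by metis
  ultimately have "U = {0\<^sub>v d} \<or> U = carrier_vec d" using irr by (auto simp: irreducible_rep_def)
  then show ?thesis using v by auto
qed

text \<open>The vectors whose whole orbit is annihilated form an invariant subspace, so irreducibility
applies.\<close>

lemma functional_vanishing_on_orbit:
  assumes l: "l \<in> carrier_vec d" and v: "v \<in> carrier_vec d" "v \<noteq> 0\<^sub>v d"
    and orbit: "\<And>g. g \<in> GL m \<Longrightarrow> l \<bullet> (polyext g *\<^sub>v v) = 0"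
    and w: "w \<in> carrier_vec d"
  shows "l \<bullet> w = 0"
proof -
  define U where "U = {w \<in> carrier_vec d. \<forall>g\<in>GL m. l \<bullet> (polyext g *\<^sub>v w) = 0}"
  have "U = carrier_vec d"
  proof (rule invariant_subspace_total[OF _ _ _ _ _ v(2)])
    show "U \<subseteq> carrier_vec d" by (auto simp: U_def)
    show "v \<in> U" using v(1) orbit by (simp add: U_def)
    show "v + w \<in> U" if "v \<in> U" "w \<in> U" for v w
      using that l by (auto simp: U_def mult_add_distrib_mat_vec[of _ d d] scalar_prod_add_distrib[of _ d])
    show "a \<cdot>\<^sub>v v \<in> U" if "v \<in> U" for a v
      using that l by (auto simp: U_def mult_mat_vec[of _ d d] scalar_prod_smult_right)
    show "polyext A *\<^sub>v v \<in> U" if A: "A \<in> GL m" and v: "v \<in> U" for A v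
    proof -
      have "l \<bullet> (polyext g *\<^sub>v (polyext A *\<^sub>v v)) = 0" if g: "g \<in> GL m" for g
      proof -
        have "polyext g *\<^sub>v (polyext A *\<^sub>v v) = polyext (g * A) *\<^sub>v v"
          using v polyext_mult[OF GL_carrier[OF g] GL_carrier[OF A]] assoc_mult_mat_vec[of "polyext g" d d "polyext A" d v]
          by (simp add: U_def)
        then show ?thesis using v GL_mult[OF g A] by (simp add: U_def)
      qed
      then show ?thesis using v by (simp add: U_def)
    qed
  qed
  then have "w \<in> U" using w by simp
  then have "l \<bullet> (polyext (1\<^sub>m m) *\<^sub>v w) = 0" using GL_one[of m] unfolding U_def by blast
  then show ?thesis using w by simp
qed

lemma poly_along_curve:
  assumes "poly_curve m m A" and M: "M \<in> carrier_mat d d" and r: "r < d" and w: "w \<in> carrier_vec d"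
  obtains p where "\<And>s. (M *\<^sub>v (polyext (A s) *\<^sub>v w)) $ r = poly p s"
proof -
  have "poly_curve d d (\<lambda>s. M * polyext (A s))"
    by (intro poly_curve_mult[of _ d] poly_curve_const M poly_curve_polyext assms(1))
  then have "\<forall>c<d. \<exists>p. \<forall>s. (M * polyext (A s)) $$ (r, c) = poly p s" using r by (auto simp: poly_curve_def)
  then obtain p where p: "\<forall>c<d. \<forall>s. (M * polyext (A s)) $$ (r, c) = poly (p c) s" by metis
  have "(M *\<^sub>v (polyext (A s) *\<^sub>v w)) $ r = poly (\<Sum>c<d. Polynomial.smult (w $ c) (p c)) s" for s
  proof -
    have "M *\<^sub>v (polyext (A s) *\<^sub>v w) = (M * polyext (A s)) *\<^sub>v w"
      using M w by (intro assoc_mult_mat_vec[symmetric, of _ d d _ d]) auto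
    moreover have "((M * polyext (A s)) *\<^sub>v w) $ r = (\<Sum>c<d. (M * polyext (A s)) $$ (r, c) * w $ c)"
      using M r w by (simp add: scalar_prod_def atLeast0LessThan)
    ultimately show ?thesis using p by (simp add: poly_sum mult.commute)
  qed
  then show ?thesis by (rule that)
qed

text \<open>Density of the big cell. Close to the identity a matrix factors as lower unitriangular times upper
triangular, and the upper factor only rescales the highest weight vector. So along the line from any group
element \<open>g\<close> to the identity, the value of the functional on the orbit vanishes near the identity;
being polynomial in the parameter, it vanishes at \<open>g\<close> too.\<close>

lemma functional_vanishing_on_unipotent_orbit:
  assumes M: "M \<in> carrier_mat d d" and r: "r < d"
    and van: "\<And>u. lower_unitriangular m u \<Longrightarrow> (M *\<^sub>v (polyext u *\<^sub>v hv)) $ r = 0"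
    and w: "w \<in> carrier_vec d"
  shows "(M *\<^sub>v w) $ r = 0"
proof -
  have row: "(M *\<^sub>v x) $ r = row M r \<bullet> x" for x using M r by simp
  have "row M r \<bullet> w = 0"
  proof (rule functional_vanishing_on_orbit[OF _ hv(1,2) _ w])
    show "row M r \<in> carrier_vec d" using M by auto
    fix g assume g: "g \<in> GL m"
    note gc = GL_carrier[OF g]
    obtain p where p: "\<And>s. (M *\<^sub>v (polyext (line_to_one m g s) *\<^sub>v hv)) $ r = poly p s"
      using poly_along_curve[OF poly_curve_line_to_one M r hv(1)] by blast
    \<comment> \<open>\<open>R\<close> bounds the direction of the line, so that the parameters \<open>s k\<close> below stay within the tolerance of the factorization\<close>
    define R where "R = 1 + (\<Sum>i<m. \<Sum>j<m. cmod ((if i = j then 1 else 0) - g $$ (i, j)))"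
    have R: "cmod ((if i = j then 1 else 0) - g $$ (i, j)) \<le> R" if "i < m" "j < m" for i j
    proof -
      have "cmod ((if i = j then 1 else 0) - g $$ (i, j)) \<le> (\<Sum>j<m. cmod ((if i = j then 1 else 0) - g $$ (i, j)))"
        using that by (intro member_le_sum) auto
      also have "\<dots> \<le> (\<Sum>i<m. \<Sum>j<m. cmod ((if i = j then 1 else 0) - g $$ (i, j)))"
        using that by (intro member_le_sum) (auto intro: sum_nonneg)
      finally show ?thesis by (simp add: R_def)
    qed
    have R1: "R \<ge> 1" by (simp add: R_def sum_nonneg)
    define f where "f = (\<lambda>k :: nat. 1 / (2 * 3 ^ m * R * (1 + real k)))"
    define s where "s = (\<lambda>k. 1 - complex_of_real (f k))"
    have root: "poly p (s k) = 0" for k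
    proof -
      define \<delta> where "\<delta> = f k"
      have \<delta>: "\<delta> \<ge> 0" "\<delta> * R \<le> 1 / (2 * 3 ^ m)"
      proof -
        show "\<delta> \<ge> 0" using R1 by (simp add: \<delta>_def f_def)
        have "\<delta> * R = 1 / (2 * 3 ^ m * (1 + real k))" using R1 by (simp add: \<delta>_def f_def)
        also have "\<dots> \<le> 1 / (2 * 3 ^ m)"
          using mult_left_mono[of 1 "1 + real k" "2 * 3 ^ m"] by (intro frac_le) auto
        finally show "\<delta> * R \<le> 1 / (2 * 3 ^ m)" .
      qed
      have "\<exists>L U. lower_unitriangular m L \<and> U \<in> GL m \<and> upper_triangular U \<and> line_to_one m g (s k) = L * U"
      proof (rule lu_near_identity)
        fix i j assume ij: "i < m" "j < m"
        have "line_to_one m g (s k) $$ (i, j) - (if i = j then 1 else 0) = - (of_real \<delta> * ((if i = j then 1 else 0) - g $$ (i, j)))"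
          using ij by (simp add: line_to_one_def s_def \<delta>_def algebra_simps)
        then have "cmod (line_to_one m g (s k) $$ (i, j) - (if i = j then 1 else 0)) = \<delta> * cmod ((if i = j then 1 else 0) - g $$ (i, j))"
          using \<delta>(1) by (simp add: norm_mult)
        also have "\<dots> \<le> \<delta> * R" using R[OF ij] \<delta>(1) by (rule mult_left_mono)
        finally show "cmod (line_to_one m g (s k) $$ (i, j) - (if i = j then 1 else 0)) \<le> 1 / (2 * 3 ^ m)"
          using \<delta>(2) by linarith
      qed (simp add: line_to_one_def)
      then obtain L U where LU: "lower_unitriangular m L" "U \<in> GL m" "upper_triangular U" "line_to_one m g (s k) = L * U"
        by blast
      have Lc: "L \<in> carrier_mat m m" using LU by (simp add: lower_unitriangular_def)
      define a where "a = (\<Prod>i<m. (U $$ (i, i)) ^ (mu ! i))"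
      have "polyext (line_to_one m g (s k)) *\<^sub>v hv = polyext L *\<^sub>v (polyext U *\<^sub>v hv)"
        unfolding LU(4) polyext_mult[OF Lc GL_carrier[OF LU(2)]] using hv(1) by (intro assoc_mult_mat_vec[of _ d d _ d]) auto
      also have "\<dots> = a \<cdot>\<^sub>v (polyext L *\<^sub>v hv)"
        unfolding hv(3)[OF LU(2,3)] a_def using hv(1) by (intro mult_mat_vec[of _ d d]) auto
      finally have "M *\<^sub>v (polyext (line_to_one m g (s k)) *\<^sub>v hv) = a \<cdot>\<^sub>v (M *\<^sub>v (polyext L *\<^sub>v hv))"
        using M hv(1) by (simp add: mult_mat_vec[of _ d d])
      then show ?thesis using p[of "s k"] van[OF LU(1)] M r by simp
    qed
    have "inj s"
    proof (rule injI)
      fix k k' assume "s k = s k'"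
      then have "f k = f k'" by (simp add: s_def)
      then show "k = k'" using R1 by (simp add: f_def)
    qed
    then have "infinite (range s)" by (rule range_inj_infinite)
    moreover have "range s \<subseteq> {s. poly p s = poly 0 s}" using root by auto
    ultimately have "p = 0" using infinite_super by (intro poly_eq_if_agree) blast
    then show "row M r \<bullet> (polyext g *\<^sub>v hv) = 0"
      using p[of 0] line_to_one_0[OF gc] by (simp add: row)
  qed
  then show ?thesis by (simp add: row)
qed

text \<open>The conjugate of a lower triangular matrix by \<open>diag(s ^ e 0, s ^ e 1, ...)\<close>. For
nondecreasing \<open>e\<close> only nonnegative powers of \<open>s\<close> occur below the diagonal, so
\<open>s = 0\<close> is allowed.\<close>

definition contract :: "(nat \<Rightarrow> nat) \<Rightarrow> complex mat \<Rightarrow> complex \<Rightarrow> complex mat" where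
  "contract e u s = mat m m (\<lambda>(i, j). if j \<le> i then u $$ (i, j) * s ^ (e i - e j) else 0)"

lemma poly_curve_contract: "poly_curve m m (contract e u)"
  unfolding poly_curve_def
proof (intro conjI allI impI)
  fix i j assume "i < m" "j < m"
  then show "\<exists>p. \<forall>s. contract e u s $$ (i, j) = poly p s"
    by (intro exI[of _ "if j \<le> i then monom (u $$ (i, j)) (e i - e j) else 0"]) (simp add: contract_def poly_monom)
qed (simp add: contract_def)

text \<open>Moving \<open>diag(s ^ e i)\<close> through \<open>u\<close> to the highest weight vector produces
the power of \<open>s\<close> given by the highest weight; moving it to the projection produces the power
given by \<open>\<kappa>\<close>. The two sides are equal as polynomials in \<open>s\<close>.\<close>

lemma torus_contraction:
  assumes mono: "\<And>i j. i \<le> j \<Longrightarrow> e i \<le> e j" and u: "lower_unitriangular m u"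
    and \<kappa>: "\<kappa> \<in> wts" and r: "r < d"
  shows "\<exists>q. (\<forall>s. (wproj \<kappa> *\<^sub>v (polyext (contract e u s) *\<^sub>v hv)) $ r = poly q s) \<and>
    monom ((wproj \<kappa> *\<^sub>v (polyext u *\<^sub>v hv)) $ r) (\<Sum>i<m. e i * \<kappa> i) = monom 1 (\<Sum>i<m. e i * mu ! i) * q"
proof -
  obtain q where q: "\<And>s. (wproj \<kappa> *\<^sub>v (polyext (contract e u s) *\<^sub>v hv)) $ r = poly q s"
    using poly_along_curve[OF poly_curve_contract wproj_carrier r hv(1)] by blast
  let ?x = "(wproj \<kappa> *\<^sub>v (polyext u *\<^sub>v hv)) $ r"
  have uc: "u \<in> carrier_mat m m" using u by (simp add: lower_unitriangular_def)
  have "poly (monom ?x (\<Sum>i<m. e i * \<kappa> i)) s = poly (monom 1 (\<Sum>i<m. e i * mu ! i) * q) s" if s: "s \<noteq> 0" for s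
  proof -
    let ?T = "mat_diag m (\<lambda>i. s ^ e i)"
    have cc: "contract e u s \<in> carrier_mat m m" by (simp add: contract_def)
    have TU: "?T * u = contract e u s * ?T"
    proof (subst mat_diag_mult_left[OF uc], subst mat_diag_mult_right[OF cc], rule eq_matI)
      fix i j assume "i < dim_row (mat m m (\<lambda>(i, j). contract e u s $$ (i, j) * s ^ e j))"
        "j < dim_col (mat m m (\<lambda>(i, j). contract e u s $$ (i, j) * s ^ e j))"
      then have ij: "i < m" "j < m" by auto
      have "s ^ (e i - e j) * s ^ e j = s ^ e i" if "j \<le> i" using mono[OF that] by (simp add: power_add[symmetric])
      then show "mat m m (\<lambda>(i, j). s ^ e i * u $$ (i, j)) $$ (i, j) = mat m m (\<lambda>(i, j). contract e u s $$ (i, j) * s ^ e j) $$ (i, j)"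
        using ij u by (auto simp: contract_def lower_unitriangular_def mult.assoc)
    qed auto
    have "det ?T = (\<Prod>i<m. s ^ e i)"
      by (subst det_lower_triangular[of m]) (auto simp: mat_diag_def prod_list_diag_prod atLeast0LessThan)
    then have TGL: "?T \<in> GL m" using s by (simp add: GL_iff_det)
    have "upper_triangular ?T" by (auto simp: mat_diag_def upper_triangular_def)
    then have "polyext ?T *\<^sub>v hv = (\<Prod>i<m. (?T $$ (i, i)) ^ (mu ! i)) \<cdot>\<^sub>v hv" by (rule hv(3)[OF TGL])
    also have "(\<Prod>i<m. (?T $$ (i, i)) ^ (mu ! i)) = s ^ (\<Sum>i<m. e i * mu ! i)"
      by (simp add: mat_diag_def power_sum power_mult)
    finally have Thv: "polyext ?T *\<^sub>v hv = s ^ (\<Sum>i<m. e i * mu ! i) \<cdot>\<^sub>v hv" .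
    have tp: "tpow m (\<lambda>i. s ^ e i) \<kappa> = s ^ (\<Sum>i<m. e i * \<kappa> i)"
      by (simp add: tpow_def power_sum power_mult)
    have "s ^ (\<Sum>i<m. e i * \<kappa> i) * ?x = ((s ^ (\<Sum>i<m. e i * \<kappa> i) \<cdot>\<^sub>m wproj \<kappa>) *\<^sub>v (polyext u *\<^sub>v hv)) $ r"
      using hv(1) r smult_mult_mat_vec[OF wproj_carrier, of "polyext u *\<^sub>v hv"] by simp
    also have "(s ^ (\<Sum>i<m. e i * \<kappa> i) \<cdot>\<^sub>m wproj \<kappa>) = wproj \<kappa> * polyext ?T"
      unfolding polyext_torus_wproj(2)[OF \<kappa>] tp ..
    also have "(wproj \<kappa> * polyext ?T) *\<^sub>v (polyext u *\<^sub>v hv) = wproj \<kappa> *\<^sub>v (polyext ?T *\<^sub>v (polyext u *\<^sub>v hv))"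
      using hv(1) by (intro assoc_mult_mat_vec[of _ d d _ d]) auto
    also have "polyext ?T *\<^sub>v (polyext u *\<^sub>v hv) = (polyext ?T * polyext u) *\<^sub>v hv"
      using hv(1) by (intro assoc_mult_mat_vec[symmetric, of _ d d _ d]) auto
    also have "polyext ?T * polyext u = polyext (contract e u s) * polyext ?T"
      using polyext_mult[OF mat_diag_dim uc] polyext_mult[OF cc mat_diag_dim] TU by metis
    also have "(polyext (contract e u s) * polyext ?T) *\<^sub>v hv = polyext (contract e u s) *\<^sub>v (polyext ?T *\<^sub>v hv)"
      using hv(1) by (intro assoc_mult_mat_vec[of _ d d _ d]) auto
    also have "wproj \<kappa> *\<^sub>v (polyext (contract e u s) *\<^sub>v (polyext ?T *\<^sub>v hv)) =
        s ^ (\<Sum>i<m. e i * mu ! i) \<cdot>\<^sub>v (wproj \<kappa> *\<^sub>v (polyext (contract e u s) *\<^sub>v hv))"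
      unfolding Thv using hv(1) by (simp add: mult_mat_vec[of _ d d])
    finally show ?thesis using q r by (simp add: poly_monom mult.commute)
  qed
  then have "{s. s \<noteq> 0} \<subseteq> {s. poly (monom ?x (\<Sum>i<m. e i * \<kappa> i)) s = poly (monom 1 (\<Sum>i<m. e i * mu ! i) * q) s}" by auto
  moreover have "infinite {s :: complex. s \<noteq> 0}"
  proof -
    have "{s :: complex. s \<noteq> 0} = UNIV - {0}" by auto
    then show ?thesis using infinite_UNIV_char_0[where 'a = complex] by simp
  qed
  ultimately have "monom ?x (\<Sum>i<m. e i * \<kappa> i) = monom 1 (\<Sum>i<m. e i * mu ! i) * q"
    using infinite_super by (intro poly_eq_if_agree) blast
  then show ?thesis using q by blast
qed

lemma weight_nonvanishing:
  assumes "\<kappa> \<in> wts"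
  obtains u r where "lower_unitriangular m u" "r < d" "(wproj \<kappa> *\<^sub>v (polyext u *\<^sub>v hv)) $ r \<noteq> 0"
proof -
  have "\<exists>r c. r < d \<and> c < d \<and> wproj \<kappa> $$ (r, c) \<noteq> 0"
  proof (rule ccontr)
    assume "\<nexists>r c. r < d \<and> c < d \<and> wproj \<kappa> $$ (r, c) \<noteq> 0"
    then have "wproj \<kappa> = 0\<^sub>m d d" by (intro eq_matI) auto
    then show False using wproj_nonzero[OF assms] by simp
  qed
  then obtain r c where rc: "r < d" "c < d" "wproj \<kappa> $$ (r, c) \<noteq> 0" by blast
  have "(wproj \<kappa> *\<^sub>v unit_vec d c) $ r = wproj \<kappa> $$ (r, c)"
    using rc by simp
  then have "\<not> (\<forall>u. lower_unitriangular m u \<longrightarrow> (wproj \<kappa> *\<^sub>v (polyext u *\<^sub>v hv)) $ r = 0)"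
    using functional_vanishing_on_unipotent_orbit[OF wproj_carrier rc(1), of \<kappa> "unit_vec d c"] rc(3) by auto
  then show ?thesis using that rc(1) by blast
qed

text \<open>Dominance in dual form: nondecreasing functions \<open>e\<close> are the cone dual to the one
spanned by the positive roots (up to sign). In \<open>torus_contraction\<close> the right side is divisible by
the power of \<open>s\<close> for the highest weight, and the left side is a nonzero monomial for a suitable
\<open>u\<close>.\<close>

lemma wts_dominated:
  assumes \<kappa>: "\<kappa> \<in> wts" and mono: "\<And>i j. i \<le> j \<Longrightarrow> e i \<le> (e j :: nat)"
  shows "(\<Sum>i<m. e i * mu ! i) \<le> (\<Sum>i<m. e i * \<kappa> i)"
proof -
  obtain u r where u: "lower_unitriangular m u" "r < d" "(wproj \<kappa> *\<^sub>v (polyext u *\<^sub>v hv)) $ r \<noteq> 0"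
    using weight_nonvanishing[OF \<kappa>] by blast
  obtain q where q: "monom ((wproj \<kappa> *\<^sub>v (polyext u *\<^sub>v hv)) $ r) (\<Sum>i<m. e i * \<kappa> i) = monom 1 (\<Sum>i<m. e i * mu ! i) * q"
    using torus_contraction[of e, OF mono u(1) \<kappa> u(2)] by blast
  show ?thesis
  proof (rule ccontr)
    assume "\<not> ?thesis"
    then have "coeff (monom 1 (\<Sum>i<m. e i * mu ! i) * q) (\<Sum>i<m. e i * \<kappa> i) = 0"
      by (simp add: coeff_monom_mult)
    then show False using u(3) unfolding q[symmetric] by simp
  qed
qed

text \<open>For constant \<open>e\<close> the torus element is a scalar matrix and the contraction does
nothing.\<close>

lemma wts_same_total:
  assumes \<kappa>: "\<kappa> \<in> wts"
  shows "(\<Sum>i<m. \<kappa> i) = (\<Sum>i<m. mu ! i)"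
proof -
  obtain u r where u: "lower_unitriangular m u" "r < d" "(wproj \<kappa> *\<^sub>v (polyext u *\<^sub>v hv)) $ r \<noteq> 0"
    using weight_nonvanishing[OF \<kappa>] by blast
  let ?x = "(wproj \<kappa> *\<^sub>v (polyext u *\<^sub>v hv)) $ r"
  obtain q where q: "\<forall>s. (wproj \<kappa> *\<^sub>v (polyext (contract (\<lambda>_. 1) u s) *\<^sub>v hv)) $ r = poly q s"
    "monom ?x (\<Sum>i<m. 1 * \<kappa> i) = monom 1 (\<Sum>i<m. 1 * mu ! i) * q"
    using torus_contraction[of "\<lambda>_. 1", OF order_refl u(1) \<kappa> u(2)] by blast
  have "contract (\<lambda>_. 1) u s = u" for s
    using u(1) by (intro eq_matI) (auto simp: contract_def lower_unitriangular_def)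
  then have "q = [:?x:]" using q(1) by (intro poly_eq_if_agree) (simp add: infinite_UNIV_char_0)
  then have "monom ?x (\<Sum>i<m. \<kappa> i) = monom ?x (\<Sum>i<m. mu ! i)"
    using q(2) by (simp add: mult.commute smult_monom)
  then have "coeff (monom ?x (\<Sum>i<m. \<kappa> i)) (\<Sum>i<m. \<kappa> i) = coeff (monom ?x (\<Sum>i<m. mu ! i)) (\<Sum>i<m. \<kappa> i)" by simp
  then show ?thesis using u(3) by (simp split: if_splits)
qed

definition top_weight :: "nat \<Rightarrow> nat" where
  "top_weight i = (if i < m then mu ! i else 0)"

lemma top_weight_projection:
  shows "top_weight \<in> wts" "wproj top_weight *\<^sub>v hv = hv"
proof -
  have "hv \<in> weight_space m (d, rho) (\<lambda>i. int (mu ! i))"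
    unfolding weight_space_def
  proof (intro CollectI conjI ballI impI)
    show "hv \<in> rep_space (d, rho)" using hv(1) by simp
    fix T assume T: "T \<in> GL m" "diagonal_mat T"
    have "upper_triangular T" using T by (auto simp: diagonal_mat_def upper_triangular_def GL_def)
    then show "snd (d, rho) T *\<^sub>v hv = (\<Prod>i<m. T $$ (i, i) powi int (mu ! i)) \<cdot>\<^sub>v hv"
      using hv(3)[OF T(1)] polyext_GL[OF T(1)] by simp
  qed
  note proj = weight_vector_projections[OF this]
  have sub: "{\<eta> \<in> wts. \<forall>i<m. int (\<eta> i) = int (mu ! i)} \<subseteq> {top_weight}"
  proof
    fix \<eta> assume "\<eta> \<in> {\<eta> \<in> wts. \<forall>i<m. int (\<eta> i) = int (mu ! i)}"
    then have "\<eta> = top_weight"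
      using wts_exponents by (intro exponents_eqI[of _ m]) (auto simp: top_weight_def exponents_def)
    then show "\<eta> \<in> {top_weight}" by simp
  qed
  have ne: "{\<eta> \<in> wts. \<forall>i<m. int (\<eta> i) = int (mu ! i)} \<noteq> {}"
  proof
    assume none: "{\<eta> \<in> wts. \<forall>i<m. int (\<eta> i) = int (mu ! i)} = {}"
    have "hv = 0\<^sub>v d" using proj hv(1) unfolding none by (intro eq_vecI) auto
    then show False using hv(2) by simp
  qed
  then have single: "{\<eta> \<in> wts. \<forall>i<m. int (\<eta> i) = int (mu ! i)} = {top_weight}" using sub by blast
  then show "top_weight \<in> wts" by blast
  show "wproj top_weight *\<^sub>v hv = hv"
    using proj hv(1) unfolding single by (intro eq_vecI) auto
qed

text \<open>The contraction with \<open>e i = i\<close> deforms every lower unitriangular \<open>u\<close> to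
the identity without changing the component of \<open>u hv\<close> of highest weight; hence that component is
always \<open>hv\<close>. By density of the unipotent orbit the range of the projection is the line through
\<open>hv\<close>.\<close>

lemma wmult_top_weight: "wmult top_weight = 1"
proof -
  let ?P = "wproj top_weight"
  have "\<exists>r<d. hv $ r \<noteq> 0"
  proof (rule ccontr)
    assume "\<not> (\<exists>r<d. hv $ r \<noteq> 0)"
    then have "hv = 0\<^sub>v d" using hv(1) by (intro eq_vecI) auto
    then show False using hv(2) by simp
  qed
  then obtain r0 where r0: "r0 < d" "hv $ r0 \<noteq> 0" by blast
  have fixed: "(?P *\<^sub>v (polyext u *\<^sub>v hv)) $ r = hv $ r" if u: "lower_unitriangular m u" and r: "r < d" for u r
  proof -
    let ?x = "(?P *\<^sub>v (polyext u *\<^sub>v hv)) $ r"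
    let ?a = "\<Sum>i<m. i * top_weight i"
    obtain q where q: "\<forall>s. (?P *\<^sub>v (polyext (contract (\<lambda>i. i) u s) *\<^sub>v hv)) $ r = poly q s"
      "monom ?x ?a = monom 1 (\<Sum>i<m. i * mu ! i) * q"
      using torus_contraction[of "\<lambda>i. i", OF _ u top_weight_projection(1) r] by blast
    have "(\<Sum>i<m. i * mu ! i) = ?a" by (intro sum.cong) (auto simp: top_weight_def)
    then have "monom 1 ?a * q = monom 1 ?a * [:?x:]" using q(2) by (simp add: mult.commute smult_monom)
    then have "q = [:?x:]" by (metis monom_eq_0_iff mult_left_cancel zero_neq_one)
    moreover have "contract (\<lambda>i. i) u 0 = 1\<^sub>m m"
      using u by (intro eq_matI) (auto simp: contract_def lower_unitriangular_def)
    ultimately have "(?P *\<^sub>v (polyext (1\<^sub>m m) *\<^sub>v hv)) $ r = ?x" using q(1)[rule_format, of 0] by simp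
    then show ?thesis using hv(1) top_weight_projection(2) by simp
  qed
  have ratio: "hv $ r0 * ?P $$ (r, c) = hv $ r * ?P $$ (r0, c)" if rc: "r < d" "c < d" for r c
  proof -
    define M where "M = mat d d (\<lambda>(i, j). hv $ r0 * ?P $$ (r, j) - hv $ r * ?P $$ (r0, j))"
    have M: "(M *\<^sub>v w) $ r = hv $ r0 * (?P *\<^sub>v w) $ r - hv $ r * (?P *\<^sub>v w) $ r0" if "w \<in> carrier_vec d" for w
      using rc r0(1) that
      by (simp add: M_def scalar_prod_def sum_subtractf sum_distrib_left left_diff_distrib mult.assoc)
    have "(M *\<^sub>v unit_vec d c) $ r = 0"
      by (rule functional_vanishing_on_unipotent_orbit)
        (use rc r0 hv(1) M fixed in \<open>auto simp: M_def mult.commute\<close>)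
    then show ?thesis using rc r0 by (simp add: M)
  qed
  have "hv $ r0 * mat_trace ?P = (\<Sum>r<d. hv $ r0 * ?P $$ (r, r))" by (simp add: mat_trace_def sum_distrib_left)
  also have "\<dots> = (\<Sum>r<d. ?P $$ (r0, r) * hv $ r)" using ratio by (intro sum.cong) (auto simp: mult.commute)
  also have "\<dots> = (?P *\<^sub>v hv) $ r0" using r0 hv(1) by (simp add: scalar_prod_def atLeast0LessThan)
  also have "\<dots> = hv $ r0" unfolding top_weight_projection(2) ..
  finally have "mat_trace ?P = 1" using r0(2) by simp
  then show ?thesis using top_weight_projection(1) by (simp add: wmult_def)
qed

end

section \<open>The Casimir operator and the radial equation\<close>

lemma mat_trace_triple_comm:
  fixes A B C :: "'a::comm_semiring_1 mat"
  assumes "A \<in> carrier_mat n n" "B \<in> carrier_mat n n" "C \<in> carrier_mat n n"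
  shows "mat_trace (A * B * C) = mat_trace (B * C * A)"
proof -
  have "A * B * C = A * (B * C)" using assms by (simp add: assoc_mult_mat[of _ n n _ n _ n])
  then show ?thesis using mat_trace_comm[of A n n "B * C"] assms by simp
qed

text \<open>Invariance of the tensor \<open>\<Sum>i j. E_ij \<otimes> E_ji\<close> under conjugation, paired
with \<open>\<alpha>\<close> and \<open>\<beta>\<close>: both sides are the trace of \<open>\<alpha> *
\<beta>\<close>.\<close>

lemma casimir_invariance:
  fixes g h \<alpha> \<beta> :: "complex mat"
  assumes c: "g \<in> carrier_mat m m" "h \<in> carrier_mat m m" "\<alpha> \<in> carrier_mat m m" "\<beta> \<in> carrier_mat m m"
    and hg: "h * g = 1\<^sub>m m"
  shows "(\<Sum>i<m. \<Sum>j<m. (\<Sum>a<m. \<Sum>b<m. (g $$ (a, i) * h $$ (j, b)) * \<alpha> $$ (a, b)) *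
      (\<Sum>a<m. \<Sum>b<m. (g $$ (a, j) * h $$ (i, b)) * \<beta> $$ (a, b))) =
    (\<Sum>i<m. \<Sum>j<m. \<alpha> $$ (i, j) * \<beta> $$ (j, i))"
proof -
  have gh: "g * h = 1\<^sub>m m" by (rule mat_mult_left_right_inverse[OF c(2,1) hg])
  let ?gt = "transpose_mat g" and ?ht = "transpose_mat h"
  have ct: "?gt \<in> carrier_mat m m" "?ht \<in> carrier_mat m m" using c by auto
  have entry: "(?gt * \<gamma> * ?ht) $$ (i, j) = (\<Sum>a<m. \<Sum>b<m. (g $$ (a, i) * h $$ (j, b)) * \<gamma> $$ (a, b))"
    if \<gamma>: "\<gamma> \<in> carrier_mat m m" and ij: "i < m" "j < m" for \<gamma> i j
  proof -
    have "(?gt * \<gamma> * ?ht) $$ (i, j) = (\<Sum>b<m. (?gt * \<gamma>) $$ (i, b) * ?ht $$ (b, j))"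
      using ct \<gamma> ij by (intro mat_mult_entry) auto
    also have "\<dots> = (\<Sum>b<m. \<Sum>a<m. (g $$ (a, i) * h $$ (j, b)) * \<gamma> $$ (a, b))"
    proof (rule sum.cong[OF refl])
      fix b assume b: "b \<in> {..<m}"
      have "(?gt * \<gamma>) $$ (i, b) = (\<Sum>a<m. ?gt $$ (i, a) * \<gamma> $$ (a, b))"
        using ct \<gamma> ij b by (intro mat_mult_entry) auto
      then show "(?gt * \<gamma>) $$ (i, b) * ?ht $$ (b, j) = (\<Sum>a<m. (g $$ (a, i) * h $$ (j, b)) * \<gamma> $$ (a, b))"
        using c ij b by (simp add: sum_distrib_left sum_distrib_right mult_ac)
    qed
    also have "\<dots> = (\<Sum>a<m. \<Sum>b<m. (g $$ (a, i) * h $$ (j, b)) * \<gamma> $$ (a, b))" by (rule sum.swap)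
    finally show ?thesis .
  qed
  have tr: "(\<Sum>i<m. \<Sum>j<m. A $$ (i, j) * B $$ (j, i)) = mat_trace (A * B)"
    if "A \<in> carrier_mat m m" "B \<in> carrier_mat m m" for A B :: "complex mat"
    using that by (simp add: mat_trace_def mat_mult_entry[OF that] del: index_mult_mat(1))
  let ?A = "?gt * \<alpha> * ?ht" and ?B = "?gt * \<beta> * ?ht"
  have cA: "?A \<in> carrier_mat m m" "?B \<in> carrier_mat m m" using ct c by auto
  have "?ht * ?gt = 1\<^sub>m m" using gh transpose_mult[OF c(1,2)] by simp
  then have hgt: "?ht * (?gt * X) = X" if "X \<in> carrier_mat m m" for X
    using ct that assoc_mult_mat[of ?ht m m ?gt m X m] by simp
  have "(\<Sum>i<m. \<Sum>j<m. (\<Sum>a<m. \<Sum>b<m. (g $$ (a, i) * h $$ (j, b)) * \<alpha> $$ (a, b)) *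
      (\<Sum>a<m. \<Sum>b<m. (g $$ (a, j) * h $$ (i, b)) * \<beta> $$ (a, b))) = (\<Sum>i<m. \<Sum>j<m. ?A $$ (i, j) * ?B $$ (j, i))"
    using entry[OF c(3)] entry[OF c(4)] by (intro sum.cong refl) simp
  also have "\<dots> = mat_trace (?A * ?B)" by (rule tr[OF cA])
  also have "?A * ?B = ?gt * (\<alpha> * \<beta>) * ?ht"
    using ct c by (simp add: assoc_mult_mat[of _ m m _ m _ m] hgt)
  also have "mat_trace (?gt * (\<alpha> * \<beta>) * ?ht) = mat_trace (\<alpha> * \<beta> * ?ht * ?gt)"
    using ct c by (intro mat_trace_triple_comm[of _ m]) auto
  also have "\<alpha> * \<beta> * ?ht * ?gt = \<alpha> * \<beta>"
    using ct c \<open>?ht * ?gt = 1\<^sub>m m\<close> by (simp add: assoc_mult_mat[of _ m m _ m _ m])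
  also have "mat_trace (\<alpha> * \<beta>) = (\<Sum>i<m. \<Sum>j<m. \<alpha> $$ (i, j) * \<beta> $$ (j, i))"
    by (rule tr[symmetric]) (use c in auto)
  finally show ?thesis .
qed

context polynomial_gl_rep
begin

abbreviation gen :: "nat \<Rightarrow> nat \<Rightarrow> complex mat" where
  "gen i j \<equiv> lie (mat_unit m i j)"

lemma square_carrier [simp]:
  "A \<in> carrier_mat d d \<Longrightarrow> B \<in> carrier_mat d d \<Longrightarrow> A * B \<in> carrier_mat d d"
  "A \<in> carrier_mat d d \<Longrightarrow> B \<in> carrier_mat d d \<Longrightarrow> A - B \<in> carrier_mat d d"
  by (auto simp: minus_carrier_mat)

definition casimir :: "complex mat" where
  "casimir = mat d d (\<lambda>(r, c). \<Sum>i<m. \<Sum>j<m. (gen i j * gen j i) $$ (r, c))"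

lemma casimir_carrier [simp]: "casimir \<in> carrier_mat d d"
  by (simp add: casimir_def)

lemma casimir_dim [simp]: "dim_row casimir = d" "dim_col casimir = d"
  by (simp_all add: casimir_def)

text \<open>Conjugating all matrix units by \<open>g\<close> leaves the sum unchanged, by
\<open>casimir_invariance\<close> applied entry by entry.\<close>

lemma casimir_commutes:
  assumes g: "g \<in> GL m"
  shows "polyext g * casimir = casimir * polyext g"
proof -
  obtain h where h: "h \<in> GL m" "g * h = 1\<^sub>m m" "h * g = 1\<^sub>m m" using GL_inverse[OF g] by blast
  have c: "g \<in> carrier_mat m m" "h \<in> carrier_mat m m" using g h by (auto intro: GL_carrier)
  define X where "X = (\<lambda>i j. mat m m (\<lambda>(a, b). g $$ (a, i) * h $$ (j, b)))"
  have Xc [simp]: "X i j \<in> carrier_mat m m" for i j by (simp add: X_def)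
  have inter: "polyext g * gen i j = lie (X i j) * polyext g" if ij: "i < m" "j < m" for i j
  proof (rule lie_intertwine)
    show "g * mat_unit m i j = X i j * g"
    proof (rule eq_matI)
      fix a b assume "a < dim_row (X i j * g)" "b < dim_col (X i j * g)"
      then have ab: "a < m" "b < m" using c by (auto simp: X_def)
      have "(g * mat_unit m i j) $$ (a, b) = (\<Sum>l<m. g $$ (a, l) * mat_unit m i j $$ (l, b))"
        using c ab by (intro mat_mult_entry) auto
      also have "\<dots> = (\<Sum>l<m. if l = i then (if b = j then g $$ (a, l) else 0) else 0)"
        using ab by (intro sum.cong) (auto simp: mat_unit_def)
      also have "\<dots> = (if b = j then g $$ (a, i) else 0)"
        using ij by (simp only: sum.delta finite_lessThan lessThan_iff if_True)
      also have "\<dots> = g $$ (a, i) * (h * g) $$ (j, b)" using h(3) ab ij by auto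
      also have "\<dots> = (\<Sum>l<m. X i j $$ (a, l) * g $$ (l, b))"
        unfolding mat_mult_entry[OF c(2,1) ij(2) ab(2)] using ab by (simp add: X_def sum_distrib_left mult.assoc)
      also have "\<dots> = (X i j * g) $$ (a, b)"
        using c ab by (intro mat_mult_entry[symmetric]) auto
      finally show "(g * mat_unit m i j) $$ (a, b) = (X i j * g) $$ (a, b)" .
    qed (use c in \<open>auto simp: X_def mat_unit_def\<close>)
  qed (use c in auto)
  have inter2: "polyext g * (gen i j * gen j i) = (lie (X i j) * lie (X j i)) * polyext g" if ij: "i < m" "j < m" for i j
  proof -
    have "polyext g * (gen i j * gen j i) = (polyext g * gen i j) * gen j i"
      by (rule assoc_mult_mat[of _ d d _ d _ d, symmetric]) auto
    also have "\<dots> = lie (X i j) * (polyext g * gen j i)"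
      unfolding inter[OF ij] by (rule assoc_mult_mat[of _ d d _ d _ d]) auto
    also have "\<dots> = (lie (X i j) * lie (X j i)) * polyext g"
      unfolding inter[OF ij(2,1)] by (rule assoc_mult_mat[of _ d d _ d _ d, symmetric]) auto
    finally show ?thesis .
  qed
  have inv: "(\<Sum>i<m. \<Sum>j<m. (lie (X i j) * lie (X j i)) $$ (r, c')) = casimir $$ (r, c')" if rc: "r < d" "c' < d" for r c'
  proof -
    have "(\<Sum>i<m. \<Sum>j<m. (lie (X i j) * lie (X j i)) $$ (r, c')) =
        (\<Sum>i<m. \<Sum>j<m. \<Sum>l<d. lie (X i j) $$ (r, l) * lie (X j i) $$ (l, c'))"
      using rc by (simp add: mat_mult_entry[of _ d d _ d] del: index_mult_mat(1))
    also have "\<dots> = (\<Sum>i<m. \<Sum>l<d. \<Sum>j<m. lie (X i j) $$ (r, l) * lie (X j i) $$ (l, c'))"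
      by (rule sum.cong[OF refl]) (rule sum.swap)
    also have "\<dots> = (\<Sum>l<d. \<Sum>i<m. \<Sum>j<m. lie (X i j) $$ (r, l) * lie (X j i) $$ (l, c'))"
      by (rule sum.swap)
    also have "\<dots> = (\<Sum>l<d. \<Sum>i<m. \<Sum>j<m. gen i j $$ (r, l) * gen j i $$ (l, c'))"
    proof (rule sum.cong[OF refl])
      fix l assume "l \<in> {..<d}"
      then have l: "l < d" by simp
      let ?\<alpha> = "mat m m (\<lambda>(a, b). gen a b $$ (r, l))" and ?\<beta> = "mat m m (\<lambda>(a, b). gen a b $$ (l, c'))"
      have "(\<Sum>i<m. \<Sum>j<m. lie (X i j) $$ (r, l) * lie (X j i) $$ (l, c')) =
        (\<Sum>i<m. \<Sum>j<m. (\<Sum>a<m. \<Sum>b<m. (g $$ (a, i) * h $$ (j, b)) * ?\<alpha> $$ (a, b)) *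
          (\<Sum>a<m. \<Sum>b<m. (g $$ (a, j) * h $$ (i, b)) * ?\<beta> $$ (a, b)))"
        unfolding lie_expand[OF Xc rc(1) l] lie_expand[OF Xc l rc(2)]
        by (intro sum.cong refl arg_cong2[of _ _ _ _ "(*)"]) (auto simp: X_def)
      also have "\<dots> = (\<Sum>i<m. \<Sum>j<m. ?\<alpha> $$ (i, j) * ?\<beta> $$ (j, i))"
        by (rule casimir_invariance[OF c _ _ h(3)]) auto
      finally show "(\<Sum>i<m. \<Sum>j<m. lie (X i j) $$ (r, l) * lie (X j i) $$ (l, c')) =
          (\<Sum>i<m. \<Sum>j<m. gen i j $$ (r, l) * gen j i $$ (l, c'))" by simp
    qed
    also have "\<dots> = (\<Sum>i<m. \<Sum>l<d. \<Sum>j<m. gen i j $$ (r, l) * gen j i $$ (l, c'))" by (rule sum.swap)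
    also have "\<dots> = (\<Sum>i<m. \<Sum>j<m. \<Sum>l<d. gen i j $$ (r, l) * gen j i $$ (l, c'))"
      by (rule sum.cong[OF refl]) (rule sum.swap)
    also have "\<dots> = casimir $$ (r, c')"
      using rc by (simp add: casimir_def mat_mult_entry[of _ d d _ d] del: index_mult_mat(1))
    finally show ?thesis .
  qed
  show ?thesis
  proof (rule eq_matI)
    fix r c' assume "r < dim_row (casimir * polyext g)" "c' < dim_col (casimir * polyext g)"
    then have rc: "r < d" "c' < d" using casimir_carrier by auto
    have "(polyext g * casimir) $$ (r, c') = (\<Sum>l<d. polyext g $$ (r, l) * casimir $$ (l, c'))"
      using rc by (intro mat_mult_entry) auto
    also have "\<dots> = (\<Sum>l<d. \<Sum>i<m. \<Sum>j<m. polyext g $$ (r, l) * (gen i j * gen j i) $$ (l, c'))"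
      using rc by (simp add: casimir_def sum_distrib_left)
    also have "\<dots> = (\<Sum>i<m. \<Sum>l<d. \<Sum>j<m. polyext g $$ (r, l) * (gen i j * gen j i) $$ (l, c'))" by (rule sum.swap)
    also have "\<dots> = (\<Sum>i<m. \<Sum>j<m. \<Sum>l<d. polyext g $$ (r, l) * (gen i j * gen j i) $$ (l, c'))"
      by (rule sum.cong[OF refl]) (rule sum.swap)
    also have "\<dots> = (\<Sum>i<m. \<Sum>j<m. (polyext g * (gen i j * gen j i)) $$ (r, c'))"
      using rc by (intro sum.cong refl mat_mult_entry[symmetric, of _ d d _ d]) auto
    also have "\<dots> = (\<Sum>i<m. \<Sum>j<m. ((lie (X i j) * lie (X j i)) * polyext g) $$ (r, c'))"
      using inter2 by (intro sum.cong refl) simp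
    also have "\<dots> = (\<Sum>i<m. \<Sum>j<m. \<Sum>l<d. (lie (X i j) * lie (X j i)) $$ (r, l) * polyext g $$ (l, c'))"
      using rc by (intro sum.cong refl mat_mult_entry[of _ d d _ d]) auto
    also have "\<dots> = (\<Sum>i<m. \<Sum>l<d. \<Sum>j<m. (lie (X i j) * lie (X j i)) $$ (r, l) * polyext g $$ (l, c'))"
      by (rule sum.cong[OF refl]) (rule sum.swap)
    also have "\<dots> = (\<Sum>l<d. \<Sum>i<m. \<Sum>j<m. (lie (X i j) * lie (X j i)) $$ (r, l) * polyext g $$ (l, c'))" by (rule sum.swap)
    also have "\<dots> = (\<Sum>l<d. casimir $$ (r, l) * polyext g $$ (l, c'))"
      using rc inv by (intro sum.cong refl) (simp add: sum_distrib_right[symmetric])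
    also have "\<dots> = (casimir * polyext g) $$ (r, c')"
      using rc by (intro mat_mult_entry[symmetric]) auto
    finally show "(polyext g * casimir) $$ (r, c') = (casimir * polyext g) $$ (r, c')" .
  qed auto
qed

end

context gl_irrep
begin

lemma gen_vec_closed [simp]: "w \<in> carrier_vec d \<Longrightarrow> lie X *\<^sub>v w \<in> carrier_vec d"
  by (rule mult_mat_vec_carrier[OF lie_carrier])

text \<open>The matrices \<open>1 + s E_ij\<close> with \<open>i < j\<close> are upper unitriangular and fix
the highest weight vector, so the coefficient of \<open>s\<close> vanishes.\<close>

lemma gen_highest_vector_upper:
  assumes "i < j" "j < m"
  shows "gen i j *\<^sub>v hv = 0\<^sub>v d"
proof (rule eq_vecI)
  fix r assume "r < dim_vec (0\<^sub>v d :: complex vec)"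
  then have r: "r < d" by simp
  have "poly (\<Sum>c<d. Polynomial.smult (hv $ c) (near_one (mat_unit m i j) r c)) s = poly [:hv $ r:] s" for s
  proof -
    let ?B = "1\<^sub>m m + s \<cdot>\<^sub>m mat_unit m i j"
    have Bc: "?B \<in> carrier_mat m m" by simp
    have Bd: "?B $$ (a, a) = 1" if "a < m" for a using that assms by (auto simp: mat_unit_def)
    have Bu: "upper_triangular ?B" using assms by (auto simp: upper_triangular_def mat_unit_def)
    have "det ?B = (\<Prod>a = 0..<m. ?B $$ (a, a))"
      using det_upper_triangular[OF Bu Bc] by (simp add: prod_list_diag_prod mat_unit_def)
    also have "\<dots> = 1" using Bd by (intro prod.neutral) auto
    finally have "?B \<in> GL m" using Bc by (simp add: GL_iff_det)
    then have "polyext ?B *\<^sub>v hv = (\<Prod>a<m. (?B $$ (a, a)) ^ (mu ! a)) \<cdot>\<^sub>v hv" using Bu by (rule hv(3))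
    also have "(\<Prod>a<m. (?B $$ (a, a)) ^ (mu ! a)) = 1" using Bd by (intro prod.neutral) auto
    finally have "(polyext ?B *\<^sub>v hv) $ r = hv $ r" using hv(1) by simp
    then have "(\<Sum>c<d. polyext ?B $$ (r, c) * hv $ c) = hv $ r"
      using r hv(1) by (simp add: scalar_prod_def atLeast0LessThan)
    then show ?thesis using r by (simp add: poly_sum near_one(1) mult.commute)
  qed
  then have "(\<Sum>c<d. Polynomial.smult (hv $ c) (near_one (mat_unit m i j) r c)) = [:hv $ r:]"
    by (intro poly_eq_if_agree) (simp add: infinite_UNIV_char_0)
  then have "coeff (\<Sum>c<d. Polynomial.smult (hv $ c) (near_one (mat_unit m i j) r c)) 1 = 0" by simp
  then have "(\<Sum>c<d. gen i j $$ (r, c) * hv $ c) = 0"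
    using r by (simp add: coeff_sum near_one(3)[simplified] mult.commute)
  then show "(gen i j *\<^sub>v hv) $ r = 0\<^sub>v d $ r"
    using r hv(1) by (simp add: scalar_prod_def atLeast0LessThan)
qed simp

lemma gen_highest_vector_diagonal:
  assumes i: "i < m"
  shows "gen i i *\<^sub>v hv = of_nat (mu ! i) \<cdot>\<^sub>v hv"
proof -
  note top = top_weight_projection
  have "gen i i *\<^sub>v hv = gen i i *\<^sub>v (wproj top_weight *\<^sub>v hv)" unfolding top(2) ..
  also have "\<dots> = (gen i i * wproj top_weight) *\<^sub>v hv"
    using hv(1) by (intro assoc_mult_mat_vec[symmetric, of _ d d _ d]) auto
  also have "gen i i * wproj top_weight = of_nat (mu ! i) \<cdot>\<^sub>m wproj top_weight"
    unfolding lie_diagonal[OF i] wproj_msum[OF top(1)] msum_mult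
    by (rule msum_scale) (use i in \<open>simp add: top_weight_def\<close>)
  also have "(of_nat (mu ! i) \<cdot>\<^sub>m wproj top_weight) *\<^sub>v hv = of_nat (mu ! i) \<cdot>\<^sub>v hv"
    unfolding smult_mult_mat_vec[OF wproj_carrier hv(1)] top(2) ..
  finally show ?thesis .
qed

text \<open>Each summand of the Casimir operator already has the highest weight vector as an eigenvector; for
\<open>i < j\<close> use the bracket to move the annihilating factor to the right.\<close>

lemma casimir_term_highest_vector:
  assumes ij: "i < m" "j < m"
  shows "\<exists>k. gen i j *\<^sub>v (gen j i *\<^sub>v hv) = k \<cdot>\<^sub>v hv"
proof -
  consider "i = j" | "j < i" | "i < j" by linarith
  then show ?thesis
  proof cases
    case 1
    then show ?thesis
      using gen_highest_vector_diagonal[OF ij(1)] hv(1) mult_mat_vec[OF lie_carrier hv(1)]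
      by (intro exI[of _ "of_nat (mu ! i) * of_nat (mu ! i)"]) (simp add: smult_smult_assoc)
  next
    case 2
    have "gen i j *\<^sub>v 0\<^sub>v d = 0\<^sub>v d" by (intro eq_vecI) auto
    then show ?thesis
      using gen_highest_vector_upper[OF 2 ij(1)] hv(1) by (intro exI[of _ 0]) (auto intro!: eq_vecI)
  next
    case 3
    have z: "gen j i *\<^sub>v 0\<^sub>v d = 0\<^sub>v d" by (intro eq_vecI) auto
    have "gen i j *\<^sub>v (gen j i *\<^sub>v hv) = (gen i j * gen j i) *\<^sub>v hv"
      using hv(1) by (intro assoc_mult_mat_vec[symmetric, of _ d d _ d]) auto
    also have "\<dots> = (gen j i * gen i j + (gen i i - gen j j)) *\<^sub>v hv"
      using lie_bracket[OF ij] 3 by simp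
    also have "\<dots> = gen j i *\<^sub>v (gen i j *\<^sub>v hv) + (gen i i *\<^sub>v hv - gen j j *\<^sub>v hv)"
      using hv(1) by (simp add: add_mult_distrib_mat_vec[of _ d d] minus_mult_distrib_mat_vec[of _ d d] assoc_mult_mat_vec[of _ d d _ d])
    also have "\<dots> = (of_nat (mu ! i) - of_nat (mu ! j)) \<cdot>\<^sub>v hv"
      unfolding gen_highest_vector_upper[OF 3 ij(2)] gen_highest_vector_diagonal[OF ij(1)] gen_highest_vector_diagonal[OF ij(2)] z
      using hv(1) by (intro eq_vecI) (auto simp: left_diff_distrib)
    finally show ?thesis by blast
  qed
qed

text \<open>Schur's lemma: the eigenspace that contains the highest weight vector is invariant.\<close>

lemma casimir_scalar:
  obtains c where "\<And>r l. r < d \<Longrightarrow> l < d \<Longrightarrow> casimir $$ (r, l) = (if r = l then c else 0)"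
proof -
  have "\<forall>i<m. \<forall>j<m. \<exists>k. gen i j *\<^sub>v (gen j i *\<^sub>v hv) = k \<cdot>\<^sub>v hv"
    using casimir_term_highest_vector by blast
  then obtain k where k: "\<And>i j. i < m \<Longrightarrow> j < m \<Longrightarrow> gen i j *\<^sub>v (gen j i *\<^sub>v hv) = k i j \<cdot>\<^sub>v hv"
    by metis
  define c where "c = (\<Sum>i<m. \<Sum>j<m. k i j)"
  have "casimir *\<^sub>v hv = c \<cdot>\<^sub>v hv"
  proof (rule eq_vecI)
    fix r assume "r < dim_vec (c \<cdot>\<^sub>v hv)"
    then have r: "r < d" using hv(1) by simp
    have summand: "(\<Sum>l<d. (gen i j * gen j i) $$ (r, l) * hv $ l) = k i j * hv $ r" if "i < m" "j < m" for i j
    proof -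
      have "(\<Sum>l<d. (gen i j * gen j i) $$ (r, l) * hv $ l) = ((gen i j * gen j i) *\<^sub>v hv) $ r"
        using r hv(1) by (simp add: scalar_prod_def atLeast0LessThan)
      also have "(gen i j * gen j i) *\<^sub>v hv = gen i j *\<^sub>v (gen j i *\<^sub>v hv)"
        using hv(1) by (intro assoc_mult_mat_vec[of _ d d _ d]) auto
      finally show ?thesis using k[OF that] hv(1) r by simp
    qed
    have "(casimir *\<^sub>v hv) $ r = (\<Sum>l<d. (\<Sum>i<m. \<Sum>j<m. (gen i j * gen j i) $$ (r, l)) * hv $ l)"
      using r hv(1) by (simp add: casimir_def scalar_prod_def atLeast0LessThan)
    also have "\<dots> = (\<Sum>l<d. \<Sum>i<m. \<Sum>j<m. (gen i j * gen j i) $$ (r, l) * hv $ l)"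
      by (simp only: sum_distrib_right)
    also have "\<dots> = (\<Sum>i<m. \<Sum>l<d. \<Sum>j<m. (gen i j * gen j i) $$ (r, l) * hv $ l)" by (rule sum.swap)
    also have "\<dots> = (\<Sum>i<m. \<Sum>j<m. \<Sum>l<d. (gen i j * gen j i) $$ (r, l) * hv $ l)"
      by (rule sum.cong[OF refl]) (rule sum.swap)
    also have "\<dots> = (\<Sum>i<m. \<Sum>j<m. k i j * hv $ r)" using summand by (intro sum.cong refl) simp
    also have "\<dots> = (c \<cdot>\<^sub>v hv) $ r" using hv(1) r by (simp add: c_def sum_distrib_right)
    finally show "(casimir *\<^sub>v hv) $ r = (c \<cdot>\<^sub>v hv) $ r" .
  qed (use hv(1) in auto)
  define U where "U = {w \<in> carrier_vec d. casimir *\<^sub>v w = c \<cdot>\<^sub>v w}"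
  have "U = carrier_vec d"
  proof (rule invariant_subspace_total[OF _ _ _ _ _ hv(2)])
    show "U \<subseteq> carrier_vec d" by (auto simp: U_def)
    show "hv \<in> U" using hv(1) \<open>casimir *\<^sub>v hv = c \<cdot>\<^sub>v hv\<close> by (simp add: U_def)
    show "v + w \<in> U" if "v \<in> U" "w \<in> U" for v w
      using that by (auto simp: U_def mult_add_distrib_mat_vec[OF casimir_carrier] smult_add_distrib_vec[of _ d])
    show "a \<cdot>\<^sub>v v \<in> U" if "v \<in> U" for a v
      using that by (auto simp: U_def mult_mat_vec[OF casimir_carrier] smult_smult_assoc mult.commute)
    show "polyext A *\<^sub>v v \<in> U" if A: "A \<in> GL m" and v: "v \<in> U" for A v
    proof -
      have vc: "v \<in> carrier_vec d" "casimir *\<^sub>v v = c \<cdot>\<^sub>v v" using v by (auto simp: U_def)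
      have "casimir *\<^sub>v (polyext A *\<^sub>v v) = (casimir * polyext A) *\<^sub>v v"
        using vc(1) by (intro assoc_mult_mat_vec[symmetric, of _ d d _ d]) auto
      also have "\<dots> = polyext A *\<^sub>v (casimir *\<^sub>v v)"
        unfolding casimir_commutes[OF A, symmetric] using vc(1) by (intro assoc_mult_mat_vec[of _ d d _ d]) auto
      also have "\<dots> = c \<cdot>\<^sub>v (polyext A *\<^sub>v v)" unfolding vc(2) by (rule mult_mat_vec[OF polyext_carrier vc(1)])
      finally show ?thesis using vc(1) by (simp add: U_def)
    qed
  qed
  then have all: "casimir *\<^sub>v w = c \<cdot>\<^sub>v w" if "w \<in> carrier_vec d" for w
    using that by (auto simp: U_def)
  have "casimir $$ (r, l) = (if r = l then c else 0)" if "r < d" "l < d" for r l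
  proof -
    have "casimir $$ (r, l) = (casimir *\<^sub>v unit_vec d l) $ r" using that casimir_carrier by simp
    also have "\<dots> = (c \<cdot>\<^sub>v unit_vec d l) $ r" by (subst all) auto
    finally show ?thesis using that by auto
  qed
  then show ?thesis by (rule that)
qed

text \<open>The radial part of the Casimir operator. Let \<open>x i j\<close> be the trace of the torus
element \<open>T\<close> times \<open>gen i j * gen j i\<close>. Commuting \<open>T\<close> past \<open>gen i
j\<close> costs the factor \<open>t i / t j\<close>; cyclicity of the trace and the bracket relation then give
a linear equation for \<open>x i j\<close> whose solution is \<open>t i / (t i - t j)\<close> times the
difference of the derivatives \<open>t i d/dt i\<close> and \<open>t j d/dt j\<close> of the
character.\<close>

theorem casimir_equation:
  obtains c where "\<And>t. inj_on t {..<m} \<Longrightarrow>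
    (\<Sum>i<m. \<Sum>\<nu>\<in>wts. wmult \<nu> * (of_nat (\<nu> i))\<^sup>2 * tpow m t \<nu>) +
    (\<Sum>i<m. \<Sum>j\<in>{..<m} - {i}. t i / (t i - t j) *
      ((\<Sum>\<nu>\<in>wts. wmult \<nu> * of_nat (\<nu> i) * tpow m t \<nu>) - (\<Sum>\<nu>\<in>wts. wmult \<nu> * of_nat (\<nu> j) * tpow m t \<nu>))) =
    c * (\<Sum>\<nu>\<in>wts. wmult \<nu> * tpow m t \<nu>)"
proof -
  obtain c where c: "\<And>r l. r < d \<Longrightarrow> l < d \<Longrightarrow> casimir $$ (r, l) = (if r = l then c else 0)"
    using casimir_scalar by blast
  have "(\<Sum>i<m. \<Sum>\<nu>\<in>wts. wmult \<nu> * (of_nat (\<nu> i))\<^sup>2 * tpow m t \<nu>) +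
    (\<Sum>i<m. \<Sum>j\<in>{..<m} - {i}. t i / (t i - t j) *
      ((\<Sum>\<nu>\<in>wts. wmult \<nu> * of_nat (\<nu> i) * tpow m t \<nu>) - (\<Sum>\<nu>\<in>wts. wmult \<nu> * of_nat (\<nu> j) * tpow m t \<nu>))) =
    c * (\<Sum>\<nu>\<in>wts. wmult \<nu> * tpow m t \<nu>)" if inj: "inj_on t {..<m}" for t
  proof -
    let ?D = "mat_diag m t"
    let ?T = "polyext ?D"
    define x where "x = (\<lambda>i j. mat_trace (?T * (gen i j * gen j i)))"
    define y where "y = (\<lambda>i. \<Sum>\<nu>\<in>wts. wmult \<nu> * of_nat (\<nu> i) * tpow m t \<nu>)"
    have y: "mat_trace (?T * gen i i) = y i" if "i < m" for i
      unfolding lie_diagonal[OF that] polyext_torus msum_mult mat_trace_msum y_def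
      by (intro sum.cong) (auto simp: wmult_def mult_ac)
    have xd: "x i i = (\<Sum>\<nu>\<in>wts. wmult \<nu> * (of_nat (\<nu> i))\<^sup>2 * tpow m t \<nu>)" if "i < m" for i
      unfolding x_def lie_diagonal[OF that] polyext_torus msum_mult mat_trace_msum
      by (intro sum.cong) (auto simp: wmult_def mult_ac power2_eq_square)
    have xo: "x i j = t i / (t i - t j) * (y i - y j)" if ij: "i < m" "j < m" "i \<noteq> j" for i j
    proof -
      have "?D * (t j \<cdot>\<^sub>m mat_unit m i j) = (t i \<cdot>\<^sub>m mat_unit m i j) * ?D"
        by (subst mat_diag_mult_left[of _ m m], simp, subst mat_diag_mult_right[of _ m m], simp)
          (rule eq_matI, auto simp: mat_unit_def)
      then have "?T * lie (t j \<cdot>\<^sub>m mat_unit m i j) = lie (t i \<cdot>\<^sub>m mat_unit m i j) * ?T"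
        by (intro lie_intertwine) auto
      moreover have "lie (s \<cdot>\<^sub>m mat_unit m i j) = s \<cdot>\<^sub>m gen i j" for s
      proof (rule eq_matI)
        fix r l assume "r < dim_row (s \<cdot>\<^sub>m gen i j)" "l < dim_col (s \<cdot>\<^sub>m gen i j)"
        then have rl: "r < d" "l < d" by auto
        have "lie (s \<cdot>\<^sub>m mat_unit m i j) $$ (r, l) = (\<Sum>a<m. \<Sum>b<m. (s \<cdot>\<^sub>m mat_unit m i j) $$ (a, b) * gen a b $$ (r, l))"
          by (rule lie_expand) (use rl in auto)
        also have "\<dots> = s * (\<Sum>a<m. \<Sum>b<m. mat_unit m i j $$ (a, b) * gen a b $$ (r, l))"
          unfolding sum_distrib_left by (intro sum.cong refl) (simp add: mat_unit_def)
        also have "(\<Sum>a<m. \<Sum>b<m. mat_unit m i j $$ (a, b) * gen a b $$ (r, l)) = gen i j $$ (r, l)"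
          by (rule lie_expand[symmetric]) (use rl in auto)
        finally show "lie (s \<cdot>\<^sub>m mat_unit m i j) $$ (r, l) = (s \<cdot>\<^sub>m gen i j) $$ (r, l)" using rl by simp
      qed auto
      ultimately have com: "t j \<cdot>\<^sub>m (?T * gen i j) = t i \<cdot>\<^sub>m (gen i j * ?T)"
        by (simp add: mult_smult_distrib[of _ d d _ d] mult_smult_assoc_mat[of _ d d _ d])
      have "t j * x i j = mat_trace ((t j \<cdot>\<^sub>m (?T * gen i j)) * gen j i)"
        unfolding x_def using mult_smult_assoc_mat[of "?T * gen i j" d d "gen j i" d "t j"]
        by (simp add: assoc_mult_mat[of _ d d _ d _ d] mat_trace_smult[of _ d])
      also have "\<dots> = t i * mat_trace ((gen i j * ?T) * gen j i)"
        unfolding com using mult_smult_assoc_mat[of "gen i j * ?T" d d "gen j i" d "t i"]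
        by (simp add: mat_trace_smult[of _ d])
      also have "mat_trace ((gen i j * ?T) * gen j i) = mat_trace (?T * gen j i * gen i j)"
        by (rule mat_trace_triple_comm[of _ d]) auto
      also have "?T * gen j i * gen i j = ?T * (gen j i * gen i j)"
        by (rule assoc_mult_mat[of _ d d _ d _ d]) auto
      also have "gen j i * gen i j = gen i j * gen j i + (gen j j - gen i i)"
        using lie_bracket[OF ij(2,1)] ij(3) by simp
      also have "?T * (gen i j * gen j i + (gen j j - gen i i)) = ?T * (gen i j * gen j i) + (?T * gen j j - ?T * gen i i)"
        by (simp add: mult_add_distrib_mat[of _ d d _ d] mult_minus_distrib_mat[of _ d d _ d] )
      also have "mat_trace (?T * (gen i j * gen j i) + (?T * gen j j - ?T * gen i i)) = x i j + (y j - y i)"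
        using y[OF ij(1)] y[OF ij(2)]
        by (simp add: mat_trace_add[of _ d] mat_trace_minus[of _ d] x_def)
      finally have "t j * x i j = t i * (x i j + (y j - y i))" .
      moreover have "t i - t j \<noteq> 0" using inj ij by (auto simp: inj_on_def)
      ultimately show ?thesis by (simp add: field_simps)
    qed
    have "c * (\<Sum>\<nu>\<in>wts. wmult \<nu> * tpow m t \<nu>) = (\<Sum>r<d. \<Sum>l<d. ?T $$ (r, l) * casimir $$ (l, r))"
    proof -
      have "(\<Sum>l<d. ?T $$ (r, l) * casimir $$ (l, r)) = c * ?T $$ (r, r)" if "r < d" for r
      proof -
        have "(\<Sum>l<d. ?T $$ (r, l) * casimir $$ (l, r)) = (\<Sum>l<d. if l = r then c * ?T $$ (r, l) else 0)"
          using that c by (intro sum.cong) auto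
        then show ?thesis using that by simp
      qed
      then show ?thesis unfolding mat_trace_ext_torus[symmetric] by (simp add: mat_trace_def sum_distrib_left)
    qed
    also have "\<dots> = (\<Sum>r<d. \<Sum>l<d. \<Sum>i<m. \<Sum>j<m. ?T $$ (r, l) * (gen i j * gen j i) $$ (l, r))"
      by (intro sum.cong refl) (simp add: casimir_def sum_distrib_left)
    also have "\<dots> = (\<Sum>r<d. \<Sum>i<m. \<Sum>l<d. \<Sum>j<m. ?T $$ (r, l) * (gen i j * gen j i) $$ (l, r))"
      by (rule sum.cong[OF refl]) (rule sum.swap)
    also have "\<dots> = (\<Sum>r<d. \<Sum>i<m. \<Sum>j<m. \<Sum>l<d. ?T $$ (r, l) * (gen i j * gen j i) $$ (l, r))"
      by (rule sum.cong[OF refl], rule sum.cong[OF refl], rule sum.swap)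
    also have "\<dots> = (\<Sum>r<d. \<Sum>i<m. \<Sum>j<m. (?T * (gen i j * gen j i)) $$ (r, r))"
      by (intro sum.cong refl mat_mult_entry[symmetric, of _ d d _ d]) auto
    also have "\<dots> = (\<Sum>i<m. \<Sum>r<d. \<Sum>j<m. (?T * (gen i j * gen j i)) $$ (r, r))" by (rule sum.swap)
    also have "\<dots> = (\<Sum>i<m. \<Sum>j<m. \<Sum>r<d. (?T * (gen i j * gen j i)) $$ (r, r))"
      by (rule sum.cong[OF refl]) (rule sum.swap)
    also have "\<dots> = (\<Sum>i<m. \<Sum>j<m. x i j)" by (simp add: x_def mat_trace_def)
    also have "\<dots> = (\<Sum>i<m. x i i + (\<Sum>j\<in>{..<m} - {i}. x i j))"
      by (intro sum.cong refl) (simp add: sum.remove)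
    also have "\<dots> = (\<Sum>i<m. x i i) + (\<Sum>i<m. \<Sum>j\<in>{..<m} - {i}. x i j)" by (rule sum.distrib)
    also have "(\<Sum>i<m. x i i) = (\<Sum>i<m. \<Sum>\<nu>\<in>wts. wmult \<nu> * (of_nat (\<nu> i))\<^sup>2 * tpow m t \<nu>)"
      using xd by (intro sum.cong) auto
    also have "(\<Sum>i<m. \<Sum>j\<in>{..<m} - {i}. x i j) = (\<Sum>i<m. \<Sum>j\<in>{..<m} - {i}. t i / (t i - t j) * (y i - y j))"
      using xo by (intro sum.cong refl) auto
    finally show ?thesis unfolding y_def by simp
  qed
  then show ?thesis by (rule that)
qed

end

section \<open>The Weyl character formula\<close>

lemma sum_distinct_ge:
  fixes B :: "nat set"
  assumes "finite B"
  shows "(\<Sum>i<card B. i) \<le> \<Sum>B"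
  using assms
proof (induction rule: finite_linorder_max_induct)
  case (insert b A)
  have "A \<subseteq> {..<b}" using insert by auto
  then have "card A \<le> b" using card_mono[of "{..<b}" A] by simp
  moreover have "b \<notin> A" using insert by auto
  ultimately show ?case using insert by simp
qed simp

lemma abel_summation:
  fixes s d :: "nat \<Rightarrow> int"
  shows "(\<Sum>i<m. s i * d i) = s 0 * (\<Sum>i<m. d i) + (\<Sum>r\<in>{1..<m}. (s r - s (r - 1)) * (\<Sum>i\<in>{r..<m}. d i))"
proof (induction m)
  case (Suc m)
  show ?case
  proof (cases "m = 0")
    case False
    have tele: "(\<Sum>r\<in>{1..<Suc n}. s r - s (r - 1)) = s n - s 0" for n
      by (induction n) auto
    have "(\<Sum>r\<in>{1..<Suc m}. (s r - s (r - 1)) * (\<Sum>i\<in>{r..<Suc m}. d i)) =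
        (\<Sum>r\<in>{1..<Suc m}. (s r - s (r - 1)) * (\<Sum>i\<in>{r..<m}. d i) + (s r - s (r - 1)) * d m)"
      by (intro sum.cong refl) (auto simp: distrib_left)
    also have "\<dots> = (\<Sum>r\<in>{1..<Suc m}. (s r - s (r - 1)) * (\<Sum>i\<in>{r..<m}. d i)) + (s m - s 0) * d m"
      unfolding sum.distrib sum_distrib_right[symmetric] tele ..
    also have "(\<Sum>r\<in>{1..<Suc m}. (s r - s (r - 1)) * (\<Sum>i\<in>{r..<m}. d i)) =
        (\<Sum>r\<in>{1..<m}. (s r - s (r - 1)) * (\<Sum>i\<in>{r..<m}. d i))"
      using False by simp
    finally show ?thesis using Suc by (simp add: algebra_simps)
  qed simp
qed simp

text \<open>Subtracting the multiple of the product of linear factors with the same top coefficient leaves too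
many roots for the remaining degree.\<close>

lemma poly_with_given_roots:
  fixes g :: "'a::field poly"
  assumes A: "finite A" and deg: "degree g \<le> card A" and root: "\<And>a. a \<in> A \<Longrightarrow> poly g a = 0"
  obtains K where "g = Polynomial.smult K (\<Prod>a\<in>A. [:- a, 1:])"
proof -
  let ?P = "\<Prod>a\<in>A. [:- a, 1:] :: 'a poly"
  have degP: "degree ?P = card A" using A by (simp add: degree_prod_eq_sum_degree)
  have lead: "lead_coeff ?P = 1" unfolding lead_coeff_prod by simp
  define h where "h = g - Polynomial.smult (coeff g (card A)) ?P"
  have "h = 0"
  proof (rule ccontr)
    assume h: "h \<noteq> 0"
    have "degree h \<le> card A" unfolding h_def
      using deg degP by (intro degree_diff_le) (auto intro: order_trans[OF degree_smult_le])
    moreover have "coeff h (card A) = 0" using lead degP by (simp add: h_def)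
    ultimately have "degree h < card A" using h
      by (metis leading_coeff_0_iff le_neq_implies_less)
    moreover have "A \<subseteq> {x. poly h x = 0}"
      using root A by (auto simp: h_def poly_prod)
    then have "card A \<le> degree h"
      using card_mono[OF poly_roots_finite[OF h]] card_poly_roots_bound[OF h] by (meson order_trans)
    ultimately show False by simp
  qed
  then have "g = Polynomial.smult (coeff g (card A)) ?P" by (simp add: h_def)
  then show ?thesis by (rule that)
qed

text \<open>The decreasing staircase \<open>m - 1, ..., 1, 0\<close>, which is zero from \<open>m\<close> on
by truncated subtraction.\<close>

definition stair :: "nat \<Rightarrow> nat \<Rightarrow> nat" where
  "stair m j = m - 1 - j"

definition alternant :: "nat \<Rightarrow> (nat \<Rightarrow> nat) \<Rightarrow> (nat \<Rightarrow> complex) \<Rightarrow> complex" where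
  "alternant m e t = (\<Sum>p | p permutes {..<m}. signof p * tpow m t (e \<circ> p))"

lemma alternant_det: "alternant m e t = det (mat m m (\<lambda>(i, j). t i ^ e j))"
  by (subst det_def'[of _ m])
    (auto simp: alternant_def tpow_def lessThan_atLeast0 permutes_in_image intro!: sum.cong prod.cong)

text \<open>As a function of \<open>t i\<close> alone the Vandermonde alternant is a polynomial of degree at
most \<open>m - 1\<close> that vanishes at the other \<open>t j\<close>, hence a multiple of \<open>\<Prod>j.
x - t j\<close>. The left side is \<open>x d/dx\<close> of it at \<open>x = t i\<close>.\<close>

lemma stair_logarithmic_derivative:
  assumes i: "i < m" and inj: "inj_on t {..<m}"
  shows "(\<Sum>p | p permutes {..<m}. signof p * of_nat (stair m (p i)) * tpow m t (stair m \<circ> p)) =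
    alternant m (stair m) t * (\<Sum>j\<in>{..<m} - {i}. t i / (t i - t j))"
proof -
  let ?J = "{..<m} - {i}"
  let ?c = "\<lambda>p. signof p * (\<Prod>j\<in>?J. t j ^ stair m (p j))"
  define g where "g = (\<Sum>p | p permutes {..<m}. monom (?c p) (stair m (p i)))"
  have fin: "finite {p. p permutes {..<m}}" by (simp add: finite_permutations)
  have g: "poly g x = alternant m (stair m) (t(i := x))" for x
  proof -
    have "tpow m (t(i := x)) (stair m \<circ> p) = (\<Prod>j\<in>?J. t j ^ stair m (p j)) * x ^ stair m (p i)" for p
    proof -
      have "tpow m (t(i := x)) (stair m \<circ> p) = x ^ stair m (p i) * (\<Prod>j\<in>?J. (t(i := x)) j ^ stair m (p j))"
        unfolding tpow_def using i by (subst prod.remove[of _ i]) auto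
      also have "(\<Prod>j\<in>?J. (t(i := x)) j ^ stair m (p j)) = (\<Prod>j\<in>?J. t j ^ stair m (p j))"
        by (intro prod.cong) auto
      finally show ?thesis by (simp only: mult.commute)
    qed
    then show ?thesis by (simp add: g_def alternant_def poly_sum poly_monom mult.assoc)
  qed
  have injJ: "inj_on t ?J" using inj by (rule inj_on_subset) auto
  have cardJ: "card (t ` ?J) = m - 1" using injJ i by (simp add: card_image)
  obtain K where K: "g = Polynomial.smult K (\<Prod>a\<in>t ` ?J. [:- a, 1:])"
  proof (rule poly_with_given_roots)
    show "finite (t ` ?J)" by simp
    show "degree g \<le> card (t ` ?J)"
      unfolding cardJ g_def by (intro degree_sum_le fin order_trans[OF degree_monom_le]) (simp add: stair_def)
    fix a assume "a \<in> t ` ?J"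
    then obtain j where j: "j < m" "j \<noteq> i" "a = t j" by auto
    have "det (mat m m (\<lambda>(l, j). (t(i := a)) l ^ stair m j)) = 0"
      by (rule det_identical_rows[of _ m i j]) (use i j in \<open>auto intro!: eq_vecI\<close>)
    then show "poly g a = 0" by (simp add: g alternant_det)
  qed
  have g2: "g = Polynomial.smult K (\<Prod>j\<in>?J. [:- t j, 1:])"
    unfolding K by (subst prod.reindex[OF injJ]) simp
  have ne: "t i - t j \<noteq> 0" if "j \<in> ?J" for j using that inj i by (auto simp: inj_on_def)
  have "(\<Sum>p | p permutes {..<m}. signof p * of_nat (stair m (p i)) * tpow m t (stair m \<circ> p)) = t i * poly (pderiv g) (t i)"
  proof -
    have "t i * poly (pderiv g) (t i) = (\<Sum>p | p permutes {..<m}. t i * poly (pderiv (monom (?c p) (stair m (p i)))) (t i))"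
      by (simp add: g_def higher_pderiv_sum[of 1, simplified] poly_sum sum_distrib_left)
    also have "\<dots> = (\<Sum>p | p permutes {..<m}. signof p * of_nat (stair m (p i)) * tpow m t (stair m \<circ> p))"
    proof (intro sum.cong refl)
      fix p
      have tp: "tpow m t (stair m \<circ> p) = t i ^ stair m (p i) * (\<Prod>j\<in>?J. t j ^ stair m (p j))"
        unfolding tpow_def using i by (subst prod.remove[of _ i]) auto
      show "t i * poly (pderiv (monom (?c p) (stair m (p i)))) (t i) = signof p * of_nat (stair m (p i)) * tpow m t (stair m \<circ> p)"
        unfolding tp pderiv_monom poly_monom by (cases "stair m (p i)") (simp_all add: mult_ac)
    qed
    finally show ?thesis by simp
  qed
  also have "poly (pderiv g) (t i) = K * (\<Sum>j\<in>?J. \<Prod>l\<in>?J - {j}. t i - t l)"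
    unfolding g2 pderiv_smult pderiv_prod by (simp add: poly_sum poly_prod pderiv_pCons)
  also have "(\<Sum>j\<in>?J. \<Prod>l\<in>?J - {j}. t i - t l) = (\<Sum>j\<in>?J. (\<Prod>l\<in>?J. t i - t l) * (1 / (t i - t j)))"
  proof (intro sum.cong refl)
    fix j assume j: "j \<in> ?J"
    have "(\<Prod>l\<in>?J. t i - t l) = (t i - t j) * (\<Prod>l\<in>?J - {j}. t i - t l)"
      using j by (intro prod.remove) auto
    then show "(\<Prod>l\<in>?J - {j}. t i - t l) = (\<Prod>l\<in>?J. t i - t l) * (1 / (t i - t j))"
      using ne[OF j] by simp
  qed
  also have "t i * (K * (\<Sum>j\<in>?J. (\<Prod>l\<in>?J. t i - t l) * (1 / (t i - t j)))) =
      (K * (\<Prod>l\<in>?J. t i - t l)) * (\<Sum>j\<in>?J. t i / (t i - t j))"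
    by (simp add: sum_distrib_left mult_ac)
  also have "K * (\<Prod>l\<in>?J. t i - t l) = poly g (t i)" unfolding g2 by (simp add: poly_prod)
  also have "poly g (t i) = alternant m (stair m) t" unfolding g by simp
  finally show ?thesis .
qed

text \<open>Symmetrize in \<open>i\<close> and \<open>j\<close> and use \<open>t i / (t i - t j) + t j / (t j
- t i) = 1\<close>. The left side is the cross term that the Laplace operator produces on a product with the
Vandermonde alternant, the first sum on the right is the one in the radial equation.\<close>

lemma off_diagonal_sum:
  fixes y :: "nat \<Rightarrow> complex"
  assumes inj: "inj_on t {..<m}"
  shows "2 * (\<Sum>i<m. (\<Sum>j\<in>{..<m} - {i}. t i / (t i - t j)) * y i) =
    (\<Sum>i<m. \<Sum>j\<in>{..<m} - {i}. t i / (t i - t j) * (y i - y j)) + of_nat (m - 1) * (\<Sum>i<m. y i)"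
proof -
  define r where "r = (\<lambda>i j. if i = j then 0 else t i / (t i - t j))"
  have off: "(\<Sum>j\<in>{..<m} - {i}. t i / (t i - t j) * f j) = (\<Sum>j<m. r i j * f j)" if "i < m" for i and f :: "nat \<Rightarrow> complex"
  proof -
    have "(\<Sum>j<m. r i j * f j) = r i i * f i + (\<Sum>j\<in>{..<m} - {i}. r i j * f j)"
      using that by (intro sum.remove) auto
    also have "(\<Sum>j\<in>{..<m} - {i}. r i j * f j) = (\<Sum>j\<in>{..<m} - {i}. t i / (t i - t j) * f j)"
      by (intro sum.cong) (auto simp: r_def)
    finally show ?thesis by (simp add: r_def)
  qed
  have rr: "r i j + r j i = (if i = j then 0 else 1)" if "i < m" "j < m" for i j
  proof (cases "i = j")
    case False
    then have ne: "t i - t j \<noteq> 0" "t j - t i \<noteq> 0" using that inj by (auto simp: inj_on_def)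
    have "t j / (t j - t i) = - (t j / (t i - t j))" by (metis minus_diff_eq minus_divide_right)
    moreover have "r i j + r j i = t i / (t i - t j) + t j / (t j - t i)" using False by (auto simp: r_def)
    ultimately have "r i j + r j i = t i / (t i - t j) - t j / (t i - t j)"
      by (simp only: diff_conv_add_uminus[of "_ / _"])
    also have "\<dots> = (t i - t j) / (t i - t j)" by (rule diff_divide_distrib[symmetric])
    also have "\<dots> = 1" using ne by simp
    finally show ?thesis using False by simp
  qed (simp add: r_def)
  have "(\<Sum>i<m. \<Sum>j<m. r i j * y j) = (\<Sum>i<m. \<Sum>j<m. r j i * y i)" by (rule sum.swap)
  then have "(\<Sum>i<m. \<Sum>j<m. r i j * y i) + (\<Sum>i<m. \<Sum>j<m. r i j * y j) = (\<Sum>i<m. \<Sum>j<m. (r i j + r j i) * y i)"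
    by (simp only: distrib_right sum.distrib)
  also have "\<dots> = (\<Sum>i<m. of_nat (m - 1) * y i)"
  proof (intro sum.cong refl)
    fix i assume i: "i \<in> {..<m}"
    have "(\<Sum>j<m. (r i j + r j i) * y i) = (r i i + r i i) * y i + (\<Sum>j\<in>{..<m} - {i}. (r i j + r j i) * y i)"
      using i by (intro sum.remove) auto
    also have "(\<Sum>j\<in>{..<m} - {i}. (r i j + r j i) * y i) = (\<Sum>j\<in>{..<m} - {i}. y i)"
      using i rr by (intro sum.cong refl) auto
    finally show "(\<Sum>j<m. (r i j + r j i) * y i) = of_nat (m - 1) * y i" using i by (simp add: r_def)
  qed
  finally have key: "(\<Sum>i<m. \<Sum>j<m. r i j * y i) + (\<Sum>i<m. \<Sum>j<m. r i j * y j) = of_nat (m - 1) * (\<Sum>i<m. y i)"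
    by (simp add: sum_distrib_left)
  have e1: "(\<Sum>i<m. (\<Sum>j\<in>{..<m} - {i}. t i / (t i - t j)) * y i) = (\<Sum>i<m. \<Sum>j<m. r i j * y i)"
    using off[where f = "\<lambda>_. 1"] by (intro sum.cong refl) (simp add: sum_distrib_right)
  have e2: "(\<Sum>i<m. \<Sum>j\<in>{..<m} - {i}. t i / (t i - t j) * (y i - y j)) =
      (\<Sum>i<m. \<Sum>j<m. r i j * y i) - (\<Sum>i<m. \<Sum>j<m. r i j * y j)"
    unfolding sum_subtractf[symmetric]
  proof (rule sum.cong[OF refl])
    fix i assume "i \<in> {..<m}"
    then have i: "i < m" by simp
    show "(\<Sum>j\<in>{..<m} - {i}. t i / (t i - t j) * (y i - y j)) = (\<Sum>j<m. r i j * y i - r i j * y j)"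
      unfolding off[OF i, of "\<lambda>j. y i - y j"] by (simp add: right_diff_distrib)
  qed
  show ?thesis unfolding e1 e2 key[symmetric] by simp
qed

text \<open>The staircase has the smallest possible suffix sums among its rearrangements, because a suffix
consists of distinct naturals.\<close>

lemma stair_suffix:
  assumes p: "p permutes {..<m}" and r: "r \<le> m"
  shows "(\<Sum>i\<in>{r..<m}. stair m i) \<le> (\<Sum>i\<in>{r..<m}. stair m (p i))"
proof -
  have pm: "p i < m" if "i < m" for i using permutes_in_image[OF p, of i] that by simp
  have inj: "inj_on (\<lambda>i. stair m (p i)) {r..<m}"
  proof (rule inj_onI)
    fix i j assume "i \<in> {r..<m}" "j \<in> {r..<m}" "stair m (p i) = stair m (p j)"
    then have "p i = p j" using pm[of i] pm[of j] by (simp add: stair_def)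
    then show "i = j" using permutes_inj[OF p] by (simp add: inj_eq)
  qed
  have "(\<Sum>i\<in>{r..<m}. stair m i) = (\<Sum>i<m - r. i)"
    by (rule sum.reindex_bij_witness[of _ "\<lambda>i. m - 1 - i" "\<lambda>i. m - 1 - i"]) (auto simp: stair_def)
  also have "\<dots> = (\<Sum>i<card ((\<lambda>i. stair m (p i)) ` {r..<m}). i)" using inj by (simp add: card_image)
  also have "\<dots> \<le> \<Sum>((\<lambda>i. stair m (p i)) ` {r..<m})" by (rule sum_distinct_ge) simp
  also have "\<dots> = (\<Sum>i\<in>{r..<m}. stair m (p i))" using inj by (simp add: sum.reindex)
  finally show ?thesis .
qed

lemma stair_total:
  assumes p: "p permutes {..<m}"
  shows "(\<Sum>i<m. f (stair m (p i))) = (\<Sum>i<m. f (stair m i))"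
  using sum.permute[OF p, of "\<lambda>i. f (stair m i)"] by (simp add: comp_def)

lemma suffix_sums_determine:
  fixes f g :: "nat \<Rightarrow> nat"
  assumes "\<And>r. r \<le> m \<Longrightarrow> (\<Sum>i\<in>{r..<m}. f i) = (\<Sum>i\<in>{r..<m}. g i)" and "i < m"
  shows "f i = g i"
proof -
  have "{i..<m} = insert i {Suc i..<m}" using assms(2) by auto
  then show ?thesis using assms(1)[of i] assms(1)[of "Suc i"] assms(2) by simp
qed

text \<open>With \<open>s = \<eta> + \<kappa>\<close> and \<open>d = \<eta> - \<kappa>\<close>, equal norms
mean \<open>\<Sum> s * d = 0\<close>. Abel summation writes this as a combination of the suffix sums of
\<open>d\<close>, which are nonnegative, with coefficients \<open>s r - s (r - 1) < 0\<close>; so all suffix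
sums of \<open>d\<close> vanish.\<close>

lemma dominated_same_norm_eq:
  fixes \<eta> \<kappa> :: "nat \<Rightarrow> nat"
  assumes d\<eta>: "strict_antimono_on {..<m} \<eta>" and d\<kappa>: "strict_antimono_on {..<m} \<kappa>"
    and dom: "\<And>r. r \<le> m \<Longrightarrow> (\<Sum>i\<in>{r..<m}. \<kappa> i) \<le> (\<Sum>i\<in>{r..<m}. \<eta> i)"
    and total: "(\<Sum>i<m. \<eta> i) = (\<Sum>i<m. \<kappa> i)"
    and norm: "(\<Sum>i<m. (\<eta> i)\<^sup>2) = (\<Sum>i<m. (\<kappa> i)\<^sup>2)"
    and i: "i < m"
  shows "\<eta> i = \<kappa> i"
proof -
  define s d where "s = (\<lambda>i. int (\<eta> i) + int (\<kappa> i))" and "d = (\<lambda>i. int (\<eta> i) - int (\<kappa> i))"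
  have "(\<Sum>i<m. s i * d i) = int (\<Sum>i<m. (\<eta> i)\<^sup>2) - int (\<Sum>i<m. (\<kappa> i)\<^sup>2)"
    by (simp add: s_def d_def sum_subtractf[symmetric] power2_eq_square algebra_simps)
  then have z: "(\<Sum>i<m. s i * d i) = 0" unfolding norm by simp
  have D0: "(\<Sum>i<m. d i) = 0"
  proof -
    have "(\<Sum>i<m. d i) = int (\<Sum>i<m. \<eta> i) - int (\<Sum>i<m. \<kappa> i)" by (simp add: d_def sum_subtractf)
    then show ?thesis unfolding total by simp
  qed
  have D: "(\<Sum>i\<in>{r..<m}. d i) \<ge> 0" if "r \<le> m" for r
  proof -
    have "(\<Sum>i\<in>{r..<m}. d i) = int (\<Sum>i\<in>{r..<m}. \<eta> i) - int (\<Sum>i\<in>{r..<m}. \<kappa> i)"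
      by (simp add: d_def sum_subtractf)
    moreover have "int (\<Sum>i\<in>{r..<m}. \<kappa> i) \<le> int (\<Sum>i\<in>{r..<m}. \<eta> i)"
      using dom[OF that] by (simp only: of_nat_le_iff)
    ultimately show ?thesis by linarith
  qed
  have step: "s r - s (r - 1) < 0" if "r \<in> {1..<m}" for r
  proof -
    have "\<eta> r < \<eta> (r - 1)" "\<kappa> r < \<kappa> (r - 1)"
      using that monotone_onD[OF d\<eta>, of "r - 1" r] monotone_onD[OF d\<kappa>, of "r - 1" r] by auto
    then show ?thesis by (simp add: s_def)
  qed
  have "(\<Sum>r\<in>{1..<m}. (s (r - 1) - s r) * (\<Sum>i\<in>{r..<m}. d i)) = 0"
  proof -
    have "(\<Sum>r\<in>{1..<m}. (s (r - 1) - s r) * (\<Sum>i\<in>{r..<m}. d i)) = - (\<Sum>r\<in>{1..<m}. (s r - s (r - 1)) * (\<Sum>i\<in>{r..<m}. d i))"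
      unfolding sum_negf[symmetric] by (intro sum.cong refl) (simp add: algebra_simps)
    then show ?thesis using abel_summation[of s d m] z D0 by simp
  qed
  moreover have "(s (r - 1) - s r) * (\<Sum>i\<in>{r..<m}. d i) \<ge> 0" if "r \<in> {1..<m}" for r
    using step[OF that] D[of r] that by (intro mult_nonneg_nonneg) auto
  ultimately have "\<forall>r\<in>{1..<m}. (s (r - 1) - s r) * (\<Sum>i\<in>{r..<m}. d i) = 0"
    using sum_nonneg_eq_0_iff[of "{1..<m}" "\<lambda>r. (s (r - 1) - s r) * (\<Sum>i\<in>{r..<m}. d i)"] by simp
  then have Dz: "(\<Sum>i\<in>{r..<m}. d i) = 0" if "r \<in> {1..<m}" for r
    using step[OF that] that by fastforce
  show ?thesis
  proof (rule suffix_sums_determine[OF _ i])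
    fix r assume "r \<le> m"
    then consider "r = 0" | "r = m" | "r \<in> {1..<m}" by fastforce
    then show "(\<Sum>i\<in>{r..<m}. \<eta> i) = (\<Sum>i\<in>{r..<m}. \<kappa> i)"
    proof cases
      case 1
      then show ?thesis using total by (simp add: lessThan_atLeast0)
    next
      case 3
      have "int (\<Sum>i\<in>{r..<m}. \<eta> i) - int (\<Sum>i\<in>{r..<m}. \<kappa> i) = (\<Sum>i\<in>{r..<m}. d i)"
        by (simp add: d_def sum_subtractf)
      then have "int (\<Sum>i\<in>{r..<m}. \<eta> i) = int (\<Sum>i\<in>{r..<m}. \<kappa> i)" using Dz[OF 3] by linarith
      then show ?thesis by (simp only: of_nat_eq_iff)
    qed simp
  qed
qed

locale dominant_gl_irrep = gl_irrep +
  assumes dominant: "\<And>i j. i \<le> j \<Longrightarrow> j < m \<Longrightarrow> mu ! j \<le> mu ! i"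
begin

text \<open>The exponents of nonzero multiplicity. Unlike the index set of the torus decomposition, this set
is invariant under permutations directly by \<open>wmult_permute\<close>.\<close>

definition wsupp :: "(nat \<Rightarrow> nat) set" where
  "wsupp = {\<nu> \<in> wts. wmult \<nu> \<noteq> 0}"

lemma finite_wsupp: "finite wsupp" and wsupp_wts: "wsupp \<subseteq> wts"
  using finite_wts by (auto simp: wsupp_def)

lemma sum_wsupp: "(\<Sum>\<nu>\<in>wts. wmult \<nu> * f \<nu>) = (\<Sum>\<nu>\<in>wsupp. wmult \<nu> * f \<nu>)"
  using finite_wts by (intro sum.mono_neutral_right) (auto simp: wsupp_def)

lemma wsupp_permute: "p permutes {..<m} \<Longrightarrow> \<nu> \<in> wsupp \<Longrightarrow> \<nu> \<circ> p \<in> wsupp"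
  using wmult_permute[of p \<nu>] by (auto simp: wsupp_def wmult_def split: if_splits)

abbreviation perms :: "(nat \<Rightarrow> nat) set" where
  "perms \<equiv> {p. p permutes {..<m}}"

lemma finite_perms: "finite perms" by (simp add: finite_permutations)

definition shifted :: "(nat \<Rightarrow> nat) \<times> (nat \<Rightarrow> nat) \<Rightarrow> nat \<Rightarrow> nat" where
  "shifted x i = fst x i + stair m (snd x i)"

text \<open>The coefficient of \<open>t^\<eta>\<close> in the product of the character with the Vandermonde
alternant.\<close>

definition acoeff :: "(nat \<Rightarrow> nat) \<Rightarrow> complex" where
  "acoeff \<eta> = (\<Sum>x\<in>{x \<in> wsupp \<times> perms. shifted x = \<eta>}. signof (snd x) * wmult (fst x))"

text \<open>The shifted highest weight. On \<open>{..<m}\<close> its values are the points of the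
diagram.\<close>

definition kap :: "nat \<Rightarrow> nat" where
  "kap i = top_weight i + stair m i"

lemma shifted_exponents:
  assumes "x \<in> wsupp \<times> perms"
  shows "shifted x \<in> exponents m"
proof -
  have "shifted x i = 0" if "m \<le> i" for i
  proof -
    have "fst x \<in> exponents m" using assms wsupp_wts wts_exponents by auto
    then have "fst x i = 0" using that by (auto simp: exponents_def)
    moreover have "snd x i = i" using assms permutes_not_in[of "snd x" "{..<m}" i] that by auto
    ultimately show ?thesis using that by (simp add: shifted_def stair_def)
  qed
  then show ?thesis by (simp add: exponents_def)
qed

lemma regroup:
  "(\<Sum>\<eta>\<in>shifted ` (wsupp \<times> perms). acoeff \<eta> * F \<eta>) =
    (\<Sum>p\<in>perms. \<Sum>\<nu>\<in>wsupp. signof p * wmult \<nu> * F (shifted (\<nu>, p)))"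
proof -
  let ?I = "wsupp \<times> perms"
  have fin: "finite ?I" using finite_wsupp finite_perms by simp
  have "(\<Sum>\<eta>\<in>shifted ` ?I. acoeff \<eta> * F \<eta>) =
    (\<Sum>\<eta>\<in>shifted ` ?I. \<Sum>x\<in>{x \<in> ?I. shifted x = \<eta>}. signof (snd x) * wmult (fst x) * F (shifted x))"
    unfolding acoeff_def sum_distrib_right by (intro sum.cong refl) auto
  also have "\<dots> = (\<Sum>x\<in>?I. signof (snd x) * wmult (fst x) * F (shifted x))"
    using fin by (intro sum.group) auto
  also have "\<dots> = (\<Sum>\<nu>\<in>wsupp. \<Sum>p\<in>perms. signof p * wmult \<nu> * F (shifted (\<nu>, p)))"
    by (simp add: sum.cartesian_product case_prod_beta)
  also have "\<dots> = (\<Sum>p\<in>perms. \<Sum>\<nu>\<in>wsupp. signof p * wmult \<nu> * F (shifted (\<nu>, p)))" by (rule sum.swap)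
  finally show ?thesis .
qed

lemma tpow_shifted: "tpow m t (shifted (\<nu>, p)) = tpow m t \<nu> * tpow m t (stair m \<circ> p)"
  unfolding tpow_add[symmetric] by (rule arg_cong[of _ _ "tpow m t"]) (simp add: shifted_def fun_eq_iff)

abbreviation rep_char :: "(nat \<Rightarrow> complex) \<Rightarrow> complex" where
  "rep_char t \<equiv> (\<Sum>\<nu>\<in>wts. wmult \<nu> * tpow m t \<nu>)"

text \<open>Let \<open>\<Delta>\<close> be the Vandermonde alternant and \<open>\<chi>\<close> the character.
The sum of the squared Euler operators \<open>t_i d/dt_i\<close> multiplies \<open>t^\<eta>\<close> by the
squared norm of \<open>\<eta>\<close>. Applied to \<open>\<Delta> \<chi>\<close> it gives
\<open>\<Delta>\<close> times its value on \<open>\<chi>\<close>, a cross term, and a constant times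
\<open>\<Delta> \<chi>\<close>; by \<open>stair_logarithmic_derivative\<close>,
\<open>off_diagonal_sum\<close> and \<open>casimir_equation\<close> the total is a constant times
\<open>\<Delta> \<chi>\<close>. Compare coefficients.\<close>

lemma laplace_eigenfunction:
  obtains E where "\<And>\<eta>. acoeff \<eta> \<noteq> 0 \<Longrightarrow> of_nat (\<Sum>i<m. (\<eta> i)\<^sup>2) = (E :: complex)"
proof -
  obtain c where c: "\<And>t. inj_on t {..<m} \<Longrightarrow>
    (\<Sum>i<m. \<Sum>\<nu>\<in>wts. wmult \<nu> * (of_nat (\<nu> i))\<^sup>2 * tpow m t \<nu>) +
    (\<Sum>i<m. \<Sum>j\<in>{..<m} - {i}. t i / (t i - t j) *
      ((\<Sum>\<nu>\<in>wts. wmult \<nu> * of_nat (\<nu> i) * tpow m t \<nu>) - (\<Sum>\<nu>\<in>wts. wmult \<nu> * of_nat (\<nu> j) * tpow m t \<nu>))) =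
    c * rep_char t"
    using casimir_equation by blast
  define M :: complex where "M = of_nat (\<Sum>i<m. mu ! i)"
  define R :: complex where "R = (\<Sum>i<m. (of_nat (stair m i))\<^sup>2)"
  define E where "E = c + of_nat (m - 1) * M + R"
  let ?T = "shifted ` (wsupp \<times> perms)"
  let ?N = "\<lambda>\<eta> :: nat \<Rightarrow> nat. (\<Sum>i<m. (of_nat (\<eta> i))\<^sup>2) :: complex"
  have "acoeff \<eta> * (?N \<eta> - E) = 0" if \<eta>: "\<eta> \<in> ?T" for \<eta>
  proof (rule monomials_independent[OF _ _ _ \<eta>, where m = m and c = "\<lambda>\<eta>. acoeff \<eta> * (?N \<eta> - E)"])
    show "finite ?T" using finite_wsupp finite_perms by simp
    show "?T \<subseteq> exponents m" using shifted_exponents by auto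
    fix t :: "nat \<Rightarrow> complex" assume inj: "inj_on t {..<m}"
    define y where "y = (\<lambda>i. \<Sum>\<nu>\<in>wts. wmult \<nu> * of_nat (\<nu> i) * tpow m t \<nu>)"
    define z where "z = (\<lambda>i. \<Sum>\<nu>\<in>wts. wmult \<nu> * (of_nat (\<nu> i))\<^sup>2 * tpow m t \<nu>)"
    define \<Delta> where "\<Delta> = alternant m (stair m) t"
    have ysum: "(\<Sum>i<m. y i) = M * rep_char t"
    proof -
      have "(\<Sum>i<m. y i) = (\<Sum>\<nu>\<in>wts. \<Sum>i<m. wmult \<nu> * of_nat (\<nu> i) * tpow m t \<nu>)"
        unfolding y_def by (rule sum.swap)
      also have "\<dots> = (\<Sum>\<nu>\<in>wts. M * (wmult \<nu> * tpow m t \<nu>))"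
      proof (intro sum.cong refl)
        fix \<nu> assume "\<nu> \<in> wts"
        then have "M = (\<Sum>i<m. of_nat (\<nu> i))" unfolding M_def using wts_same_total[of \<nu>] by (metis of_nat_sum)
        then show "(\<Sum>i<m. wmult \<nu> * of_nat (\<nu> i) * tpow m t \<nu>) = M * (wmult \<nu> * tpow m t \<nu>)"
          by (simp add: sum_distrib_left mult_ac)
      qed
      finally show ?thesis by (simp add: sum_distrib_left)
    qed
    have main: "(\<Sum>i<m. z i) + 2 * (\<Sum>i<m. (\<Sum>j\<in>{..<m} - {i}. t i / (t i - t j)) * y i) + R * rep_char t = E * rep_char t"
    proof -
      have c': "(\<Sum>i<m. z i) + (\<Sum>i<m. \<Sum>j\<in>{..<m} - {i}. t i / (t i - t j) * (y i - y j)) = c * rep_char t"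
        using c[OF inj] by (simp only: y_def z_def)
      show ?thesis
        unfolding off_diagonal_sum[OF inj] ysum E_def distrib_right mult.assoc c'[symmetric] by (simp only: add_ac)
    qed
    have Nsplit: "?N (shifted (\<nu>, p)) = ?N \<nu> + 2 * (\<Sum>i<m. of_nat (stair m (p i)) * of_nat (\<nu> i)) + R"
      if "p permutes {..<m}" for \<nu> p
    proof -
      have "?N (shifted (\<nu>, p)) = (\<Sum>i<m. (of_nat (\<nu> i))\<^sup>2 + 2 * (of_nat (stair m (p i)) * of_nat (\<nu> i)) + (of_nat (stair m (p i)))\<^sup>2)"
        by (intro sum.cong refl) (simp add: shifted_def power2_eq_square algebra_simps)
      also have "\<dots> = ?N \<nu> + 2 * (\<Sum>i<m. of_nat (stair m (p i)) * of_nat (\<nu> i)) + (\<Sum>i<m. (of_nat (stair m (p i)))\<^sup>2)"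
        by (simp add: sum.distrib sum_distrib_left)
      also have "(\<Sum>i<m. (of_nat (stair m (p i)))\<^sup>2) = R"
        unfolding R_def by (rule stair_total[OF that, of "\<lambda>x. (of_nat x)\<^sup>2"])
      finally show ?thesis .
    qed
    have "(\<Sum>\<eta>\<in>?T. acoeff \<eta> * (?N \<eta> - E) * tpow m t \<eta>) =
        (\<Sum>p\<in>perms. \<Sum>\<nu>\<in>wsupp. signof p * wmult \<nu> * ((?N (shifted (\<nu>, p)) - E) * tpow m t (shifted (\<nu>, p))))"
      using regroup[of "\<lambda>\<eta>. (?N \<eta> - E) * tpow m t \<eta>"] by (simp only: mult.assoc)
    also have "\<dots> = (\<Sum>p\<in>perms. \<Sum>\<nu>\<in>wts. signof p * wmult \<nu> * ((?N (shifted (\<nu>, p)) - E) * tpow m t (shifted (\<nu>, p))))"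
      by (rule sum.cong[OF refl]) (simp only: mult.assoc sum_distrib_left[symmetric] sum_wsupp)
    also have "\<dots> = (\<Sum>p\<in>perms. \<Sum>\<nu>\<in>wts. signof p * tpow m t (stair m \<circ> p) * (wmult \<nu> * ?N \<nu> * tpow m t \<nu>)
        + 2 * (\<Sum>i<m. signof p * of_nat (stair m (p i)) * tpow m t (stair m \<circ> p) * (wmult \<nu> * of_nat (\<nu> i) * tpow m t \<nu>))
        + signof p * tpow m t (stair m \<circ> p) * ((R - E) * (wmult \<nu> * tpow m t \<nu>)))"
    proof (intro sum.cong refl)
      fix p \<nu> assume p: "p \<in> perms"
      have "(\<Sum>i<m. signof p * of_nat (stair m (p i)) * tpow m t (stair m \<circ> p) * (wmult \<nu> * of_nat (\<nu> i) * tpow m t \<nu>)) =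
          signof p * wmult \<nu> * tpow m t \<nu> * tpow m t (stair m \<circ> p) * (\<Sum>i<m. of_nat (stair m (p i)) * of_nat (\<nu> i))"
        unfolding sum_distrib_left by (intro sum.cong refl) (simp only: mult_ac)
      then show "signof p * wmult \<nu> * ((?N (shifted (\<nu>, p)) - E) * tpow m t (shifted (\<nu>, p))) =
        signof p * tpow m t (stair m \<circ> p) * (wmult \<nu> * ?N \<nu> * tpow m t \<nu>)
        + 2 * (\<Sum>i<m. signof p * of_nat (stair m (p i)) * tpow m t (stair m \<circ> p) * (wmult \<nu> * of_nat (\<nu> i) * tpow m t \<nu>))
        + signof p * tpow m t (stair m \<circ> p) * ((R - E) * (wmult \<nu> * tpow m t \<nu>))"
        using p Nsplit[of p \<nu>] by (simp only: tpow_shifted mem_Collect_eq) (simp add: algebra_simps)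
    qed
    also have "\<dots> = (\<Sum>p\<in>perms. signof p * tpow m t (stair m \<circ> p) * (\<Sum>i<m. z i)
        + 2 * (\<Sum>i<m. signof p * of_nat (stair m (p i)) * tpow m t (stair m \<circ> p) * y i)
        + signof p * tpow m t (stair m \<circ> p) * ((R - E) * rep_char t))"
    proof (rule sum.cong[OF refl])
      fix p
      have zz: "(\<Sum>\<nu>\<in>wts. wmult \<nu> * ?N \<nu> * tpow m t \<nu>) = (\<Sum>i<m. z i)"
        unfolding z_def by (subst sum.swap) (simp add: sum_distrib_left sum_distrib_right mult_ac)
      have yy: "(\<Sum>\<nu>\<in>wts. \<Sum>i<m. signof p * of_nat (stair m (p i)) * tpow m t (stair m \<circ> p) * (wmult \<nu> * of_nat (\<nu> i) * tpow m t \<nu>)) =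
          (\<Sum>i<m. signof p * of_nat (stair m (p i)) * tpow m t (stair m \<circ> p) * y i)"
        unfolding y_def sum_distrib_left by (rule sum.swap)
      show "(\<Sum>\<nu>\<in>wts. signof p * tpow m t (stair m \<circ> p) * (wmult \<nu> * ?N \<nu> * tpow m t \<nu>)
        + 2 * (\<Sum>i<m. signof p * of_nat (stair m (p i)) * tpow m t (stair m \<circ> p) * (wmult \<nu> * of_nat (\<nu> i) * tpow m t \<nu>))
        + signof p * tpow m t (stair m \<circ> p) * ((R - E) * (wmult \<nu> * tpow m t \<nu>))) =
        signof p * tpow m t (stair m \<circ> p) * (\<Sum>i<m. z i)
        + 2 * (\<Sum>i<m. signof p * of_nat (stair m (p i)) * tpow m t (stair m \<circ> p) * y i)
        + signof p * tpow m t (stair m \<circ> p) * ((R - E) * rep_char t)"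
        unfolding sum.distrib sum_distrib_left[symmetric] zz yy ..
    qed
    also have "\<dots> = \<Delta> * (\<Sum>i<m. z i) + 2 * (\<Sum>i<m. (\<Sum>p\<in>perms. signof p * of_nat (stair m (p i)) * tpow m t (stair m \<circ> p)) * y i)
        + \<Delta> * ((R - E) * rep_char t)"
    proof -
      have "(\<Sum>p\<in>perms. \<Sum>i<m. signof p * of_nat (stair m (p i)) * tpow m t (stair m \<circ> p) * y i) =
          (\<Sum>i<m. (\<Sum>p\<in>perms. signof p * of_nat (stair m (p i)) * tpow m t (stair m \<circ> p)) * y i)"
        unfolding sum_distrib_right by (rule sum.swap)
      then show ?thesis
        unfolding sum.distrib sum_distrib_left[symmetric] sum_distrib_right[symmetric] \<Delta>_def alternant_def by simp
    qed
    also have "(\<Sum>i<m. (\<Sum>p\<in>perms. signof p * of_nat (stair m (p i)) * tpow m t (stair m \<circ> p)) * y i) =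
        \<Delta> * (\<Sum>i<m. (\<Sum>j\<in>{..<m} - {i}. t i / (t i - t j)) * y i)"
      unfolding sum_distrib_left \<Delta>_def
      by (rule sum.cong[OF refl], subst stair_logarithmic_derivative[OF _ inj], simp, simp only: mult.assoc)
    also have "\<Delta> * (\<Sum>i<m. z i) + 2 * (\<Delta> * (\<Sum>i<m. (\<Sum>j\<in>{..<m} - {i}. t i / (t i - t j)) * y i)) + \<Delta> * ((R - E) * rep_char t) =
        \<Delta> * (((\<Sum>i<m. z i) + 2 * (\<Sum>i<m. (\<Sum>j\<in>{..<m} - {i}. t i / (t i - t j)) * y i) + R * rep_char t) - E * rep_char t)"
      by (simp only: ring_distribs mult.left_commute[of _ 2] mult.commute[of _ 2]) (simp add: algebra_simps)
    also have "\<dots> = 0" unfolding main by simp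
    finally show "(\<Sum>\<eta>\<in>?T. acoeff \<eta> * (?N \<eta> - E) * tpow m t \<eta>) = 0" .
  qed
  moreover have "\<eta> \<in> ?T" if "acoeff \<eta> \<noteq> 0" for \<eta>
  proof (rule ccontr)
    assume "\<eta> \<notin> ?T"
    then have none: "{x \<in> wsupp \<times> perms. shifted x = \<eta>} = {}" by blast
    have "acoeff \<eta> = 0" unfolding acoeff_def none by simp
    then show False using that by simp
  qed
  ultimately have "of_nat (\<Sum>i<m. (\<eta> i)\<^sup>2) = E" if "acoeff \<eta> \<noteq> 0" for \<eta>
    using that by fastforce
  then show ?thesis by (rule that)
qed

lemma acoeff_permute:
  assumes q: "q permutes {..<m}"
  shows "acoeff (\<eta> \<circ> q) = signof q * acoeff \<eta>"
proof -
  define r where "r = inv_into UNIV q"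
  have r: "r permutes {..<m}" "q \<circ> r = id" "r \<circ> q = id"
    using permutes_inv[OF q] permutes_inv_o[OF q] by (auto simp: r_def)
  have sh: "shifted (\<nu> \<circ> s, p \<circ> s) = shifted (\<nu>, p) \<circ> s" for \<nu> p s
    by (simp add: shifted_def fun_eq_iff)
  have bij: "bij_betw (\<lambda>(\<nu>, p). (\<nu> \<circ> q, p \<circ> q)) {x \<in> wsupp \<times> perms. shifted x = \<eta>}
      {x \<in> wsupp \<times> perms. shifted x = \<eta> \<circ> q}"
  proof (rule bij_betwI[where g = "\<lambda>(\<nu>, p). (\<nu> \<circ> r, p \<circ> r)"])
    show "(\<lambda>(\<nu>, p). (\<nu> \<circ> q, p \<circ> q)) \<in> {x \<in> wsupp \<times> perms. shifted x = \<eta>} \<rightarrow> {x \<in> wsupp \<times> perms. shifted x = \<eta> \<circ> q}"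
      using wsupp_permute[OF q] permutes_compose[OF q] by (auto simp: sh)
    show "(\<lambda>(\<nu>, p). (\<nu> \<circ> r, p \<circ> r)) \<in> {x \<in> wsupp \<times> perms. shifted x = \<eta> \<circ> q} \<rightarrow> {x \<in> wsupp \<times> perms. shifted x = \<eta>}"
      using wsupp_permute[OF r(1)] permutes_compose[OF r(1)] by (auto simp: sh comp_assoc r(2))
  qed (auto simp: comp_assoc r)
  have "acoeff (\<eta> \<circ> q) = (\<Sum>x\<in>{x \<in> wsupp \<times> perms. shifted x = \<eta>}.
      signof (snd (case x of (\<nu>, p) \<Rightarrow> (\<nu> \<circ> q, p \<circ> q))) * wmult (fst (case x of (\<nu>, p) \<Rightarrow> (\<nu> \<circ> q, p \<circ> q))))"
    unfolding acoeff_def by (rule sum.reindex_bij_betw[OF bij, symmetric])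
  also have "\<dots> = signof q * acoeff \<eta>"
    unfolding acoeff_def sum_distrib_left
  proof (rule sum.cong[OF refl])
    fix x assume "x \<in> {x \<in> wsupp \<times> perms. shifted x = \<eta>}"
    then obtain \<nu> p where x: "x = (\<nu>, p)" "p permutes {..<m}" by auto
    have "permutation p" "permutation q" using x(2) q permutation_permutes by (auto intro: finite_lessThan)
    then have "sign (p \<circ> q) = sign p * sign q" by (rule sign_compose)
    then show "signof (snd (case x of (\<nu>, p) \<Rightarrow> (\<nu> \<circ> q, p \<circ> q))) * wmult (fst (case x of (\<nu>, p) \<Rightarrow> (\<nu> \<circ> q, p \<circ> q))) =
        signof q * (signof (snd x) * wmult (fst x))"
      using x wmult_permute[OF q] by simp
  qed
  finally show ?thesis .
qed

lemma shifted_dominates: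
  assumes x: "x \<in> wsupp \<times> perms" and r: "r \<le> m"
  shows "(\<Sum>i\<in>{r..<m}. top_weight i) \<le> (\<Sum>i\<in>{r..<m}. fst x i)"
    "(\<Sum>i\<in>{r..<m}. stair m i) \<le> (\<Sum>i\<in>{r..<m}. stair m (snd x i))"
proof -
  have w: "fst x \<in> wts" using x wsupp_wts by auto
  have "(\<Sum>i<m. (if r \<le> i then 1 else 0) * mu ! i) \<le> (\<Sum>i<m. (if r \<le> i then 1 else 0) * fst x i)"
    by (rule wts_dominated[OF w]) auto
  moreover have "(\<Sum>i<m. (if r \<le> i then 1 else 0) * f i) = (\<Sum>i\<in>{r..<m}. f i)" for f :: "nat \<Rightarrow> nat"
    by (rule sum.mono_neutral_cong_right) auto
  moreover have "(\<Sum>i\<in>{r..<m}. mu ! i) = (\<Sum>i\<in>{r..<m}. top_weight i)"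
    by (intro sum.cong) (auto simp: top_weight_def)
  ultimately show "(\<Sum>i\<in>{r..<m}. top_weight i) \<le> (\<Sum>i\<in>{r..<m}. fst x i)" by simp
  show "(\<Sum>i\<in>{r..<m}. stair m i) \<le> (\<Sum>i\<in>{r..<m}. stair m (snd x i))"
    using stair_suffix[OF _ r] x by auto
qed

lemma kap_antimono: "strict_antimono_on {..<m} kap"
proof (rule monotone_onI)
  fix i j assume ij: "i \<in> {..<m}" "j \<in> {..<m}" "i < j"
  then have "mu ! j \<le> mu ! i" using dominant[of i j] by simp
  then show "kap j < kap i" using ij by (auto simp: kap_def top_weight_def stair_def)
qed

lemma kap_inj: "inj_on kap {..<m}"
  using strict_antimono_inj[of m kap] kap_antimono by (simp add: lessThan_atLeast0)

text \<open>Both summands of an exponent dominate their part of \<open>kap\<close>, so equality is possible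
only for the highest weight and the identity permutation.\<close>

lemma acoeff_kap: "acoeff kap = 1"
proof -
  have "{x \<in> wsupp \<times> perms. shifted x = kap} = {(top_weight, id)}"
  proof (intro equalityI subsetI)
    fix x assume "x \<in> {x \<in> wsupp \<times> perms. shifted x = kap}"
    then have x: "x \<in> wsupp \<times> perms" "shifted x = kap" by auto
    have split: "(\<Sum>i\<in>{r..<m}. top_weight i) = (\<Sum>i\<in>{r..<m}. fst x i) \<and>
        (\<Sum>i\<in>{r..<m}. stair m i) = (\<Sum>i\<in>{r..<m}. stair m (snd x i))" if r: "r \<le> m" for r
    proof -
      have "(\<Sum>i\<in>{r..<m}. shifted x i) = (\<Sum>i\<in>{r..<m}. kap i)" using x(2) by simp
      then show ?thesis using shifted_dominates[OF x(1) r] by (simp add: shifted_def kap_def sum.distrib)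
    qed
    have "fst x i = top_weight i" if "i < m" for i
      by (rule suffix_sums_determine[OF _ that]) (use split in simp)
    moreover have "fst x \<in> exponents m" "top_weight \<in> exponents m"
      using x wsupp_wts wts_exponents top_weight_projection by auto
    ultimately have 1: "fst x = top_weight" by (intro exponents_eqI[of _ m])
    have st: "stair m (snd x i) = stair m i" if "i < m" for i
      by (rule suffix_sums_determine[OF _ that]) (use split in simp)
    have perm: "snd x permutes {..<m}" using x by auto
    have "snd x i = i" for i
    proof (cases "i < m")
      case True
      then have "snd x i < m" using permutes_in_image[OF perm, of i] by simp
      then show ?thesis using st[OF True] True by (simp add: stair_def)
    next
      case False
      then show ?thesis using permutes_not_in[OF perm, of i] by simp
    qed
    then have "snd x = id" by auto
    then show "x \<in> {(top_weight, id)}" using 1 by (simp add: prod_eq_iff)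
  next
    fix x assume "x \<in> {(top_weight, id :: nat \<Rightarrow> nat)}"
    then show "x \<in> {x \<in> wsupp \<times> perms. shifted x = kap}"
      using top_weight_projection(1) wmult_top_weight
      by (auto simp: wsupp_def shifted_def kap_def fun_eq_iff permutes_id)
  qed
  then show ?thesis unfolding acoeff_def by (simp add: wmult_top_weight)
qed

text \<open>Antisymmetry excludes exponents with repeated entries, so \<open>\<eta>\<close> can be sorted. Its
sorted form dominates \<open>kap\<close> and has the same norm, since \<open>kap\<close> itself occurs with
coefficient 1; now apply \<open>dominated_same_norm_eq\<close>.\<close>

lemma acoeff_support:
  assumes "acoeff \<eta> \<noteq> 0"
  obtains q where "q permutes {..<m}" "\<eta> = kap \<circ> q"
proof -
  obtain E where E: "\<And>\<eta>. acoeff \<eta> \<noteq> 0 \<Longrightarrow> of_nat (\<Sum>i<m. (\<eta> i)\<^sup>2) = (E :: complex)"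
    using laplace_eigenfunction by blast
  have "inj_on \<eta> {0..<m}"
  proof (rule ccontr)
    assume "\<not> inj_on \<eta> {0..<m}"
    then obtain a b where ab: "a < m" "b < m" "a \<noteq> b" "\<eta> a = \<eta> b" by (auto simp: inj_on_def)
    have p: "Transposition.transpose a b permutes {..<m}" using ab by (intro permutes_swap_id) auto
    have "\<eta> \<circ> Transposition.transpose a b = \<eta>"
      using ab by (auto simp: fun_eq_iff Transposition.transpose_def)
    then have "acoeff \<eta> = signof (Transposition.transpose a b) * acoeff \<eta>"
      using acoeff_permute[OF p, of \<eta>] by simp
    then show False using assms ab by (simp add: sign_swap_id)
  qed
  then obtain p where p: "p permutes {0..<m}" "strict_antimono_on {0..<m} (\<eta> \<circ> p)"
    by (rule sort_decreasing)
  then have p': "p permutes {..<m}" "strict_antimono_on {..<m} (\<eta> \<circ> p)" by (auto simp: lessThan_atLeast0)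
  let ?\<eta> = "\<eta> \<circ> p"
  have ne: "acoeff ?\<eta> \<noteq> 0" using acoeff_permute[OF p'(1), of \<eta>] assms by (simp add: sign_def)
  have "{x \<in> wsupp \<times> perms. shifted x = ?\<eta>} \<noteq> {}"
  proof
    assume none: "{x \<in> wsupp \<times> perms. shifted x = ?\<eta>} = {}"
    have "acoeff ?\<eta> = 0" unfolding acoeff_def none by simp
    then show False using ne by simp
  qed
  then obtain x where x: "x \<in> wsupp \<times> perms" "shifted x = ?\<eta>" by blast
  have eq: "?\<eta> i = kap i" if "i < m" for i
  proof (rule dominated_same_norm_eq[OF p'(2) kap_antimono _ _ _ that])
    show "(\<Sum>i\<in>{r..<m}. kap i) \<le> (\<Sum>i\<in>{r..<m}. ?\<eta> i)" if "r \<le> m" for r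
      unfolding x(2)[symmetric] using shifted_dominates[OF x(1) that] by (simp add: shifted_def kap_def sum.distrib)
    show "(\<Sum>i<m. ?\<eta> i) = (\<Sum>i<m. kap i)"
    proof -
      have "fst x \<in> wts" "snd x permutes {..<m}" using x wsupp_wts by auto
      then have "(\<Sum>i<m. fst x i) = (\<Sum>i<m. top_weight i)" "(\<Sum>i<m. stair m (snd x i)) = (\<Sum>i<m. stair m i)"
        using wts_same_total[of "fst x"] stair_total[of "snd x" m "\<lambda>x. x"]
        by (auto simp: top_weight_def)
      then show ?thesis unfolding x(2)[symmetric] by (simp add: shifted_def kap_def sum.distrib)
    qed
    have "of_nat (\<Sum>i<m. (?\<eta> i)\<^sup>2) = (of_nat (\<Sum>i<m. (kap i)\<^sup>2) :: complex)"
      using E[OF ne] E[of kap] acoeff_kap by simp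
    then show "(\<Sum>i<m. (?\<eta> i)\<^sup>2) = (\<Sum>i<m. (kap i)\<^sup>2)" using of_nat_eq_iff by blast
  qed
  have "?\<eta> = kap"
  proof (rule exponents_eqI[of _ m])
    show "?\<eta> \<in> exponents m" using shifted_exponents[OF x(1)] x(2) by simp
    show "kap \<in> exponents m" by (auto simp: exponents_def kap_def top_weight_def stair_def)
  qed (rule eq)
  define q where "q = inv_into UNIV p"
  have q: "q permutes {..<m}" "p \<circ> q = id"
    using permutes_inv[OF p'(1)] permutes_inv_o[OF p'(1)] by (auto simp: q_def)
  have "\<eta> = kap \<circ> q" unfolding \<open>?\<eta> = kap\<close>[symmetric] by (simp add: comp_assoc q)
  then show ?thesis using q(1) by (rule that[rotated])
qed

text \<open>The product on the left is the sum of \<open>acoeff \<eta> * t^\<eta>\<close>, and only the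
permutations of \<open>kap\<close> contribute, each with its sign.\<close>

theorem weyl_character_formula:
  "alternant m (stair m) t * rep_char t = alternant m kap t"
proof -
  let ?T = "shifted ` (wsupp \<times> perms)"
  have finT: "finite ?T" using finite_wsupp finite_perms by simp
  have ak: "acoeff (kap \<circ> q) = signof q" if "q permutes {..<m}" for q
    using acoeff_permute[OF that, of kap] acoeff_kap by simp
  have "alternant m (stair m) t * rep_char t = (\<Sum>p\<in>perms. \<Sum>\<nu>\<in>wsupp. signof p * wmult \<nu> * tpow m t (shifted (\<nu>, p)))"
    unfolding alternant_def sum_wsupp sum_product tpow_shifted by (intro sum.cong refl) (simp add: mult_ac)
  also have "\<dots> = (\<Sum>\<eta>\<in>?T. acoeff \<eta> * tpow m t \<eta>)" by (rule regroup[symmetric])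
  also have "\<dots> = (\<Sum>\<eta>\<in>(\<lambda>q. kap \<circ> q) ` perms. acoeff \<eta> * tpow m t \<eta>)"
  proof (rule sum.mono_neutral_right[OF finT])
    show "(\<lambda>q. kap \<circ> q) ` perms \<subseteq> ?T"
    proof (rule image_subsetI)
      fix q assume "q \<in> perms"
      then have "acoeff (kap \<circ> q) \<noteq> 0" using ak[of q] by (simp add: sign_def)
      then have "{x \<in> wsupp \<times> perms. shifted x = kap \<circ> q} \<noteq> {}" unfolding acoeff_def by fastforce
      then obtain x where "x \<in> wsupp \<times> perms" "shifted x = kap \<circ> q" by blast
      then show "kap \<circ> q \<in> ?T" by (intro image_eqI[of _ _ x]) simp_all
    qed
    show "\<forall>\<eta>\<in>?T - (\<lambda>q. kap \<circ> q) ` perms. acoeff \<eta> * tpow m t \<eta> = 0"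
    proof
      fix \<eta> assume \<eta>: "\<eta> \<in> ?T - (\<lambda>q. kap \<circ> q) ` perms"
      have "acoeff \<eta> = 0"
      proof (rule ccontr)
        assume "acoeff \<eta> \<noteq> 0"
        then obtain q where "q permutes {..<m}" "\<eta> = kap \<circ> q" by (rule acoeff_support)
        then show False using \<eta> by blast
      qed
      then show "acoeff \<eta> * tpow m t \<eta> = 0" by simp
    qed
  qed
  also have "\<dots> = (\<Sum>q\<in>perms. acoeff (kap \<circ> q) * tpow m t (kap \<circ> q))"
  proof (rule sum.reindex_cong[of "\<lambda>q. kap \<circ> q", OF _ refl refl])
    show "inj_on (\<lambda>q. kap \<circ> q) perms"
    proof (rule inj_onI)
      fix q q' assume q: "q \<in> perms" "q' \<in> perms" "kap \<circ> q = kap \<circ> q'"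
      show "q = q'"
      proof (rule ext)
        fix i
        show "q i = q' i"
        proof (cases "i < m")
          case True
          then have "q i \<in> {..<m}" "q' i \<in> {..<m}"
            using q permutes_in_image[of q "{..<m}" i] permutes_in_image[of q' "{..<m}" i] by auto
          then show ?thesis using fun_cong[OF q(3), of i] inj_onD[OF kap_inj] by simp
        next
          case False
          then show ?thesis using q permutes_not_in[of q "{..<m}" i] permutes_not_in[of q' "{..<m}" i] by simp
        qed
      qed
    qed
  qed
  also have "\<dots> = alternant m kap t" unfolding alternant_def using ak by (intro sum.cong) auto
  finally show ?thesis .
qed

end

section \<open>Diagrams as decreasing enumerations and the Cauchy-Binet formula\<close>

lemma finite_diagrams: "finite (diagrams n k)"
proof (rule finite_subset)
  show "diagrams n k \<subseteq> {xs. set xs \<subseteq> {..k} \<and> length xs = n}" by (auto simp: diagrams_def)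
  show "finite {xs. set xs \<subseteq> {..k} \<and> length xs = n}" by (rule finite_lists_length_eq) simp
qed

lemma diagram_nth_mono:
  assumes "lam \<in> diagrams n k" "i \<le> j" "j < n"
  shows "lam ! j \<le> lam ! i"
  using assms by (cases "i = j") (auto simp: diagrams_def sorted_wrt_iff_nth_less)

lemma diagram_nth_le:
  assumes "lam \<in> diagrams n k" "i < n"
  shows "lam ! i \<le> k"
  using assms by (auto simp: diagrams_def)

lemma particle_antimono:
  assumes "lam \<in> diagrams n k"
  shows "strict_antimono_on {0..<n} (particle n lam)"
proof (rule monotone_onI)
  fix i j assume "i \<in> {0..<n}" "j \<in> {0..<n}" "i < j"
  moreover from this have "lam ! j \<le> lam ! i" using diagram_nth_mono[OF assms] by simp
  ultimately show "particle n lam j < particle n lam i" by (auto simp: particle_def)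
qed

lemma particle_less:
  assumes "lam \<in> diagrams n k" "i < n"
  shows "particle n lam i < n + k"
  using diagram_nth_le[OF assms] assms(2) by (simp add: particle_def)

lemma strict_antimono_gap:
  fixes f :: "nat \<Rightarrow> nat"
  assumes "strict_antimono_on {0..<n} f" "i \<le> j" "j < n"
  shows "f j + (j - i) \<le> f i"
  using assms(2,3)
proof (induction j rule: dec_induct)
  case (step j)
  have "f (Suc j) < f j" using assms(1) step by (auto simp: monotone_on_def)
  then show ?case using step by simp
qed simp

text \<open>Strictly decreasing sequences of points in \<open>{0..<n + k}\<close> are the point configurations
of diagrams in the \<open>n\<close> by \<open>k\<close> rectangle; subtracting the staircase recovers the row
lengths.\<close>

lemma antimono_is_particle:
  assumes dec: "strict_antimono_on {0..<n} f" and ran: "\<And>i. i < n \<Longrightarrow> f i < n + k"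
  obtains lam where "lam \<in> diagrams n k" "\<And>i. i < n \<Longrightarrow> particle n lam i = f i"
proof -
  define lam where "lam = map (\<lambda>i. f i - (n - 1 - i)) [0..<n]"
  have ge: "n - 1 - i \<le> f i" if "i < n" for i
    using strict_antimono_gap[OF dec, of i "n - 1"] that by force
  have le: "f i - (n - 1 - i) \<le> k" if "i < n" for i
    using strict_antimono_gap[OF dec, of 0 i] ran[of 0] that by simp
  have "lam ! j \<le> lam ! i" if "i < j" "j < n" for i j
    using strict_antimono_gap[OF dec, of i j] that ge by (simp add: lam_def)
  then have "lam \<in> diagrams n k"
    using le by (auto simp: diagrams_def sorted_wrt_iff_nth_less lam_def)
  moreover have "particle n lam i = f i" if "i < n" for i
    using ge[OF that] that by (simp add: particle_def lam_def)
  ultimately show ?thesis by (rule that)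
qed

lemma particle_inject:
  assumes "lam \<in> diagrams n k" "lam' \<in> diagrams n k"
    and "particle n lam ` {0..<n} = particle n lam' ` {0..<n}"
  shows "lam = lam'"
proof (rule nth_equalityI)
  show "length lam = length lam'" using assms by (simp add: diagrams_def)
  fix i assume "i < length lam"
  then have "particle n lam i = particle n lam' i"
    using decreasing_unique[OF particle_antimono[OF assms(1)] particle_antimono[OF assms(2)] assms(3)]
      assms(1) by (auto simp: diagrams_def)
  then show "lam ! i = lam' ! i" by (simp add: particle_def)
qed

text \<open>Every injection is a decreasing enumeration, given by a diagram, preceded by a
permutation.\<close>

lemma injections_by_diagrams:
  "bij_betw (\<lambda>(lam, p). restrict (particle n lam \<circ> p) {0..<n})
     (diagrams n k \<times> {p. p permutes {0..<n}})
     {f \<in> {0..<n} \<rightarrow>\<^sub>E {0..<n + k}. inj_on f {0..<n}}"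
proof (rule bij_betwI')
  fix x y assume "x \<in> diagrams n k \<times> {p. p permutes {0..<n}}"
    "y \<in> diagrams n k \<times> {p. p permutes {0..<n}}"
  then obtain lam p lam' p' where x: "x = (lam, p)" "lam \<in> diagrams n k" "p permutes {0..<n}"
    and y: "y = (lam', p')" "lam' \<in> diagrams n k" "p' permutes {0..<n}" by auto
  have "lam = lam' \<and> p = p'"
    if eq: "restrict (particle n lam \<circ> p) {0..<n} = restrict (particle n lam' \<circ> p') {0..<n}"
  proof -
    have eqi: "particle n lam (p i) = particle n lam' (p' i)" if "i \<in> {0..<n}" for i
      using fun_cong[OF eq, of i] that by simp
    have "particle n lam ` {0..<n} = (particle n lam \<circ> p) ` {0..<n}"
      using x(3) by (metis image_comp permutes_image)
    also have "\<dots> = (particle n lam' \<circ> p') ` {0..<n}" using eqi by (intro image_cong) auto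
    also have "\<dots> = particle n lam' ` {0..<n}" using y(3) by (metis image_comp permutes_image)
    finally have l: "lam = lam'" by (rule particle_inject[OF x(2) y(2)])
    have "p i = p' i" if "i \<in> {0..<n}" for i
      using eqi[OF that] inj_onD[OF strict_antimono_inj[OF particle_antimono[OF x(2)]]]
        permutes_in_image[OF x(3)] permutes_in_image[OF y(3)] that l by metis
    then show ?thesis using l x(3) y(3)
      by (metis permutes_not_in ext)
  qed
  then show "((case x of (lam, p) \<Rightarrow> restrict (particle n lam \<circ> p) {0..<n}) =
      (case y of (lam, p) \<Rightarrow> restrict (particle n lam \<circ> p) {0..<n})) = (x = y)"
    using x y by auto
next
  fix x assume "x \<in> diagrams n k \<times> {p. p permutes {0..<n}}"
  then obtain lam p where x: "x = (lam, p)" "lam \<in> diagrams n k" "p permutes {0..<n}" by auto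
  have "inj_on (particle n lam \<circ> p) {0..<n}"
    using permutes_inj_on[OF x(3)] permutes_image[OF x(3)]
      strict_antimono_inj[OF particle_antimono[OF x(2)]] by (intro comp_inj_on) auto
  then show "(case x of (lam, p) \<Rightarrow> restrict (particle n lam \<circ> p) {0..<n})
      \<in> {f \<in> {0..<n} \<rightarrow>\<^sub>E {0..<n + k}. inj_on f {0..<n}}"
    using x particle_less[OF x(2)] permutes_in_image[OF x(3)] by (auto simp: inj_on_def)
next
  fix f assume "f \<in> {f \<in> {0..<n} \<rightarrow>\<^sub>E {0..<n + k}. inj_on f {0..<n}}"
  then have f: "f \<in> {0..<n} \<rightarrow>\<^sub>E {0..<n + k}" "inj_on f {0..<n}" by auto
  obtain p where p: "p permutes {0..<n}" "strict_antimono_on {0..<n} (f \<circ> p)"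
    using sort_decreasing[OF f(2)] by blast
  have "(f \<circ> p) i < n + k" if "i < n" for i
    using f(1) permutes_in_image[OF p(1), of i] that by (auto simp: PiE_iff)
  then obtain lam where lam: "lam \<in> diagrams n k" "\<And>i. i < n \<Longrightarrow> particle n lam i = (f \<circ> p) i"
    using antimono_is_particle[OF p(2)] by blast
  define r where "r = inv_into UNIV p"
  have r: "r permutes {0..<n}" "p (r i) = i" for i
    using permutes_inv[OF p(1)] permutes_inverses(1)[OF p(1)] by (auto simp: r_def)
  have "f = restrict (particle n lam \<circ> r) {0..<n}"
  proof
    fix i
    show "f i = restrict (particle n lam \<circ> r) {0..<n} i"
    proof (cases "i < n")
      case True
      then have "r i < n" using permutes_in_image[OF r(1), of i] by simp
      then show ?thesis using True lam(2)[of "r i"] r(2) by simp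
    next
      case False
      then show ?thesis using f(1) by (auto simp: PiE_iff extensional_def)
    qed
  qed
  then show "\<exists>x\<in>diagrams n k \<times> {p. p permutes {0..<n}}.
      f = (case x of (lam, p) \<Rightarrow> restrict (particle n lam \<circ> p) {0..<n})"
    using lam(1) r(1) by (intro bexI[of _ "(lam, r)"]) auto
qed

text \<open>The common core of the Cauchy-Binet formula and of the Laplace expansion: group the functions by
their image; the sum over the permutations of one image is a determinant.\<close>

lemma alternating_sum:
  fixes P :: "nat \<Rightarrow> nat \<Rightarrow> 'a::comm_ring_1" and G :: "(nat \<Rightarrow> nat) \<Rightarrow> 'a"
  assumes cong: "\<And>f g. (\<And>i. i < n \<Longrightarrow> f i = g i) \<Longrightarrow> G f = G g"
    and zero: "\<And>f. \<not> inj_on f {0..<n} \<Longrightarrow> G f = 0"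
    and alt: "\<And>f p. p permutes {0..<n} \<Longrightarrow> G (f \<circ> p) = signof p * G f"
  shows "(\<Sum>f\<in>{0..<n} \<rightarrow>\<^sub>E {0..<n + k}. (\<Prod>i = 0..<n. P i (f i)) * G f) =
    (\<Sum>lam\<in>diagrams n k. det (mat n n (\<lambda>(i, j). P i (particle n lam j))) * G (particle n lam))"
proof -
  let ?I = "{f \<in> {0..<n} \<rightarrow>\<^sub>E {0..<n + k}. inj_on f {0..<n}}"
  let ?D = "diagrams n k \<times> {p. p permutes {0..<n}}"
  let ?h = "\<lambda>(lam, p). restrict (particle n lam \<circ> p) {0..<n}"
  let ?t = "\<lambda>f. (\<Prod>i = 0..<n. P i (f i)) * G f"
  have "(\<Sum>f\<in>{0..<n} \<rightarrow>\<^sub>E {0..<n + k}. ?t f) = (\<Sum>f\<in>?I. ?t f)"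
    by (rule sum.mono_neutral_right) (auto intro: finite_PiE simp: zero)
  also have "\<dots> = (\<Sum>x\<in>?D. ?t (?h x))"
    by (rule sum.reindex_bij_betw[OF injections_by_diagrams, symmetric])
  also have "\<dots> = (\<Sum>(lam, p)\<in>?D. signof p * (\<Prod>i = 0..<n. P i (particle n lam (p i))) * G (particle n lam))"
  proof (rule sum.cong[OF refl], clarify)
    fix lam p assume p: "p permutes {0..<n}"
    have "G (restrict (particle n lam \<circ> p) {0..<n}) = G (particle n lam \<circ> p)"
      by (rule cong) simp
    then show "?t (restrict (particle n lam \<circ> p) {0..<n}) =
        signof p * (\<Prod>i = 0..<n. P i (particle n lam (p i))) * G (particle n lam)"
      using alt[OF p] by simp
  qed
  also have "\<dots> = (\<Sum>lam\<in>diagrams n k. \<Sum>p | p permutes {0..<n}.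
      signof p * (\<Prod>i = 0..<n. P i (particle n lam (p i))) * G (particle n lam))"
    by (simp add: sum.cartesian_product)
  also have "\<dots> = (\<Sum>lam\<in>diagrams n k. det (mat n n (\<lambda>(i, j). P i (particle n lam j))) * G (particle n lam))"
  proof (rule sum.cong[OF refl])
    fix lam
    show "(\<Sum>p | p permutes {0..<n}.
        signof p * (\<Prod>i = 0..<n. P i (particle n lam (p i))) * G (particle n lam)) =
      det (mat n n (\<lambda>(i, j). P i (particle n lam j))) * G (particle n lam)"
      by (subst det_def'[of _ n]) (auto simp: sum_distrib_right permutes_in_image intro!: sum.cong prod.cong)
  qed
  finally show ?thesis .
qed

text \<open>Expanding all entries of the product gives a sum over functions \<open>f\<close> of
\<open>\<Prod>i. A i (f i)\<close> times the determinant of the rows \<open>f i\<close> of \<open>B\<close>,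
which is alternating in \<open>f\<close>.\<close>

theorem cauchy_binet:
  fixes A B :: "nat \<Rightarrow> nat \<Rightarrow> 'a::comm_ring_1"
  shows "det (mat n n (\<lambda>(i, j). \<Sum>c = 0..<n + k. A i c * B c j)) =
    (\<Sum>lam\<in>diagrams n k. det (mat n n (\<lambda>(i, j). A i (particle n lam j))) *
       det (mat n n (\<lambda>(i, j). B (particle n lam i) j)))"
proof -
  define G where "G = (\<lambda>f. det (mat n n (\<lambda>(i, j). B (f i) j)))"
  have "det (mat n n (\<lambda>(i, j). \<Sum>c = 0..<n + k. A i c * B c j)) =
     (\<Sum>p | p permutes {0..<n}. signof p * (\<Prod>i = 0..<n. \<Sum>c = 0..<n + k. A i c * B c (p i)))"
    by (subst det_def'[of _ n]) (auto simp: permutes_in_image intro!: sum.cong prod.cong)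
  also have "\<dots> = (\<Sum>p | p permutes {0..<n}. \<Sum>f\<in>{0..<n} \<rightarrow>\<^sub>E {0..<n + k}.
      signof p * (\<Prod>i = 0..<n. A i (f i) * B (f i) (p i)))"
    by (simp add: prod_sum_PiE sum_distrib_left)
  also have "\<dots> = (\<Sum>f\<in>{0..<n} \<rightarrow>\<^sub>E {0..<n + k}. \<Sum>p | p permutes {0..<n}.
      signof p * (\<Prod>i = 0..<n. A i (f i) * B (f i) (p i)))"
    by (rule sum.swap)
  also have "\<dots> = (\<Sum>f\<in>{0..<n} \<rightarrow>\<^sub>E {0..<n + k}. (\<Prod>i = 0..<n. A i (f i)) * G f)"
    unfolding G_def
    by (subst det_def'[of _ n]) (auto simp: sum_distrib_left permutes_in_image prod.distrib mult_ac intro!: sum.cong prod.cong)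
  also have "\<dots> = (\<Sum>lam\<in>diagrams n k. det (mat n n (\<lambda>(i, j). A i (particle n lam j))) * G (particle n lam))"
  proof (rule alternating_sum)
    fix f g :: "nat \<Rightarrow> nat" assume "\<And>i. i < n \<Longrightarrow> f i = g i"
    then show "G f = G g" unfolding G_def by (intro arg_cong[of _ _ det] eq_matI) auto
  next
    fix f :: "nat \<Rightarrow> nat" assume "\<not> inj_on f {0..<n}"
    then obtain i j where ij: "i \<noteq> j" "i < n" "j < n" "f i = f j" by (auto simp: inj_on_def)
    show "G f = 0" unfolding G_def
      by (rule det_identical_rows[of _ n i j]) (use ij in \<open>auto intro!: eq_vecI\<close>)
  next
    fix f p assume p: "p permutes {0..<n}"
    have "mat n n (\<lambda>(i, j). B ((f \<circ> p) i) j) = mat n n (\<lambda>(i, j). mat n n (\<lambda>(i, j). B (f i) j) $$ (p i, j))"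
      using permutes_in_image[OF p] by (intro eq_matI) auto
    then show "G (f \<circ> p) = signof p * G f" unfolding G_def
      using det_permute_rows[OF _ p, of "mat n n (\<lambda>(i, j). B (f i) j)"] by simp
  qed
  finally show ?thesis unfolding G_def .
qed

section \<open>Particles, holes and the Laplace expansion\<close>

lemma vandermonde_append:
  fixes y :: "nat \<Rightarrow> 'a::comm_ring_1"
  shows "vandermonde (n + k) y = vandermonde n y * vandermonde k (\<lambda>i. y (n + i)) * (\<Prod>s<k. \<Prod>r<n. y (n + s) - y r)"
proof (induction k)
  case (Suc k)
  have "(\<Prod>l<n + m. f l) = (\<Prod>r<n. f r) * (\<Prod>l<m. f (n + l))" for m and f :: "nat \<Rightarrow> 'a"
    by (induction m) (simp_all add: mult_ac)
  then show ?case using Suc by (simp add: vandermonde_def mult_ac)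
qed (simp add: vandermonde_def)

lemma det_permute_columns:
  assumes A: "A \<in> carrier_mat n n" and p: "p permutes {0..<n}"
  shows "det (mat n n (\<lambda>(i, j). A $$ (i, p j))) = signof p * det A"
proof -
  have "mat n n (\<lambda>(i, j). A $$ (i, p j)) = transpose_mat (mat n n (\<lambda>(i, j). transpose_mat A $$ (p i, j)))"
    using A permutes_in_image[OF p] by (intro eq_matI) auto
  then show ?thesis
    using A det_permute_rows[OF _ p, of "transpose_mat A"] det_transpose[OF A]
      det_transpose[of "mat n n (\<lambda>(i, j). transpose_mat A $$ (p i, j))" n] by simp
qed

definition dual_diagram :: "nat \<Rightarrow> nat list \<Rightarrow> nat list" where
  "dual_diagram k lam = conjugate_diagram k (complement_diagram k lam)"

lemma dual_diagram_nth:
  assumes "lam \<in> diagrams n k" "j < k"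
  shows "dual_diagram k lam ! j = card {i. i < n \<and> lam ! i + j < k}"
proof -
  have len: "length lam = n" using assms by (simp add: diagrams_def)
  have "dual_diagram k lam ! j = card {i. i < n \<and> j < k - lam ! (n - 1 - i)}"
    using assms(2) len
    by (auto simp: dual_diagram_def conjugate_diagram_def complement_diagram_def intro!: arg_cong[of _ _ card])
  also have "\<dots> = card {i. i < n \<and> lam ! i + j < k}"
    by (rule bij_betw_same_card[of "\<lambda>i. n - 1 - i"], rule bij_betwI[where g = "\<lambda>i. n - 1 - i"]) auto
  finally show ?thesis .
qed

lemma dual_diagram_in_diagrams:
  assumes "lam \<in> diagrams n k"
  shows "dual_diagram k lam \<in> diagrams k n"
proof -
  have len: "length (dual_diagram k lam) = k" by (simp add: dual_diagram_def conjugate_diagram_def)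
  have "dual_diagram k lam ! j \<le> dual_diagram k lam ! i" if "i < j" "j < k" for i j
    using that by (auto simp: dual_diagram_nth[OF assms] intro!: card_mono)
  moreover have "dual_diagram k lam ! i \<le> n" if "i < k" for i
  proof -
    have "card {i'. i' < n \<and> lam ! i' + i < k} \<le> card {..<n}" by (rule card_mono) auto
    then show ?thesis using that by (simp add: dual_diagram_nth[OF assms])
  qed
  ultimately show ?thesis using len by (auto simp: diagrams_def sorted_wrt_iff_nth_less in_set_conv_nth)
qed

text \<open>If \<open>lam ! i + j < k\<close>, then at least the \<open>n - i\<close> rows from
\<open>i\<close> on are counted in row \<open>j\<close> of the dual diagram, so the dual point is the larger
one; otherwise at most the \<open>n - i - 1\<close> rows after \<open>i\<close> are counted and it is the
smaller one.\<close>

lemma particle_dual_disjoint: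
  assumes lam: "lam \<in> diagrams n k" and i: "i < n" and j: "j < k"
  shows "particle n lam i \<noteq> particle k (dual_diagram k lam) j"
proof (cases "lam ! i + j < k")
  case True
  have "{i..<n} \<subseteq> {i. i < n \<and> lam ! i + j < k}"
  proof
    fix l assume "l \<in> {i..<n}"
    then have "lam ! l \<le> lam ! i" using diagram_nth_mono[OF lam] by simp
    then show "l \<in> {i. i < n \<and> lam ! i + j < k}" using True \<open>l \<in> {i..<n}\<close> by simp
  qed
  then have "n - i \<le> card {i. i < n \<and> lam ! i + j < k}"
    using card_mono[of "{i. i < n \<and> lam ! i + j < k}" "{i..<n}"] by simp
  then show ?thesis using True i j by (simp add: particle_def dual_diagram_nth[OF lam j])
next
  case False
  have "{i. i < n \<and> lam ! i + j < k} \<subseteq> {i<..<n}"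
  proof
    fix l assume l: "l \<in> {i. i < n \<and> lam ! i + j < k}"
    then have "\<not> l \<le> i" using diagram_nth_mono[OF lam, of l i] False i by auto
    then show "l \<in> {i<..<n}" using l by simp
  qed
  then have "card {i. i < n \<and> lam ! i + j < k} \<le> n - Suc i"
    using card_mono[of "{i<..<n}" "{i. i < n \<and> lam ! i + j < k}"] by simp
  then show ?thesis using False i j by (simp add: particle_def dual_diagram_nth[OF lam j])
qed

text \<open>The permutation of \<open>{0..<n + k}\<close> that lists the particles of a diagram and then those
of its dual, which are the holes, both in decreasing order.\<close>

definition particle_hole :: "nat \<Rightarrow> nat \<Rightarrow> nat list \<Rightarrow> nat \<Rightarrow> nat" where
  "particle_hole n k lam c =
    (if c < n then particle n lam c
     else if c < n + k then particle k (dual_diagram k lam) (c - n) else c)"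

lemma particle_hole_permutes:
  assumes lam: "lam \<in> diagrams n k"
  shows "particle_hole n k lam permutes {0..<n + k}"
proof -
  note dual = dual_diagram_in_diagrams[OF lam]
  have "inj_on (particle_hole n k lam) {0..<n + k}"
  proof (rule inj_onI)
    fix c d assume cd: "c \<in> {0..<n + k}" "d \<in> {0..<n + k}" "particle_hole n k lam c = particle_hole n k lam d"
    consider "c < n" "d < n" | "c < n" "\<not> d < n" | "\<not> c < n" "d < n" | "\<not> c < n" "\<not> d < n" by blast
    then show "c = d"
    proof cases
      case 1
      then show ?thesis using cd inj_onD[OF strict_antimono_inj[OF particle_antimono[OF lam]], of c d]
        by (simp add: particle_hole_def)
    next
      case 2
      then show ?thesis using cd particle_dual_disjoint[OF lam, of c "d - n"]
        by (simp add: particle_hole_def)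
    next
      case 3
      then show ?thesis using cd particle_dual_disjoint[OF lam, of d "c - n", symmetric]
        by (simp add: particle_hole_def)
    next
      case 4
      then have "c - n < k" "d - n < k" using cd by auto
      then have "c - n = d - n"
        using 4 cd inj_onD[OF strict_antimono_inj[OF particle_antimono[OF dual]], of "c - n" "d - n"]
        by (simp add: particle_hole_def)
      then show ?thesis using 4 by simp
    qed
  qed
  moreover have "particle_hole n k lam ` {0..<n + k} \<subseteq> {0..<n + k}"
    using particle_less[OF lam] particle_less[OF dual] by (auto simp: particle_hole_def add.commute)
  ultimately have "bij_betw (particle_hole n k lam) {0..<n + k} {0..<n + k}"
    by (intro bij_betw_imageI endo_inj_surj) auto
  then show ?thesis by (rule bij_imp_permutes) (simp add: particle_hole_def)
qed

text \<open>\<open>Y f\<close> replaces the first \<open>n\<close> rows of \<open>Z\<close> by the unit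
vectors at \<open>f 0, ..., f (n - 1)\<close>, and its determinant \<open>G f\<close> is alternating in
\<open>f\<close>. Multilinearity in these rows reduces the determinant of \<open>Z\<close> to
\<open>alternating_sum\<close>; for a decreasing enumeration, moving the particle columns to the front makes
\<open>Y f\<close> block triangular.\<close>

theorem laplace_expansion_rows:
  fixes Z :: "nat \<Rightarrow> nat \<Rightarrow> 'a::idom"
  shows "det (mat (n + k) (n + k) (\<lambda>(i, c). Z i c)) =
    (\<Sum>lam\<in>diagrams n k. signof (particle_hole n k lam) *
       det (mat n n (\<lambda>(i, j). Z i (particle n lam j))) *
       det (mat k k (\<lambda>(i, j). Z (n + i) (particle k (dual_diagram k lam) j))))"
proof -
  define Y where "Y = (\<lambda>f::nat\<Rightarrow>nat. mat (n + k) (n + k)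
    (\<lambda>(i, c). if i < n then (if f i = c then 1 else 0) else Z i c))"
  define G where "G = (\<lambda>f. det (Y f))"
  have G_expand: "G f = (\<Sum>p | p permutes {0..<n + k}. signof p *
      (\<Prod>i = 0..<n. if f i = p i then 1 else 0) * (\<Prod>i = n..<n + k. Z i (p i)))" for f
  proof -
    have "G f = (\<Sum>p | p permutes {0..<n + k}. signof p * (\<Prod>i = 0..<n + k. Y f $$ (i, p i)))"
      unfolding G_def by (rule det_def') (simp add: Y_def)
    also have "\<dots> = (\<Sum>p | p permutes {0..<n + k}. signof p *
      (\<Prod>i = 0..<n. if f i = p i then 1 else 0) * (\<Prod>i = n..<n + k. Z i (p i)))"
    proof (rule sum.cong[OF refl])
      fix p assume "p \<in> {p. p permutes {0..<n + k}}"
      then have pi: "p i < n + k" if "i < n + k" for i using that permutes_in_image[of p "{0..<n + k}" i] by simp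
      have "(\<Prod>i = 0..<n + k. Y f $$ (i, p i)) = (\<Prod>i = 0..<n. Y f $$ (i, p i)) * (\<Prod>i = n..<n + k. Y f $$ (i, p i))"
        by (rule prod.atLeastLessThan_concat[symmetric]) auto
      also have "(\<Prod>i = 0..<n. Y f $$ (i, p i)) = (\<Prod>i = 0..<n. if f i = p i then 1 else 0)"
        using pi by (intro prod.cong) (auto simp: Y_def)
      also have "(\<Prod>i = n..<n + k. Y f $$ (i, p i)) = (\<Prod>i = n..<n + k. Z i (p i))"
        using pi by (intro prod.cong) (auto simp: Y_def)
      finally show "signof p * (\<Prod>i = 0..<n + k. Y f $$ (i, p i)) = signof p *
        (\<Prod>i = 0..<n. if f i = p i then 1 else 0) * (\<Prod>i = n..<n + k. Z i (p i))" by simp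
    qed
    finally show ?thesis .
  qed
  have "(\<Sum>f\<in>{0..<n} \<rightarrow>\<^sub>E {0..<n + k}. (\<Prod>i = 0..<n. Z i (f i)) * G f) =
      (\<Sum>p | p permutes {0..<n + k}. signof p * (\<Prod>i = n..<n + k. Z i (p i)) *
        (\<Sum>f\<in>{0..<n} \<rightarrow>\<^sub>E {0..<n + k}. \<Prod>i = 0..<n. Z i (f i) * (if f i = p i then 1 else 0)))"
    unfolding G_expand sum_distrib_left
    by (subst sum.swap) (simp add: prod.distrib mult_ac)
  also have "\<dots> = (\<Sum>p | p permutes {0..<n + k}. signof p * (\<Prod>i = 0..<n + k. Z i (p i)))"
  proof (rule sum.cong[OF refl])
    fix p assume "p \<in> {p. p permutes {0..<n + k}}"
    then have pi: "p i < n + k" if "i < n + k" for i using that permutes_in_image[of p "{0..<n + k}" i] by simp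
    have "(\<Sum>f\<in>{0..<n} \<rightarrow>\<^sub>E {0..<n + k}. \<Prod>i = 0..<n. Z i (f i) * (if f i = p i then 1 else 0)) =
        (\<Prod>i = 0..<n. \<Sum>c = 0..<n + k. Z i c * (if c = p i then 1 else 0))"
      by (rule prod_sum_PiE[symmetric]) auto
    also have "\<dots> = (\<Prod>i = 0..<n. Z i (p i))"
    proof (rule prod.cong[OF refl])
      fix i assume "i \<in> {0..<n}"
      then show "(\<Sum>c = 0..<n + k. Z i c * (if c = p i then 1 else 0)) = Z i (p i)"
        using pi[of i] by (subst sum.remove[of _ "p i"]) auto
    qed
    finally show "signof p * (\<Prod>i = n..<n + k. Z i (p i)) *
        (\<Sum>f\<in>{0..<n} \<rightarrow>\<^sub>E {0..<n + k}. \<Prod>i = 0..<n. Z i (f i) * (if f i = p i then 1 else 0)) =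
        signof p * (\<Prod>i = 0..<n + k. Z i (p i))"
      using prod.atLeastLessThan_concat[of 0 n "n + k" "\<lambda>i. Z i (p i)"] by (simp add: mult_ac)
  qed
  also have "\<dots> = det (mat (n + k) (n + k) (\<lambda>(i, c). Z i c))"
    by (subst det_def'[of _ "n + k"]) (auto simp: permutes_in_image intro!: sum.cong prod.cong)
  finally have "det (mat (n + k) (n + k) (\<lambda>(i, c). Z i c)) =
      (\<Sum>f\<in>{0..<n} \<rightarrow>\<^sub>E {0..<n + k}. (\<Prod>i = 0..<n. Z i (f i)) * G f)" by simp
  also have "\<dots> = (\<Sum>lam\<in>diagrams n k. det (mat n n (\<lambda>(i, j). Z i (particle n lam j))) * G (particle n lam))"
  proof (rule alternating_sum)
    fix f g :: "nat \<Rightarrow> nat" assume "\<And>i. i < n \<Longrightarrow> f i = g i"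
    then show "G f = G g" unfolding G_def Y_def by (intro arg_cong[of _ _ det] eq_matI) auto
  next
    fix f :: "nat \<Rightarrow> nat" assume "\<not> inj_on f {0..<n}"
    then obtain i j where ij: "i \<noteq> j" "i < n" "j < n" "f i = f j" by (auto simp: inj_on_def)
    show "G f = 0" unfolding G_def Y_def
      by (rule det_identical_rows[of _ "n + k" i j]) (use ij in \<open>auto intro!: eq_vecI\<close>)
  next
    fix f p assume p: "p permutes {0..<n}"
    then have p': "p permutes {0..<n + k}" by (rule permutes_subset) auto
    have pn: "p i < n" if "i < n" for i using permutes_in_image[OF p, of i] that by simp
    have pid: "p i = i" if "\<not> i < n" for i using permutes_not_in[OF p, of i] that by simp
    have "Y (f \<circ> p) = mat (n + k) (n + k) (\<lambda>(i, j). Y f $$ (p i, j))"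
      unfolding Y_def using permutes_in_image[OF p'] pn pid by (intro eq_matI) auto
    then show "G (f \<circ> p) = signof p * G f" unfolding G_def
      using det_permute_rows[OF _ p', of "Y f"] by (simp add: Y_def)
  qed
  also have "\<dots> = (\<Sum>lam\<in>diagrams n k. signof (particle_hole n k lam) *
       det (mat n n (\<lambda>(i, j). Z i (particle n lam j))) *
       det (mat k k (\<lambda>(i, j). Z (n + i) (particle k (dual_diagram k lam) j))))"
  proof (rule sum.cong[OF refl])
    fix lam assume lam: "lam \<in> diagrams n k"
    let ?s = "particle_hole n k lam"
    note s = particle_hole_permutes[OF lam]
    let ?C = "mat k n (\<lambda>(i, j). Z (n + i) (particle n lam j))"
    let ?Q = "mat k k (\<lambda>(i, j). Z (n + i) (particle k (dual_diagram k lam) j))"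
    have "mat (n + k) (n + k) (\<lambda>(i, j). Y (particle n lam) $$ (i, ?s j)) =
        four_block_mat (1\<^sub>m n) (0\<^sub>m n k) ?C ?Q"
    proof (rule eq_matI)
      fix i j assume "i < dim_row (four_block_mat (1\<^sub>m n) (0\<^sub>m n k) ?C ?Q)"
        "j < dim_col (four_block_mat (1\<^sub>m n) (0\<^sub>m n k) ?C ?Q)"
      then have ij: "i < n + k" "j < n + k" by auto
      then have sj: "?s j < n + k" using permutes_in_image[OF s, of j] by simp
      have "(particle n lam i = ?s j) = (i = j)" if "i < n"
      proof -
        have "particle n lam i = ?s i" using that by (simp add: particle_hole_def)
        then show ?thesis using inj_eq[OF permutes_inj[OF s]] by simp
      qed
      then show "mat (n + k) (n + k) (\<lambda>(i, j). Y (particle n lam) $$ (i, ?s j)) $$ (i, j) =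
          four_block_mat (1\<^sub>m n) (0\<^sub>m n k) ?C ?Q $$ (i, j)"
        using ij sj by (auto simp: Y_def particle_hole_def)
    qed auto
    moreover have "det (four_block_mat (1\<^sub>m n) (0\<^sub>m n k) ?C ?Q) = det ?Q"
      by (subst det_four_block_mat_upper_right_zero[of _ n _ k]) auto
    ultimately have "det ?Q = signof ?s * G (particle n lam)"
      using det_permute_columns[OF _ s, of "Y (particle n lam)"] by (simp add: G_def Y_def)
    then have "signof ?s * det ?Q = G (particle n lam)" 
      by (simp add: sign_def)
    then show "det (mat n n (\<lambda>(i, j). Z i (particle n lam j))) * G (particle n lam) =
      signof ?s * det (mat n n (\<lambda>(i, j). Z i (particle n lam j))) * det ?Q"
      by (simp add: mult_ac)
  qed
  finally show ?thesis .
qed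

section \<open>Signs, and the sum of paired Vandermonde products\<close>

abbreviation holes :: "nat \<Rightarrow> nat list \<Rightarrow> nat \<Rightarrow> nat" where
  "holes k lam \<equiv> particle k (dual_diagram k lam)"

lemma vandermonde_sign:
  fixes x :: "nat \<Rightarrow> real"
  assumes "\<And>l j. l < j \<Longrightarrow> j < n \<Longrightarrow> x j - x l = e * \<bar>x j - x l\<bar>"
  shows "vandermonde n x = (\<Prod>j<n. \<Prod>l<j. e) * \<bar>vandermonde n x\<bar>"
proof -
  have "vandermonde n x = (\<Prod>j<n. \<Prod>l<j. e * \<bar>x j - x l\<bar>)"
    unfolding vandermonde_def using assms by (intro prod.cong) auto
  also have "\<dots> = (\<Prod>j<n. \<Prod>l<j. e) * \<bar>vandermonde n x\<bar>"
    by (simp add: vandermonde_def prod.distrib abs_prod)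
  finally show ?thesis .
qed

lemma sgn_prod':
  fixes f :: "'b \<Rightarrow> real"
  shows "sgn (prod f A) = (\<Prod>x\<in>A. sgn (f x))"
  by (induction A rule: infinite_finite_induct) (auto simp: sgn_mult)

lemma vandermonde_nonzero:
  fixes x :: "nat \<Rightarrow> 'a::idom"
  assumes "inj_on x {0..<n}"
  shows "vandermonde n x \<noteq> 0"
  unfolding vandermonde_def using inj_onD[OF assms] by fastforce

lemma abs_vandermonde_permute:
  fixes x :: "nat \<Rightarrow> real"
  assumes "p permutes {0..<n}"
  shows "\<bar>vandermonde n (\<lambda>i. x (p i))\<bar> = \<bar>vandermonde n x\<bar>"
  by (simp add: vandermonde_permute[OF assms] abs_mult sign_def)

lemma power_inj_pos:
  fixes q :: real
  assumes "q > 0" "q \<noteq> 1" "q ^ a = q ^ b"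
  shows "a = b"
  using assms power_inject_exp'[of q] by auto

text \<open>Of the points above the hole \<open>s\<close>, exactly \<open>s\<close> are holes, since the holes
are listed in decreasing order.\<close>

lemma count_particles_above:
  assumes lam: "lam \<in> diagrams n k" and s: "s < k"
  shows "card {r. r < n \<and> holes k lam s < particle n lam r} + holes k lam s + s + 1 = n + k"
proof -
  note dual = dual_diagram_in_diagrams[OF lam]
  let ?b = "holes k lam s"
  let ?A = "{r. r < n \<and> ?b < particle n lam r}"
  have b: "?b < n + k" using particle_less[OF dual s] by (simp add: add.commute)
  have dec: "holes k lam s < holes k lam s' \<longleftrightarrow> s' < s" if "s' < k" for s'
    using monotone_onD[OF particle_antimono[OF dual], of s s'] that s
      monotone_onD[OF particle_antimono[OF dual], of s' s]
    by (cases s s' rule: linorder_cases) auto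
  have "bij_betw (particle_hole n k lam) (?A \<union> (+) n ` {..<s}) {?b<..<n + k}"
  proof (rule bij_betw_imageI)
    show "inj_on (particle_hole n k lam) (?A \<union> (+) n ` {..<s})"
      using permutes_inj_on[OF particle_hole_permutes[OF lam]] by blast
    have "particle_hole n k lam c \<in> {?b<..<n + k}" if "c \<in> ?A \<union> (+) n ` {..<s}" for c
    proof -
      have "c < n + k" using that s by auto
      then have "particle_hole n k lam c < n + k"
        using permutes_in_image[OF particle_hole_permutes[OF lam], of c] by simp
      moreover have "?b < particle_hole n k lam c"
        using that s dec by (auto simp: particle_hole_def)
      ultimately show ?thesis by simp
    qed
    moreover have "c \<in> particle_hole n k lam ` (?A \<union> (+) n ` {..<s})" if c: "c \<in> {?b<..<n + k}" for c
    proof -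
      have "c \<in> particle_hole n k lam ` {0..<n + k}"
        using permutes_image[OF particle_hole_permutes[OF lam]] c by simp
      then obtain d where d: "c = particle_hole n k lam d" "d < n + k" by auto
      have "d \<in> ?A \<union> (+) n ` {..<s}"
      proof (cases "d < n")
        case True
        then show ?thesis using c d by (simp add: particle_hole_def)
      next
        case False
        then have "d - n < s" using c d dec[of "d - n"] by (auto simp: particle_hole_def)
        then have "d \<in> (+) n ` {..<s}" using False by (intro image_eqI[of _ _ "d - n"]) auto
        then show ?thesis by simp
      qed
      then show ?thesis using d by blast
    qed
    ultimately show "particle_hole n k lam ` (?A \<union> (+) n ` {..<s}) = {?b<..<n + k}" by blast
  qed
  then have "card (?A \<union> (+) n ` {..<s}) = n + k - Suc ?b"
    using bij_betw_same_card by fastforce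
  moreover have "card (?A \<union> (+) n ` {..<s}) = card ?A + s"
    by (subst card_Un_disjoint) (auto simp: card_image)
  ultimately show ?thesis using b by simp
qed

text \<open>The sign of the permutation is read off from the Vandermonde product of the integers it lists.
Pairs of particles and pairs of holes contribute signs that do not depend on the diagram. A hole \<open>b
s\<close> has \<open>n + k - 1 - s - b s\<close> particles above it, so up to a constant the particle-hole
pairs contribute \<open>(-1)\<close> to the sum of the holes.\<close>

lemma particle_hole_sign:
  obtains c :: real where "\<bar>c\<bar> = 1"
    "\<And>lam. lam \<in> diagrams n k \<Longrightarrow>
      signof (particle_hole n k lam) * (-1) ^ (\<Sum>s<k. holes k lam s) = c"
proof -
  define E where "E = (\<lambda>n::nat. (\<Prod>j<n. \<Prod>l<j. -1) :: real)"
  have E: "\<bar>E n\<bar> = 1" for n by (simp add: E_def abs_prod)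
  define c where "c = sgn (vandermonde (n + k) real) * (E n * E k * (\<Prod>s<k. (-1) ^ (n + k - 1 - s)))"
  have nz: "vandermonde (n + k) real \<noteq> 0" by (rule vandermonde_nonzero) (auto simp: inj_on_def)
  have "\<bar>c\<bar> = 1" using nz by (simp add: c_def abs_mult E abs_sgn_eq power_abs abs_prod)
  moreover have "signof (particle_hole n k lam) * (-1) ^ (\<Sum>s<k. holes k lam s) = c"
    if lam: "lam \<in> diagrams n k" for lam
  proof -
    note dual = dual_diagram_in_diagrams[OF lam]
    let ?a = "particle n lam" and ?b = "holes k lam"
    have sg: "sgn (vandermonde m (\<lambda>i. real (f i))) = E m" if f: "strict_antimono_on {0..<m} f" for m f
    proof -
      have "vandermonde m (\<lambda>i. real (f i)) = (\<Prod>j<m. \<Prod>l<j. - 1) * \<bar>vandermonde m (\<lambda>i. real (f i))\<bar>"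
      proof (rule vandermonde_sign)
        fix l j :: nat assume "l < j" "j < m"
        then have "f j < f l" using f by (auto simp: monotone_on_def)
        then show "real (f j) - real (f l) = - 1 * \<bar>real (f j) - real (f l)\<bar>" by simp
      qed
      then have "sgn (vandermonde m (\<lambda>i. real (f i))) = sgn (E m) * sgn \<bar>vandermonde m (\<lambda>i. real (f i))\<bar>"
        unfolding E_def sgn_mult[symmetric] by (rule arg_cong)
      moreover have "vandermonde m (\<lambda>i. real (f i)) \<noteq> 0"
        using strict_antimono_inj[OF f] by (intro vandermonde_nonzero) (auto simp: inj_on_def)
      moreover have "sgn (E m) = E m" using E[of m] by (auto simp: abs_if sgn_if split: if_splits)
      ultimately show ?thesis by simp
    qed
    have prd: "(\<Prod>r<n. sgn (real (?b s) - real (?a r))) * (-1) ^ ?b s = (-1) ^ (n + k - 1 - s)"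
      if s: "s < k" for s
    proof -
      have "(\<Prod>r<n. sgn (real (?b s) - real (?a r))) = (\<Prod>r<n. if ?b s < ?a r then -1 else 1)"
      proof (rule prod.cong[OF refl])
        fix r assume "r \<in> {..<n}"
        then show "sgn (real (?b s) - real (?a r)) = (if ?b s < ?a r then -1 else 1)"
          using particle_dual_disjoint[OF lam _ s, of r] by (auto simp: sgn_if)
      qed
      also have "\<dots> = (-1) ^ card {r. r < n \<and> ?b s < ?a r}"
        by (subst prod.If_cases) (simp_all add: Int_def)
      finally have "(\<Prod>r<n. sgn (real (?b s) - real (?a r))) * (-1) ^ ?b s =
          (-1) ^ (card {r. r < n \<and> ?b s < ?a r} + ?b s)" by (simp add: power_add)
      moreover have "card {r. r < n \<and> ?b s < ?a r} + ?b s = n + k - 1 - s"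
        using count_particles_above[OF lam s] by simp
      ultimately show ?thesis by simp
    qed
    have "signof (particle_hole n k lam) * vandermonde (n + k) real =
        vandermonde (n + k) (\<lambda>i. real (particle_hole n k lam i))"
      by (rule vandermonde_permute[OF particle_hole_permutes[OF lam], symmetric])
    also have "\<dots> = vandermonde n (\<lambda>i. real (?a i)) * vandermonde k (\<lambda>i. real (?b i)) *
        (\<Prod>s<k. \<Prod>r<n. real (?b s) - real (?a r))"
      unfolding vandermonde_append by (auto simp: particle_hole_def vandermonde_def intro!: arg_cong2[of _ _ _ _ "(*)"] prod.cong)
    finally have h: "signof (particle_hole n k lam) * vandermonde (n + k) real =
        vandermonde n (\<lambda>i. real (?a i)) * vandermonde k (\<lambda>i. real (?b i)) *
        (\<Prod>s<k. \<Prod>r<n. real (?b s) - real (?a r))" .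
    have "sgn (signof (particle_hole n k lam) :: real) * sgn (vandermonde (n + k) real) =
        E n * E k * (\<Prod>s<k. \<Prod>r<n. sgn (real (?b s) - real (?a r)))"
      using arg_cong[OF h, of sgn]
      unfolding sgn_mult sg[OF particle_antimono[OF lam]] sg[OF particle_antimono[OF dual]] sgn_prod' .
    moreover have "sgn (signof (particle_hole n k lam) :: real) = signof (particle_hole n k lam)"
      by (simp add: sign_def)
    moreover have "(\<Prod>s<k. \<Prod>r<n. sgn (real (?b s) - real (?a r))) * (-1) ^ (\<Sum>s<k. ?b s) =
        (\<Prod>s<k. (-1) ^ (n + k - 1 - s))"
      unfolding power_sum prod.distrib[symmetric] using prd by (intro prod.cong) auto
    ultimately have h': "signof (particle_hole n k lam) * sgn (vandermonde (n + k) real) * (-1) ^ (\<Sum>s<k. ?b s) =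
        E n * E k * (\<Prod>s<k. (-1) ^ (n + k - 1 - s))"
      by (simp add: mult.assoc)
    then have "c = signof (particle_hole n k lam) * (-1) ^ (\<Sum>s<k. ?b s) * (sgn (vandermonde (n + k) real) * sgn (vandermonde (n + k) real))"
      unfolding c_def h'[symmetric] by (simp only: mult_ac)
    then show ?thesis using nz by (simp add: sgn_if split: if_splits)
  qed
  ultimately show ?thesis by (rule that)
qed

text \<open>Powers of \<open>q\<close> are monotone in the exponent, so for decreasing exponents the sign
depends only on \<open>n\<close> and on whether \<open>q < 1\<close>.\<close>

lemma vandermonde_powers_sign:
  fixes q :: real
  assumes "q > 0" "q \<noteq> 1"
  obtains c where "\<bar>c\<bar> = 1"
    "\<And>f. strict_antimono_on {0..<n} f \<Longrightarrow> vandermonde n (\<lambda>i. q ^ f i) = c * \<bar>vandermonde n (\<lambda>i. q ^ f i)\<bar>"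
proof -
  define e :: real where "e = (if q < 1 then 1 else -1)"
  have "vandermonde n (\<lambda>i. q ^ f i) = (\<Prod>j<n. \<Prod>l<j. e) * \<bar>vandermonde n (\<lambda>i. q ^ f i)\<bar>"
    if f: "strict_antimono_on {0..<n} f" for f
  proof (rule vandermonde_sign)
    fix l j assume "l < j" "j < n"
    then have "f j < f l" using f by (auto simp: monotone_on_def)
    then have "if q < 1 then q ^ f l < q ^ f j else q ^ f j < q ^ f l"
      using assms power_strict_decreasing[of "f j" "f l" q] power_strict_increasing[of "f j" "f l" q]
      by auto
    then show "q ^ f j - q ^ f l = e * \<bar>q ^ f j - q ^ f l\<bar>" by (auto simp: e_def split: if_splits)
  qed
  moreover have "\<bar>\<Prod>j<n. \<Prod>l<j. e\<bar> = 1" by (simp add: abs_prod e_def)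
  ultimately show ?thesis by (intro that)
qed

text \<open>A principal specialization of the dual Cauchy identity. It is the Laplace expansion of the
Vandermonde determinant in the variables \<open>q ^ i\<close> and \<open>- (r ^ j)\<close>. The minus signs
produce \<open>(-1)\<close> to the sum of the holes, which by \<open>particle_hole_sign\<close> cancels the
sign of the expansion up to a constant; so all terms have the same sign and absolute values may be
taken.\<close>

lemma vandermonde_sum_over_diagrams:
  fixes q r :: real
  assumes q: "q > 0" "q \<noteq> 1" and r: "r > 0" "r \<noteq> 1"
  shows "(\<Sum>lam\<in>diagrams n k.
      \<bar>vandermonde n (\<lambda>i. q ^ particle n lam i)\<bar> * \<bar>vandermonde k (\<lambda>j. r ^ holes k lam j)\<bar>) =
    \<bar>vandermonde n (\<lambda>i. q ^ i)\<bar> * \<bar>vandermonde k (\<lambda>j. r ^ j)\<bar> * (\<Prod>i<n. \<Prod>j<k. q ^ i + r ^ j)"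
proof -
  \<comment> \<open>the variables of the large Vandermonde determinant\<close>
  define z where "z = (\<lambda>i. if i < n then q ^ i else - (r ^ (i - n)))"
  obtain c1 where c1: "\<bar>c1\<bar> = 1" "\<And>lam. lam \<in> diagrams n k \<Longrightarrow>
      signof (particle_hole n k lam) * (-1) ^ (\<Sum>s<k. holes k lam s) = (c1 :: real)"
    using particle_hole_sign by blast
  obtain c2 where c2: "\<bar>c2\<bar> = 1" "\<And>f. strict_antimono_on {0..<n} f \<Longrightarrow>
      vandermonde n (\<lambda>i. q ^ f i) = c2 * \<bar>vandermonde n (\<lambda>i. q ^ f i)\<bar>"
    using vandermonde_powers_sign[OF q] by blast
  obtain c3 where c3: "\<bar>c3\<bar> = 1" "\<And>f. strict_antimono_on {0..<k} f \<Longrightarrow>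
      vandermonde k (\<lambda>i. r ^ f i) = c3 * \<bar>vandermonde k (\<lambda>i. r ^ f i)\<bar>"
    using vandermonde_powers_sign[OF r] by blast
  have "vandermonde (n + k) z = det (mat (n + k) (n + k) (\<lambda>(i, c). z i ^ c))"
    by (rule det_vandermonde[symmetric])
  also have "\<dots> = (\<Sum>lam\<in>diagrams n k. signof (particle_hole n k lam) *
       det (mat n n (\<lambda>(i, j). z i ^ particle n lam j)) *
       det (mat k k (\<lambda>(i, j). z (n + i) ^ holes k lam j)))"
    by (rule laplace_expansion_rows)
  also have "\<dots> = (\<Sum>lam\<in>diagrams n k. c1 * c2 * c3 * (\<bar>vandermonde n (\<lambda>i. q ^ particle n lam i)\<bar> * \<bar>vandermonde k (\<lambda>j. r ^ holes k lam j)\<bar>))"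
  proof (rule sum.cong[OF refl])
    fix lam assume lam: "lam \<in> diagrams n k"
    have 1: "det (mat n n (\<lambda>(i, j). z i ^ particle n lam j)) = vandermonde n (\<lambda>i. q ^ particle n lam i)"
    proof -
      have "mat n n (\<lambda>(i, j). z i ^ particle n lam j) = mat n n (\<lambda>(i, j). (q ^ particle n lam j) ^ i)"
        by (rule eq_matI) (auto simp: z_def power_mult[symmetric] mult.commute)
      then show ?thesis by (simp add: det_vandermonde_transpose)
    qed
    have 2: "det (mat k k (\<lambda>(i, j). z (n + i) ^ holes k lam j)) =
        (-1) ^ (\<Sum>s<k. holes k lam s) * vandermonde k (\<lambda>j. r ^ holes k lam j)"
    proof -
      let ?D = "mat k k (\<lambda>(i, j). (r ^ holes k lam j) ^ i)"
      have "mat k k (\<lambda>(i, j). z (n + i) ^ holes k lam j) = ?D * mat_diag k (\<lambda>j. (-1) ^ holes k lam j)"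
        by (subst mat_diag_mult_right[of _ k], simp, rule eq_matI)
          (auto simp: z_def power_mult[symmetric] mult.commute power_minus[of "r ^ _"])
      moreover have "det (mat_diag k (\<lambda>j. (-1) ^ holes k lam j :: real)) = (-1) ^ (\<Sum>s<k. holes k lam s)"
        by (subst det_lower_triangular[of k])
          (auto simp: mat_diag_def prod_list_diag_prod power_sum atLeast0LessThan)
      ultimately show ?thesis
        using det_mult[of ?D k "mat_diag k (\<lambda>j. (-1) ^ holes k lam j)"]
        by (simp add: det_vandermonde_transpose)
    qed
    show "signof (particle_hole n k lam) * det (mat n n (\<lambda>(i, j). z i ^ particle n lam j)) *
        det (mat k k (\<lambda>(i, j). z (n + i) ^ holes k lam j)) =
      c1 * c2 * c3 * (\<bar>vandermonde n (\<lambda>i. q ^ particle n lam i)\<bar> * \<bar>vandermonde k (\<lambda>j. r ^ holes k lam j)\<bar>)"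
      unfolding 1 2 c1(2)[OF lam, symmetric]
      by (subst c2(2)[OF particle_antimono[OF lam]],
          subst c3(2)[OF particle_antimono[OF dual_diagram_in_diagrams[OF lam]]]) (simp only: mult_ac)
  qed
  finally have "\<bar>vandermonde (n + k) z\<bar> = \<bar>c1 * c2 * c3\<bar> * \<bar>\<Sum>lam\<in>diagrams n k. \<bar>vandermonde n (\<lambda>i. q ^ particle n lam i)\<bar> * \<bar>vandermonde k (\<lambda>j. r ^ holes k lam j)\<bar>\<bar>"
    by (simp add: sum_distrib_left[symmetric] abs_mult)
  also have "\<dots> = (\<Sum>lam\<in>diagrams n k. \<bar>vandermonde n (\<lambda>i. q ^ particle n lam i)\<bar> * \<bar>vandermonde k (\<lambda>j. r ^ holes k lam j)\<bar>)"
    using c1(1) c2(1) c3(1) by (simp add: abs_mult sum_nonneg)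
  finally have total: "(\<Sum>lam\<in>diagrams n k. \<bar>vandermonde n (\<lambda>i. q ^ particle n lam i)\<bar> * \<bar>vandermonde k (\<lambda>j. r ^ holes k lam j)\<bar>) = \<bar>vandermonde (n + k) z\<bar>"
    by simp
  have v1: "vandermonde n z = vandermonde n (\<lambda>i. q ^ i)" by (auto simp: vandermonde_def z_def intro!: prod.cong)
  have v2: "\<bar>vandermonde k (\<lambda>i. z (n + i))\<bar> = \<bar>vandermonde k (\<lambda>j. r ^ j)\<bar>"
    by (simp add: vandermonde_def z_def abs_prod abs_minus_commute)
  have "(\<Prod>s<k. \<Prod>i<n. \<bar>z (n + s) - z i\<bar>) = (\<Prod>s<k. \<Prod>i<n. q ^ i + r ^ s)"
  proof (intro prod.cong refl)
    fix s i assume "i \<in> {..<n}"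
    then have "z (n + s) - z i = - (q ^ i + r ^ s)" by (simp add: z_def)
    moreover have "0 < q ^ i + r ^ s" using q r by (simp add: add_pos_pos)
    ultimately show "\<bar>z (n + s) - z i\<bar> = q ^ i + r ^ s" by linarith
  qed
  also have "\<dots> = (\<Prod>i<n. \<Prod>s<k. q ^ i + r ^ s)" by (rule prod.swap)
  finally show ?thesis unfolding total vandermonde_append by (simp add: abs_mult abs_prod v1 v2)
qed

section \<open>Vandermonde products of complementary powers of \<open>q\<close>\<close>

lemma prod_offdiagonal:
  fixes g :: "nat \<Rightarrow> nat \<Rightarrow> 'a::comm_monoid_mult"
  assumes "\<And>i j. g i j = g j i"
  shows "(\<Prod>i<n. \<Prod>r\<in>{..<n} - {i}. g i r) = (\<Prod>j<n. \<Prod>l<j. g j l) * (\<Prod>j<n. \<Prod>l<j. g j l)"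
proof (induction n)
  case (Suc n)
  have "(\<Prod>r\<in>{..<Suc n} - {i}. g i r) = g i n * (\<Prod>r\<in>{..<n} - {i}. g i r)" if "i < n" for i
  proof -
    have "{..<Suc n} - {i} = insert n ({..<n} - {i})" using that by auto
    then show ?thesis by simp
  qed
  moreover have "{..<Suc n} - {n} = {..<n}" by auto
  ultimately have "(\<Prod>i<Suc n. \<Prod>r\<in>{..<Suc n} - {i}. g i r) =
      (\<Prod>i<n. g i n * (\<Prod>r\<in>{..<n} - {i}. g i r)) * (\<Prod>r<n. g n r)"
    by simp
  also have "(\<Prod>i<n. g i n * (\<Prod>r\<in>{..<n} - {i}. g i r)) = (\<Prod>i<n. g n i * (\<Prod>r\<in>{..<n} - {i}. g i r))"
    by (simp only: assms[of _ n])
  finally have "(\<Prod>i<Suc n. \<Prod>r\<in>{..<Suc n} - {i}. g i r) =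
      (\<Prod>i<n. g n i * (\<Prod>r\<in>{..<n} - {i}. g i r)) * (\<Prod>r<n. g n r)" .
  then show ?case using Suc by (simp add: prod.distrib mult_ac)
qed simp

text \<open>Every index occurs in \<open>n - 1\<close> pairs.\<close>

lemma prod_pairs:
  fixes g :: "nat \<Rightarrow> 'a::comm_monoid_mult"
  shows "(\<Prod>j<n. \<Prod>l<j. g j * g l) = (\<Prod>i<n. g i ^ (n - 1))"
proof (induction n)
  case (Suc n)
  have "(\<Prod>l<n. g n * g l) * (\<Prod>i<n. g i ^ (n - 1)) = g n ^ n * (\<Prod>i<n. g i * g i ^ (n - 1))"
    by (simp add: prod.distrib mult_ac)
  also have "(\<Prod>i<n. g i * g i ^ (n - 1)) = (\<Prod>i<n. g i ^ n)"
    by (cases n) simp_all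
  finally show ?case using Suc by (simp add: mult_ac)
qed simp

lemma abs_vandermonde_inverse:
  fixes y :: "nat \<Rightarrow> real"
  assumes "\<And>i. i < n \<Longrightarrow> y i > 0"
  shows "\<bar>vandermonde n y\<bar> = \<bar>vandermonde n (\<lambda>i. inverse (y i))\<bar> * (\<Prod>i<n. y i ^ (n - 1))"
proof -
  have "\<bar>vandermonde n y\<bar> = (\<Prod>j<n. \<Prod>l<j. \<bar>inverse (y j) - inverse (y l)\<bar> * (y j * y l))"
    unfolding vandermonde_def abs_prod
  proof (intro prod.cong refl)
    fix j l assume "j \<in> {..<n}" "l \<in> {..<j}"
    then have pos: "y j > 0" "y l > 0" using assms by auto
    have "(inverse (y j) - inverse (y l)) * (y j * y l) = y l - y j"
      using pos by (simp add: left_diff_distrib mult.left_commute[of "inverse (y l)"] mult.assoc[symmetric])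
    then have "\<bar>inverse (y j) - inverse (y l)\<bar> * \<bar>y j * y l\<bar> = \<bar>y l - y j\<bar>"
      by (simp only: abs_mult[symmetric])
    then show "\<bar>y j - y l\<bar> = \<bar>inverse (y j) - inverse (y l)\<bar> * (y j * y l)"
      using pos by (simp add: abs_minus_commute)
  qed
  then show ?thesis using prod_pairs[of y n] by (simp add: prod.distrib vandermonde_def abs_prod)
qed

lemma q_number_pos:
  assumes "q > 0" "q \<noteq> 1" "m > 0"
  shows "q_number q m > 0"
proof (cases "q < 1")
  case True
  then show ?thesis using assms power_less_one_iff[of q m] by (simp add: q_number_def)
next
  case False
  then have "q ^ m > 1" using assms by simp
  then show ?thesis using False assms by (simp add: q_number_def divide_neg_neg)
qed

lemma q_fact_pos:
  assumes "q > 0" "q \<noteq> 1"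
  shows "q_fact q m > 0"
  unfolding q_fact_def using q_number_pos[OF assms] by (intro prod_pos) auto

lemma q_fact_Suc: "q_fact q (Suc m) = q_fact q m * q_number q (Suc m)"
  by (simp add: q_fact_def)

lemma abs_one_minus_power:
  assumes "q > 0" "q \<noteq> 1"
  shows "\<bar>1 - q ^ m\<bar> = \<bar>1 - q\<bar> * q_number q m"
proof -
  have "q_number q m \<ge> 0" using q_number_pos[OF assms, of m] by (cases "m = 0") (auto simp: q_number_def)
  then have "q_number q m = \<bar>1 - q ^ m\<bar> / \<bar>1 - q\<bar>" by (metis abs_divide abs_of_nonneg q_number_def)
  then show ?thesis using assms by simp
qed

lemma prod_distance_below:
  assumes "q > 0" "q \<noteq> 1"
  shows "(\<Prod>c<a. \<bar>q ^ a - q ^ c\<bar>) = q ^ (a choose 2) * \<bar>1 - q\<bar> ^ a * q_fact q a"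
proof (induction a)
  case (Suc a)
  have "(\<Prod>c<Suc a. \<bar>q ^ Suc a - q ^ c\<bar>) = \<bar>q ^ Suc a - 1\<bar> * (\<Prod>c<a. \<bar>q ^ Suc a - q ^ Suc c\<bar>)"
    by (simp only: prod.lessThan_Suc_shift comp_def power_0)
  also have "(\<Prod>c<a. \<bar>q ^ Suc a - q ^ Suc c\<bar>) = (\<Prod>c<a. q * \<bar>q ^ a - q ^ c\<bar>)"
    using assms by (intro prod.cong) (auto simp: right_diff_distrib[symmetric] abs_mult)
  also have "\<dots> = q ^ a * (\<Prod>c<a. \<bar>q ^ a - q ^ c\<bar>)" by (simp add: prod.distrib)
  also have "\<bar>q ^ Suc a - 1\<bar> = \<bar>1 - q\<bar> * q_number q (Suc a)"
    using abs_one_minus_power[OF assms, of "Suc a"] by (simp add: abs_minus_commute)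
  finally show ?case
    unfolding Suc q_fact_Suc using choose_reduce_nat[of "Suc a" 2] 
    by (simp add: power_add numeral_2_eq_2 mult_ac)
qed (simp add: q_fact_def binomial_eq_0)

lemma prod_distance_above:
  assumes "q > 0" "q \<noteq> 1"
  shows "(\<Prod>c<m. \<bar>q ^ a - q ^ (a + Suc c)\<bar>) = q ^ (a * m) * \<bar>1 - q\<bar> ^ m * q_fact q m"
proof (induction m)
  case (Suc m)
  have "q ^ a - q ^ (a + Suc m) = q ^ a * (1 - q ^ Suc m)" by (simp add: power_add algebra_simps)
  then have "\<bar>q ^ a - q ^ (a + Suc m)\<bar> = q ^ a * (\<bar>1 - q\<bar> * q_number q (Suc m))"
    using abs_one_minus_power[OF assms, of "Suc m"] assms by (simp add: abs_mult)
  then show ?case unfolding prod.lessThan_Suc Suc q_fact_Suc by (simp add: power_add mult_ac)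
qed (simp add: q_fact_def)

text \<open>The distances from \<open>q ^ a\<close> to the other powers, which become the one-particle weight:
points below \<open>a\<close> contribute \<open>q\<close> to the sum of these points, points above contribute
\<open>q ^ a\<close> each.\<close>

lemma prod_distance:
  assumes q: "q > 0" "q \<noteq> 1" and a: "a \<le> N"
  shows "(\<Prod>c\<in>{..<Suc N} - {a}. \<bar>q ^ a - q ^ c\<bar>) =
    q ^ ((a choose 2) + a * (N - a)) * \<bar>1 - q\<bar> ^ N * q_fact q a * q_fact q (N - a)"
proof -
  have "{..<Suc N} - {a} = {..<a} \<union> (\<lambda>c. a + Suc c) ` {..<N - a}"
  proof (intro equalityI subsetI)
    fix c assume "c \<in> {..<Suc N} - {a}"
    then consider "c < a" | "a < c" "c \<le> N" by force
    then show "c \<in> {..<a} \<union> (\<lambda>c. a + Suc c) ` {..<N - a}"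
    proof cases
      case 2
      then have "c = a + Suc (c - a - 1)" "c - a - 1 < N - a" by auto
      then show ?thesis by blast
    qed simp
  qed (use a in auto)
  moreover have disj: "{..<a} \<inter> (\<lambda>c. a + Suc c) ` {..<N - a} = {}" by auto
  ultimately have "(\<Prod>c\<in>{..<Suc N} - {a}. \<bar>q ^ a - q ^ c\<bar>) =
      (\<Prod>c<a. \<bar>q ^ a - q ^ c\<bar>) * (\<Prod>c\<in>(\<lambda>c. a + Suc c) ` {..<N - a}. \<bar>q ^ a - q ^ c\<bar>)"
    using disj by (simp only: prod.union_disjoint finite_lessThan finite_imageI)
  also have "(\<Prod>c\<in>(\<lambda>c. a + Suc c) ` {..<N - a}. \<bar>q ^ a - q ^ c\<bar>) = (\<Prod>c<N - a. \<bar>q ^ a - q ^ (a + Suc c)\<bar>)"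
    by (subst prod.reindex) (auto simp: inj_on_def comp_def)
  finally have split: "(\<Prod>c\<in>{..<Suc N} - {a}. \<bar>q ^ a - q ^ c\<bar>) =
      (\<Prod>c<a. \<bar>q ^ a - q ^ c\<bar>) * (\<Prod>c<N - a. \<bar>q ^ a - q ^ (a + Suc c)\<bar>)" .
  have "\<bar>1 - q\<bar> ^ N = \<bar>1 - q\<bar> ^ a * \<bar>1 - q\<bar> ^ (N - a)" using a by (simp add: power_add[symmetric])
  then show ?thesis
    unfolding split prod_distance_below[OF q] prod_distance_above[OF q] by (simp add: power_add mult_ac)
qed

text \<open>For a set of points split into particles and holes, the product over a particle \<open>i\<close>
of its distances to all other points counts every particle-hole pair once and every particle pair
twice.\<close>

lemma vandermonde_holes:
  assumes q: "q > 0" "q \<noteq> (1 :: real)" and lam: "lam \<in> diagrams n k"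
  shows "\<bar>vandermonde k (\<lambda>j. q ^ holes k lam j)\<bar> *
      (\<Prod>i<n. \<Prod>c\<in>{..<n + k} - {particle n lam i}. \<bar>q ^ particle n lam i - q ^ c\<bar>) =
    \<bar>vandermonde n (\<lambda>i. q ^ particle n lam i)\<bar> * \<bar>vandermonde (n + k) (\<lambda>i. q ^ i)\<bar>"
proof -
  let ?s = "particle_hole n k lam" and ?a = "particle n lam" and ?b = "holes k lam"
  note s = particle_hole_permutes[OF lam]
  have cross: "(\<Prod>c\<in>{..<n + k} - {?a i}. \<bar>q ^ ?a i - q ^ c\<bar>) =
      (\<Prod>r\<in>{..<n} - {i}. \<bar>q ^ ?a i - q ^ ?a r\<bar>) * (\<Prod>j<k. \<bar>q ^ ?b j - q ^ ?a i\<bar>)" if i: "i < n" for i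
  proof -
    have ai: "?a i = ?s i" using i by (simp add: particle_hole_def)
    have "?s ` ({..<n + k} - {i}) = {..<n + k} - {?s i}"
      using permutes_image[OF s] permutes_inj[OF s] by (simp add: image_set_diff atLeast0LessThan)
    then have "(\<Prod>c\<in>{..<n + k} - {?a i}. \<bar>q ^ ?a i - q ^ c\<bar>) = (\<Prod>c\<in>{..<n + k} - {i}. \<bar>q ^ ?a i - q ^ ?s c\<bar>)"
      using permutes_inj_on[OF s] prod.reindex[of ?s "{..<n + k} - {i}" "\<lambda>c. \<bar>q ^ ?a i - q ^ c\<bar>"]
      by (simp add: ai comp_def)
    also have "{..<n + k} - {i} = ({..<n} - {i}) \<union> (+) n ` {..<k}"
    proof (intro equalityI subsetI)
      fix c assume c: "c \<in> {..<n + k} - {i}"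
      show "c \<in> ({..<n} - {i}) \<union> (+) n ` {..<k}"
      proof (cases "c < n")
        case False
        then have "c \<in> (+) n ` {..<k}" using c by (intro image_eqI[of _ _ "c - n"]) auto
        then show ?thesis by simp
      qed (use c in auto)
    qed (use i in auto)
    also have "(\<Prod>c\<in>({..<n} - {i}) \<union> (+) n ` {..<k}. \<bar>q ^ ?a i - q ^ ?s c\<bar>) =
        (\<Prod>c\<in>{..<n} - {i}. \<bar>q ^ ?a i - q ^ ?s c\<bar>) * (\<Prod>c\<in>(+) n ` {..<k}. \<bar>q ^ ?a i - q ^ ?s c\<bar>)"
      by (rule prod.union_disjoint) auto
    also have "(\<Prod>c\<in>{..<n} - {i}. \<bar>q ^ ?a i - q ^ ?s c\<bar>) = (\<Prod>r\<in>{..<n} - {i}. \<bar>q ^ ?a i - q ^ ?a r\<bar>)"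
      by (intro prod.cong) (auto simp: particle_hole_def)
    also have "(\<Prod>c\<in>(+) n ` {..<k}. \<bar>q ^ ?a i - q ^ ?s c\<bar>) = (\<Prod>j<k. \<bar>q ^ ?b j - q ^ ?a i\<bar>)"
      by (subst prod.reindex) (auto simp: particle_hole_def abs_minus_commute intro!: prod.cong)
    finally show ?thesis .
  qed
  have "\<bar>vandermonde (n + k) (\<lambda>i. q ^ i)\<bar> = \<bar>vandermonde (n + k) (\<lambda>i. q ^ ?s i)\<bar>"
    by (rule abs_vandermonde_permute[OF s, symmetric])
  also have "\<dots> = \<bar>vandermonde n (\<lambda>i. q ^ ?a i)\<bar> * \<bar>vandermonde k (\<lambda>j. q ^ ?b j)\<bar> *
      (\<Prod>j<k. \<Prod>i<n. \<bar>q ^ ?b j - q ^ ?a i\<bar>)"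
    unfolding vandermonde_append by (auto simp: particle_hole_def vandermonde_def abs_mult abs_prod intro!: arg_cong2[of _ _ _ _ "(*)"] prod.cong)
  also have "(\<Prod>j<k. \<Prod>i<n. \<bar>q ^ ?b j - q ^ ?a i\<bar>) = (\<Prod>i<n. \<Prod>j<k. \<bar>q ^ ?b j - q ^ ?a i\<bar>)"
    by (rule prod.swap)
  finally have tot: "\<bar>vandermonde (n + k) (\<lambda>i. q ^ i)\<bar> = \<bar>vandermonde n (\<lambda>i. q ^ ?a i)\<bar> * \<bar>vandermonde k (\<lambda>j. q ^ ?b j)\<bar> *
      (\<Prod>i<n. \<Prod>j<k. \<bar>q ^ ?b j - q ^ ?a i\<bar>)" .
  have "(\<Prod>i<n. \<Prod>c\<in>{..<n + k} - {?a i}. \<bar>q ^ ?a i - q ^ c\<bar>) =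
      (\<Prod>i<n. \<Prod>r\<in>{..<n} - {i}. \<bar>q ^ ?a i - q ^ ?a r\<bar>) * (\<Prod>i<n. \<Prod>j<k. \<bar>q ^ ?b j - q ^ ?a i\<bar>)"
    unfolding prod.distrib[symmetric] using cross by (intro prod.cong) auto
  also have "(\<Prod>i<n. \<Prod>r\<in>{..<n} - {i}. \<bar>q ^ ?a i - q ^ ?a r\<bar>) =
      \<bar>vandermonde n (\<lambda>i. q ^ ?a i)\<bar> * \<bar>vandermonde n (\<lambda>i. q ^ ?a i)\<bar>"
    by (subst prod_offdiagonal) (auto simp: vandermonde_def abs_prod abs_minus_commute)
  finally show ?thesis using tot by (simp add: mult_ac)
qed

section \<open>Weights and determinantal ensembles\<close>

lemma two_choose_two: "2 * (a choose 2) = a * (a - 1)"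
  by (simp add: choose_two) (cases a, simp_all)

lemma q_binomial_pos:
  assumes "q > 0" "q \<noteq> 1"
  shows "q_binomial q N a > 0"
  unfolding q_binomial_def using q_fact_pos[OF assms] by simp

lemma weight_W_pos:
  assumes "q > 0" "q \<noteq> 1"
  shows "weight_W n k q a > 0"
  unfolding weight_W_def using q_binomial_pos[OF assms] assms by simp

lemma weight_W_hat_pos:
  assumes "q > 0" "q \<noteq> 1"
  shows "weight_W_hat n k q a > 0"
  unfolding weight_W_hat_def using q_binomial_pos[OF assms] assms by simp

text \<open>The \<open>q\<close>-binomial coefficient is the reciprocal of the two factorials in
\<open>prod_distance\<close>; the power \<open>q ^ (2 a (n - 1))\<close> comes from passing from \<open>q ^
a\<close> to \<open>q ^ (- a)\<close> in the squared Vandermonde product.\<close>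

lemma weight_W_via_distances:
  assumes q: "q > 0" "q \<noteq> 1" and "n \<ge> 1" and a: "a < n + k"
  shows "weight_W n k q a * (\<Prod>c\<in>{..<n + k} - {a}. \<bar>q ^ a - q ^ c\<bar>) =
    \<bar>1 - q\<bar> ^ (n + k - 1) * q_fact q (n + k - 1) * ((q ^ a) ^ (n - 1) * (q ^ a) ^ (n - 1))"
proof -
  let ?N = "n + k - 1"
  have N: "n + k = Suc ?N" "a \<le> ?N" using assms by auto
  have choose2: "2 * (int (a choose 2)) = int a * (int a - 1)"
    using two_choose_two[of a] by (cases a) (simp_all flip: of_nat_mult of_nat_add add: algebra_simps)
  have ex: "int (a choose 2) + int a * (int n - int k) + int ((a choose 2) + a * (?N - a)) =
      int (a * (n - 1) + a * (n - 1))"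
  proof -
    have "int (?N - a) = int n + int k - 1 - int a" "int (n - 1) = int n - 1"
      using assms N by (auto simp: of_nat_diff)
    then show ?thesis using choose2 by (simp only: of_nat_add of_nat_mult) (simp add: algebra_simps)
  qed
  have "q powi (int (a choose 2) + int a * (int n - int k)) * q ^ ((a choose 2) + a * (?N - a)) =
      q powi (int (a choose 2) + int a * (int n - int k) + int ((a choose 2) + a * (?N - a)))"
    unfolding power_int_of_nat[symmetric] using q by (subst power_int_add) simp_all
  also have "\<dots> = (q ^ a) ^ (n - 1) * (q ^ a) ^ (n - 1)"
    unfolding ex power_int_of_nat by (simp add: power_add power_mult)
  finally have pw: "q powi (int (a choose 2) + int a * (int n - int k)) * q ^ ((a choose 2) + a * (?N - a)) =
    (q ^ a) ^ (n - 1) * (q ^ a) ^ (n - 1)" .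
  have bin: "q_binomial q ?N a * (q_fact q a * q_fact q (?N - a)) = q_fact q ?N"
    using q_fact_pos[OF q, of a] q_fact_pos[OF q, of "?N - a"] by (simp add: q_binomial_def)
  have "weight_W n k q a * (\<Prod>c\<in>{..<Suc ?N} - {a}. \<bar>q ^ a - q ^ c\<bar>) =
    \<bar>1 - q\<bar> ^ ?N * (q_binomial q ?N a * (q_fact q a * q_fact q (?N - a))) *
    (q powi (int (a choose 2) + int a * (int n - int k)) * q ^ ((a choose 2) + a * (?N - a)))"
    unfolding prod_distance[OF q N(2)] weight_W_def by (simp only: mult_ac)
  then show ?thesis unfolding bin pw N(1)[symmetric] .
qed

lemma weight_W_hat_eq:
  assumes "q > 0" "k \<ge> 1"
  shows "weight_W_hat n k q a = weight_W n k q a * (q ^ a) ^ (k - 1)"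
proof -
  have "int (a * (k - 1)) = int a * (int k - 1)"
    using assms by (simp add: of_nat_diff)
  then have k1: "(q ^ a) ^ (k - 1) = q powi (int a * (int k - 1))"
    by (metis power_int_of_nat power_mult)
  have "int (a choose 2) + int a * (int n - 1) =
      int (a choose 2) + int a * (int n - int k) + int a * (int k - 1)" by (simp add: algebra_simps)
  then have "q powi (int (a choose 2) + int a * (int n - 1)) =
      q powi (int (a choose 2) + int a * (int n - int k)) * q powi (int a * (int k - 1))"
    using assms by (simp only:) (rule power_int_add, simp)
  then show ?thesis
    unfolding weight_W_hat_def weight_W_def k1 by (simp only: mult_ac)
qed

text \<open>Combine \<open>vandermonde_holes\<close>, which gives the squared Vandermonde product of the
\<open>q ^ a\<close> over the distances, with the passage to \<open>q ^ (- a)\<close>.\<close>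

lemma vandermonde_pair_weight_W:
  assumes q: "q > 0" "q \<noteq> 1" and n: "n \<ge> 1"
  obtains C where "\<And>lam. lam \<in> diagrams n k \<Longrightarrow>
    \<bar>vandermonde n (\<lambda>i. q ^ particle n lam i)\<bar> * \<bar>vandermonde k (\<lambda>j. q ^ holes k lam j)\<bar> =
    C * (\<Prod>i<n. weight_W n k q (particle n lam i)) * (vandermonde n (\<lambda>i. q powi (- int (particle n lam i))))\<^sup>2"
proof -
  define c where "c = \<bar>1 - q\<bar> ^ (n + k - 1) * q_fact q (n + k - 1)"
  define v where "v = \<bar>vandermonde (n + k) (\<lambda>i. q ^ i)\<bar>"
  have c: "c > 0" using q q_fact_pos[OF q] by (simp add: c_def)
  have "\<bar>vandermonde n (\<lambda>i. q ^ particle n lam i)\<bar> * \<bar>vandermonde k (\<lambda>j. q ^ holes k lam j)\<bar> =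
    v / c ^ n * (\<Prod>i<n. weight_W n k q (particle n lam i)) * (vandermonde n (\<lambda>i. q powi (- int (particle n lam i))))\<^sup>2"
    if lam: "lam \<in> diagrams n k" for lam
  proof -
    let ?a = "particle n lam"
    define D where "D = (\<Prod>i<n. \<Prod>c\<in>{..<n + k} - {?a i}. \<bar>q ^ ?a i - q ^ c\<bar>)"
    define X where "X = \<bar>vandermonde n (\<lambda>i. q powi (- int (?a i)))\<bar>"
    define Q where "Q = (\<Prod>i<n. (q ^ ?a i) ^ (n - 1))"
    have "D > 0" unfolding D_def using power_inj_pos[OF q] by (intro prod_pos) fastforce
    have "(\<Prod>i<n. weight_W n k q (?a i)) * D = (\<Prod>i<n. c * ((q ^ ?a i) ^ (n - 1) * (q ^ ?a i) ^ (n - 1)))"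
      unfolding D_def prod.distrib[symmetric]
      using weight_W_via_distances[OF q n particle_less[OF lam]] by (intro prod.cong) (auto simp: c_def)
    then have W: "(\<Prod>i<n. weight_W n k q (?a i)) * D = c ^ n * (Q * Q)"
      by (simp add: prod.distrib Q_def)
    have "(\<lambda>i. q powi (- int (?a i))) = (\<lambda>i. inverse (q ^ ?a i))"
      by (simp add: power_int_minus)
    then have V: "\<bar>vandermonde n (\<lambda>i. q ^ ?a i)\<bar> = X * Q"
      unfolding X_def Q_def by (simp only:) (rule abs_vandermonde_inverse, use q in simp)
    have H: "\<bar>vandermonde k (\<lambda>j. q ^ holes k lam j)\<bar> * D = X * Q * v"
      using vandermonde_holes[OF q lam] by (simp only: D_def V v_def)
    have "(X * Q * \<bar>vandermonde k (\<lambda>j. q ^ holes k lam j)\<bar>) * (D * c ^ n) = (v * (\<Prod>i<n. weight_W n k q (?a i)) * X\<^sup>2) * D"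
    proof -
      have "(X * Q * \<bar>vandermonde k (\<lambda>j. q ^ holes k lam j)\<bar>) * (D * c ^ n) = X * Q * (\<bar>vandermonde k (\<lambda>j. q ^ holes k lam j)\<bar> * D) * c ^ n"
        by (simp only: mult_ac)
      also have "\<dots> = v * X\<^sup>2 * (c ^ n * (Q * Q))" unfolding H power2_eq_square by (simp only: mult_ac)
      also have "\<dots> = (v * (\<Prod>i<n. weight_W n k q (?a i)) * X\<^sup>2) * D" unfolding W[symmetric] by (simp only: mult_ac)
      finally show ?thesis .
    qed
    then have "X * Q * \<bar>vandermonde k (\<lambda>j. q ^ holes k lam j)\<bar> = v / c ^ n * (\<Prod>i<n. weight_W n k q (?a i)) * X\<^sup>2"
      using \<open>D > 0\<close> c by (simp add: field_simps)
    then show ?thesis by (simp add: V X_def)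
  qed
  then show ?thesis by (rule that)
qed

text \<open>Inverting the powers at the holes costs \<open>\<Prod>j. (q ^ b j) ^ (k - 1)\<close>. Since
particles and holes together exhaust \<open>{0..<n + k}\<close>, this is a constant divided by the same
product over the particles, which is the extra factor in the second weight.\<close>

lemma vandermonde_pair_weight_W_hat:
  assumes q: "q > 0" "q \<noteq> 1" and n: "n \<ge> 1" and k: "k \<ge> 1"
  obtains C where "\<And>lam. lam \<in> diagrams n k \<Longrightarrow>
    \<bar>vandermonde n (\<lambda>i. q ^ particle n lam i)\<bar> * \<bar>vandermonde k (\<lambda>j. (1 / q) ^ holes k lam j)\<bar> =
    C * (\<Prod>i<n. weight_W_hat n k q (particle n lam i)) * (vandermonde n (\<lambda>i. q powi (- int (particle n lam i))))\<^sup>2"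
proof -
  obtain C where C: "\<And>lam. lam \<in> diagrams n k \<Longrightarrow>
    \<bar>vandermonde n (\<lambda>i. q ^ particle n lam i)\<bar> * \<bar>vandermonde k (\<lambda>j. q ^ holes k lam j)\<bar> =
    C * (\<Prod>i<n. weight_W n k q (particle n lam i)) * (vandermonde n (\<lambda>i. q powi (- int (particle n lam i))))\<^sup>2"
    using vandermonde_pair_weight_W[OF q n] by blast
  define T where "T = (\<Prod>c<n + k. (q ^ c) ^ (k - 1))"
  have "\<bar>vandermonde n (\<lambda>i. q ^ particle n lam i)\<bar> * \<bar>vandermonde k (\<lambda>j. (1 / q) ^ holes k lam j)\<bar> =
    C / T * (\<Prod>i<n. weight_W_hat n k q (particle n lam i)) * (vandermonde n (\<lambda>i. q powi (- int (particle n lam i))))\<^sup>2"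
    if lam: "lam \<in> diagrams n k" for lam
  proof -
    let ?a = "particle n lam" and ?b = "holes k lam"
    define A where "A = (\<Prod>i<n. (q ^ ?a i) ^ (k - 1))"
    define B where "B = (\<Prod>j<k. (q ^ ?b j) ^ (k - 1))"
    have pos: "A > 0" "B > 0" "T > 0" using q by (auto simp: A_def B_def T_def intro!: prod_pos)
    have "T = (\<Prod>c<n + k. (q ^ particle_hole n k lam c) ^ (k - 1))"
      unfolding T_def
      using prod.permute[OF particle_hole_permutes[OF lam], of "\<lambda>c. (q ^ c) ^ (k - 1)"]
      by (simp add: atLeast0LessThan comp_def)
    also have "\<dots> = (\<Prod>c<n. (q ^ particle_hole n k lam c) ^ (k - 1)) * (\<Prod>j<k. (q ^ particle_hole n k lam (n + j)) ^ (k - 1))"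
    proof -
      have "(\<Prod>l<n + m. f l) = (\<Prod>r<n. f r) * (\<Prod>l<m. f (n + l))" for m and f :: "nat \<Rightarrow> real"
        by (induction m) (simp_all add: mult_ac)
      then show ?thesis by blast
    qed
    also have "\<dots> = A * B"
      unfolding A_def B_def by (auto simp: particle_hole_def)
    finally have T: "T = A * B" .
    have W: "(\<Prod>i<n. weight_W_hat n k q (?a i)) = (\<Prod>i<n. weight_W n k q (?a i)) * A"
      using q k by (simp add: weight_W_hat_eq prod.distrib A_def)
    have "(\<lambda>j. (1 / q) ^ ?b j) = (\<lambda>j. inverse (q ^ ?b j))" by (simp add: power_divide inverse_eq_divide)
    then have "\<bar>vandermonde k (\<lambda>j. q ^ ?b j)\<bar> = \<bar>vandermonde k (\<lambda>j. (1 / q) ^ ?b j)\<bar> * B"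
      unfolding B_def by (simp only:) (rule abs_vandermonde_inverse, use q in simp)
    then have "\<bar>vandermonde n (\<lambda>i. q ^ ?a i)\<bar> * \<bar>vandermonde k (\<lambda>j. (1 / q) ^ ?b j)\<bar> * B =
      C * (\<Prod>i<n. weight_W n k q (?a i)) * (vandermonde n (\<lambda>i. q powi (- int (?a i))))\<^sup>2"
      using C[OF lam] by (simp add: mult_ac)
    then show ?thesis unfolding W T using pos by (simp add: field_simps)
  qed
  then show ?thesis by (rule that)
qed

text \<open>The kernel matrix is \<open>M\<close> times its transpose.\<close>

lemma ensemble_det_square:
  assumes w: "\<And>c. w c > 0"
  shows "ensemble_det n q w K lam =
    (det (mat n n (\<lambda>(i, l). sqrt (w (particle n lam i)) * poly (K l) (q powi (- int (particle n lam i))))))\<^sup>2"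
proof -
  let ?a = "particle n lam"
  let ?M = "mat n n (\<lambda>(i, l). sqrt (w (?a i)) * poly (K l) (q powi (- int (?a i))))"
  have "mat n n (\<lambda>(i, j). sqrt (w (?a i) * w (?a j)) *
         (\<Sum>l<n. poly (K l) (q powi (- int (?a i))) * poly (K l) (q powi (- int (?a j))))) = ?M * transpose_mat ?M"
    using w by (intro eq_matI)
      (auto simp: scalar_prod_def atLeast0LessThan sum_distrib_left real_sqrt_mult mult_ac intro!: sum.cong)
  then show ?thesis unfolding ensemble_det_def Let_def
    using det_mult[of ?M n "transpose_mat ?M"] det_transpose[of ?M n] by (simp add: power2_eq_square)
qed

lemma ensemble_det_vandermonde:
  assumes w: "\<And>c. w c > 0" and deg: "\<And>l. l < n \<Longrightarrow> degree (K l) = l"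
  shows "ensemble_det n q w K lam =
    (\<Prod>l<n. lead_coeff (K l))\<^sup>2 * (\<Prod>i<n. w (particle n lam i)) * (vandermonde n (\<lambda>i. q powi (- int (particle n lam i))))\<^sup>2"
proof -
  let ?a = "particle n lam"
  let ?P = "mat n n (\<lambda>(i, l). poly (K l) (q powi (- int (?a i))))"
  let ?S = "mat_diag n (\<lambda>i. sqrt (w (?a i)))"
  have "mat n n (\<lambda>(i, l). sqrt (w (?a i)) * poly (K l) (q powi (- int (?a i)))) = ?S * ?P"
    by (subst mat_diag_mult_left[of _ n n]) auto
  moreover have "det ?S = (\<Prod>i<n. sqrt (w (?a i)))"
    by (subst det_lower_triangular[of n])
      (auto simp: mat_diag_def prod_list_diag_prod atLeast0LessThan)
  moreover have "det ?P = vandermonde n (\<lambda>i. q powi (- int (?a i))) * (\<Prod>l<n. lead_coeff (K l))"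
    using det_poly_eval[of n K "\<lambda>i. q powi (- int (?a i))"] deg by (simp add: det_vandermonde)
  moreover have "(\<Prod>i<n. sqrt (w (?a i)))\<^sup>2 = (\<Prod>i<n. w (?a i))"
    using w by (simp add: prod_power_distrib less_imp_le)
  ultimately show ?thesis
    unfolding ensemble_det_square[OF w] using det_mult[of ?S n ?P]
    by (simp add: power_mult_distrib mult_ac)
qed

text \<open>By Cauchy-Binet the sum of the squared minors is the determinant of the Gram matrix, which is the
identity.\<close>

lemma ensemble_det_total:
  assumes w: "\<And>c. w c > 0"
    and orth: "\<And>j l. j < n \<Longrightarrow> l < n \<Longrightarrow>
      (\<Sum>c<n + k. w c * poly (K j) (q powi (- int c)) * poly (K l) (q powi (- int c))) = (if j = l then 1 else 0)"
  shows "(\<Sum>lam\<in>diagrams n k. ensemble_det n q w K lam) = 1"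
proof -
  let ?A = "\<lambda>l c. sqrt (w c) * poly (K l) (q powi (- int c))"
  have "det (mat n n (\<lambda>(i, j). \<Sum>c = 0..<n + k. ?A i c * ?A j c)) =
    (\<Sum>lam\<in>diagrams n k. det (mat n n (\<lambda>(i, j). ?A i (particle n lam j))) *
       det (mat n n (\<lambda>(i, j). ?A j (particle n lam i))))"
    by (rule cauchy_binet)
  also have "\<dots> = (\<Sum>lam\<in>diagrams n k. ensemble_det n q w K lam)"
  proof (rule sum.cong[OF refl])
    fix lam
    let ?M = "mat n n (\<lambda>(i, j). ?A j (particle n lam i))"
    have "mat n n (\<lambda>(i, j). ?A i (particle n lam j)) = transpose_mat ?M" by (rule eq_matI) auto
    then show "det (mat n n (\<lambda>(i, j). ?A i (particle n lam j))) * det ?M = ensemble_det n q w K lam"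
      unfolding ensemble_det_square[OF w] using det_transpose[of ?M n] by (simp add: power2_eq_square)
  qed
  also have "mat n n (\<lambda>(i, j). \<Sum>c = 0..<n + k. ?A i c * ?A j c) = 1\<^sub>m n"
  proof (rule eq_matI)
    fix i j assume "i < dim_row (1\<^sub>m n :: real mat)" "j < dim_col (1\<^sub>m n :: real mat)"
    then have ij: "i < n" "j < n" by auto
    have "(\<Sum>c = 0..<n + k. ?A i c * ?A j c) = (\<Sum>c<n + k. w c * poly (K i) (q powi (- int c)) * poly (K j) (q powi (- int c)))"
      unfolding atLeast0LessThan
    proof (rule sum.cong[OF refl])
      fix c
      have "?A i c * ?A j c = (sqrt (w c) * sqrt (w c)) * poly (K i) (q powi (- int c)) * poly (K j) (q powi (- int c))"
        by (simp only: mult_ac)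
      then show "?A i c * ?A j c = w c * poly (K i) (q powi (- int c)) * poly (K j) (q powi (- int c))"
        using w[of c] by simp
    qed
    then show "mat n n (\<lambda>(i, j). \<Sum>c = 0..<n + k. ?A i c * ?A j c) $$ (i, j) = 1\<^sub>m n $$ (i, j)"
      using ij orth by simp
  qed auto
  finally show ?thesis by simp
qed

text \<open>Two proportional functions with the same nonzero sum are equal. The factor \<open>L\<close> is
nonzero because the determinants sum to 1; the degree condition alone would admit \<open>K 0 =
0\<close>.\<close>

lemma ensemble_det_unique:
  assumes w: "\<And>c. w c > 0"
    and deg: "\<And>l. l < n \<Longrightarrow> degree (K l) = l"
    and orth: "\<And>j l. j < n \<Longrightarrow> l < n \<Longrightarrow>
      (\<Sum>c<n + k. w c * poly (K j) (q powi (- int c)) * poly (K l) (q powi (- int c))) = (if j = l then 1 else 0)"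
    and total: "(\<Sum>lam\<in>diagrams n k. f lam) = 1"
    and form: "\<And>lam. lam \<in> diagrams n k \<Longrightarrow>
      f lam = C * (\<Prod>i<n. w (particle n lam i)) * (vandermonde n (\<lambda>i. q powi (- int (particle n lam i))))\<^sup>2"
    and lam: "lam \<in> diagrams n k"
  shows "f lam = ensemble_det n q w K lam"
proof -
  define L where "L = (\<Prod>l<n. lead_coeff (K l))\<^sup>2"
  have ens: "ensemble_det n q w K lam = L * (\<Prod>i<n. w (particle n lam i)) * (vandermonde n (\<lambda>i. q powi (- int (particle n lam i))))\<^sup>2" for lam
    using ensemble_det_vandermonde[OF w deg] by (simp add: L_def)
  have "L * f lam = C * ensemble_det n q w K lam" if "lam \<in> diagrams n k" for lam
    unfolding form[OF that] ens by simp
  moreover from this have "(\<Sum>lam\<in>diagrams n k. L * f lam) = (\<Sum>lam\<in>diagrams n k. C * ensemble_det n q w K lam)"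
    by (rule sum.cong[OF refl])
  then have "L = C" using total ensemble_det_total[OF w orth] by (simp add: sum_distrib_left[symmetric])
  moreover have "L \<noteq> 0"
  proof
    assume "L = 0"
    then have "ensemble_det n q w K lam = 0" for lam by (simp add: ens)
    then show False using ensemble_det_total[OF w orth] by simp
  qed
  ultimately show ?thesis using lam by simp
qed

lemma q_Krawtchouk_orthogonality:
  assumes K: "normalized_q_Krawtchouk p (n + k - 1) q K" and n: "n \<ge> 1" and k: "k \<ge> 1"
    and w: "\<And>c. q_binomial q (n + k - 1) c * p powi (- int c) *
      q powi (int (c choose 2) - int c * int (n + k - 1)) = w c"
    and jl: "j < n" "l < n"
  shows "(\<Sum>c<n + k. w c * poly (K j) (q powi (- int c)) * poly (K l) (q powi (- int c))) = (if j = l then 1 else 0)"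
proof -
  have jl': "j \<le> n + k - 1" "l \<le> n + k - 1" using jl by auto
  have "{..n + k - 1} = {..<n + k}" using n by auto
  then show ?thesis using K jl' unfolding normalized_q_Krawtchouk_def w by simp
qed

section \<open>Principal specialization and the two Krawtchouk ensembles\<close>

text \<open>Subtracting a simple root from \<open>\<nu>\<close> raises the exponent of \<open>q\<close> in
\<open>q^(\<Sum>j. j * \<nu> j)\<close> by one; this is why \<open>dim_q\<close> counts by the sum of the
coordinates \<open>u\<close>.\<close>

lemma simple_root_pairing:
  assumes "i < m - 1"
  shows "(\<Sum>j<m. int j * simple_root i j) = - 1"
proof -
  have "(\<Sum>j<m. int j * simple_root i j) = (\<Sum>j\<in>{i, Suc i}. int j * simple_root i j)"
    using assms by (intro sum.mono_neutral_right) (auto simp: simple_root_def)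
  then show ?thesis by (simp add: simple_root_def)
qed

lemma sum_simple_roots:
  assumes "j < m"
  shows "(\<Sum>i<m - 1. a i * simple_root i j) = (if j < m - 1 then a j else 0) - (if j = 0 then 0 else a (j - 1))"
proof -
  have "(\<Sum>i<m - 1. a i * simple_root i j) =
      (\<Sum>i<m - 1. (if i = j then a j else 0) - (if j \<noteq> 0 \<and> i = j - 1 then a (j - 1) else 0))"
    by (intro sum.cong refl) (auto simp: simple_root_def)
  also have "\<dots> = (\<Sum>i<m - 1. if i = j then a j else 0) - (\<Sum>i<m - 1. if i = j - 1 then (if j \<noteq> 0 then a (j - 1) else 0) else 0)"
    unfolding sum_subtractf by (intro arg_cong2[of _ _ _ _ "(-)"] sum.cong refl) auto
  also have "\<dots> = (if j < m - 1 then a j else 0) - (if j = 0 then 0 else a (j - 1))"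
    using assms by (subst (1 2) sum.delta) auto
  finally show ?thesis .
qed

context dominant_gl_irrep
begin

definition root_weight :: "nat list \<Rightarrow> nat \<Rightarrow> int" where
  "root_weight u j = int (mu ! j) - (\<Sum>i<m - 1. int (u ! i) * simple_root i j)"

text \<open>The coordinates of \<open>mu - \<kappa>\<close> in the simple roots are its partial sums.\<close>

definition root_coords :: "(nat \<Rightarrow> nat) \<Rightarrow> nat list" where
  "root_coords \<kappa> = map (\<lambda>r. nat (\<Sum>j\<le>r. int (mu ! j) - int (\<kappa> j))) [0..<m - 1]"

text \<open>Consecutive partial sums differ by \<open>mu ! j - \<kappa> j\<close>. They are nonnegative by
dominance, so that the truncation to naturals is harmless, and the last one is zero because the totals
agree.\<close>

lemma root_weight_coords:
  assumes \<kappa>: "\<kappa> \<in> wts" and j: "j < m"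
  shows "root_weight (root_coords \<kappa>) j = int (\<kappa> j)"
proof -
  define D where "D = (\<lambda>r. \<Sum>j\<le>r. int (mu ! j) - int (\<kappa> j))"
  have total: "(\<Sum>j<m. int (mu ! j) - int (\<kappa> j)) = 0"
    using wts_same_total[OF \<kappa>] by (simp add: sum_subtractf flip: of_nat_sum)
  have nonneg: "D r \<ge> 0" if "r < m" for r
  proof -
    have "(\<Sum>i<m. (if r < i then 1 else 0) * mu ! i) \<le> (\<Sum>i<m. (if r < i then 1 else 0) * \<kappa> i)"
      by (rule wts_dominated[OF \<kappa>]) auto
    moreover have "(\<Sum>i<m. (if r < i then 1 else 0) * f i) = (\<Sum>i\<in>{r<..<m}. f i)" for f :: "nat \<Rightarrow> nat"
      by (rule sum.mono_neutral_cong_right) auto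
    ultimately have "(\<Sum>i\<in>{r<..<m}. mu ! i) \<le> (\<Sum>i\<in>{r<..<m}. \<kappa> i)" by simp
    then have "int (\<Sum>i\<in>{r<..<m}. mu ! i) \<le> int (\<Sum>i\<in>{r<..<m}. \<kappa> i)" by (simp only: of_nat_le_iff)
    then have "(\<Sum>i\<in>{r<..<m}. int (mu ! i) - int (\<kappa> i)) \<le> 0" by (simp add: sum_subtractf)
    moreover have "(\<Sum>j<m. int (mu ! j) - int (\<kappa> j)) = D r + (\<Sum>i\<in>{r<..<m}. int (mu ! i) - int (\<kappa> i))"
    proof -
      have split: "{..<m} = {..r} \<union> {r<..<m}" using that by auto
      show ?thesis unfolding D_def split by (rule sum.union_disjoint) auto
    qed
    ultimately show ?thesis using total by linarith
  qed
  have Dlast: "D (m - 1) = 0"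
  proof -
    have "{..m - 1} = {..<m}" using j by auto
    then show ?thesis using total by (simp add: D_def)
  qed
  have "(\<Sum>i<m - 1. int (root_coords \<kappa> ! i) * simple_root i j) = (\<Sum>i<m - 1. D i * simple_root i j)"
    using nonneg by (intro sum.cong refl) (simp add: root_coords_def D_def)
  also have "\<dots> = (if j < m - 1 then D j else 0) - (if j = 0 then 0 else D (j - 1))"
    by (rule sum_simple_roots[OF j])
  also have "(if j < m - 1 then D j else 0) = D j"
  proof (cases "j < m - 1")
    case False
    then have "j = m - 1" using j by simp
    then show ?thesis using Dlast by simp
  qed simp
  also have "D j - (if j = 0 then 0 else D (j - 1)) = int (mu ! j) - int (\<kappa> j)"
    by (cases j) (simp_all add: D_def)
  finally show ?thesis by (simp add: root_weight_def)
qed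

lemma root_coords_unique:
  assumes u: "length u = m - 1" and eq: "\<And>j. j < m \<Longrightarrow> root_weight u j = int (\<kappa> j)"
  shows "u = root_coords \<kappa>"
proof (rule nth_equalityI)
  show "length u = length (root_coords \<kappa>)" using u by (simp add: root_coords_def)
  fix r assume "r < length u"
  then have r: "r < m - 1" using u by simp
  have "(\<Sum>j\<le>r. int (mu ! j) - int (\<kappa> j)) = (\<Sum>j\<le>r. int (u ! j) - (if j = 0 then 0 else int (u ! (j - 1))))"
  proof (intro sum.cong refl)
    fix j assume "j \<in> {..r}"
    then have j: "j < m" "j < m - 1" using r by auto
    show "int (mu ! j) - int (\<kappa> j) = int (u ! j) - (if j = 0 then 0 else int (u ! (j - 1)))"
      using eq[OF j(1)] sum_simple_roots[OF j(1), of "\<lambda>i. int (u ! i)"] j by (simp add: root_weight_def)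
  qed
  also have "\<dots> = int (u ! r)" by (induction r) auto
  finally show "u ! r = root_coords \<kappa> ! r" using r by (simp add: root_coords_def)
qed

lemma root_coords_exponent:
  assumes \<kappa>: "\<kappa> \<in> wts" and len: "length mu = m"
  shows "diagram_norm mu + sum_list (root_coords \<kappa>) = (\<Sum>i<m. i * \<kappa> i)"
proof -
  let ?u = "root_coords \<kappa>"
  have "int (\<Sum>i<m. i * \<kappa> i) = (\<Sum>j<m. int j * root_weight ?u j)"
    by (simp add: root_weight_coords[OF \<kappa>])
  also have "\<dots> = (\<Sum>j<m. int j * int (mu ! j)) - (\<Sum>j<m. \<Sum>i<m - 1. int (?u ! i) * (int j * simple_root i j))"
    by (simp add: root_weight_def right_diff_distrib sum_subtractf sum_distrib_left mult_ac)
  also have "(\<Sum>j<m. \<Sum>i<m - 1. int (?u ! i) * (int j * simple_root i j)) =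
      (\<Sum>i<m - 1. int (?u ! i) * (\<Sum>j<m. int j * simple_root i j))"
    unfolding sum_distrib_left by (rule sum.swap)
  also have "\<dots> = (\<Sum>i<m - 1. - int (?u ! i))"
    by (intro sum.cong refl) (simp add: simple_root_pairing)
  also have "\<dots> = - int (sum_list ?u)"
    by (simp add: sum_negf sum_list_sum_nth root_coords_def atLeast0LessThan)
  also have "(\<Sum>j<m. int j * int (mu ! j)) = int (diagram_norm mu)" by (simp add: diagram_norm_def len)
  finally show ?thesis by linarith
qed

text \<open>The sum defining \<open>dim_q\<close> runs over the root coordinates of the weights, so after
multiplication by \<open>q\<close> to the norm it is the character at \<open>diag(1, q, ..., q^(m-1))\<close>.
At this point both alternants in the Weyl formula are transposed Vandermonde determinants. The absolute values
remove the sign caused by the decreasing order of the staircase.\<close>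

theorem dim_q_eq_vandermonde:
  assumes q: "q > 0" "q \<noteq> (1 :: real)" and len: "length mu = m"
  shows "q ^ diagram_norm mu * dim_q m mu (d, rho) q =
    \<bar>vandermonde m (\<lambda>i. q ^ particle m mu i)\<bar> / \<bar>vandermonde m (\<lambda>i. q ^ i)\<bar>"
proof -
  define summand where "summand = (\<lambda>u. q ^ sum_list u * real (weight_multiplicity m (d, rho) (root_weight u)))"
  define X where "X = q ^ diagram_norm mu * dim_q m mu (d, rho) q"
  let ?S = "root_coords ` wts"
  have inj: "inj_on root_coords wts"
  proof (rule inj_onI)
    fix \<kappa> \<kappa>' assume k: "\<kappa> \<in> wts" "\<kappa>' \<in> wts" "root_coords \<kappa> = root_coords \<kappa>'"
    show "\<kappa> = \<kappa>'"
    proof (rule exponents_eqI[of _ m])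
      show "\<kappa> \<in> exponents m" "\<kappa>' \<in> exponents m" using k wts_exponents by auto
      show "\<kappa> i = \<kappa>' i" if "i < m" for i
        using root_weight_coords[OF k(1) that] root_weight_coords[OF k(2) that] k(3) by simp
    qed
  qed
  have "dim_q m mu (d, rho) q = infsum summand {u. length u = m - 1}"
  proof -
    have "root_weight u = (\<lambda>j. int (mu ! j) - (\<Sum>i<m - 1. int (u ! i) * simple_root i j))" for u
      by (simp add: root_weight_def fun_eq_iff)
    then show ?thesis by (simp only: dim_q_def summand_def)
  qed
  also have "\<dots> = infsum summand ?S"
  proof (rule infsum_cong_neutral)
    fix u assume u: "u \<in> {u. length u = m - 1} - ?S"
    have "weight_multiplicity m (d, rho) (root_weight u) = 0"
    proof (rule weight_multiplicity_zero, rule ccontr)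
      fix \<kappa> assume "\<kappa> \<in> wts" "\<not> (\<exists>i<m. root_weight u i \<noteq> int (\<kappa> i))"
      then have "u = root_coords \<kappa>" using u by (intro root_coords_unique) auto
      then show False using u \<open>\<kappa> \<in> wts\<close> by blast
    qed
    then show "summand u = 0" by (simp add: summand_def)
  next
    fix u assume "u \<in> ?S - {u. length u = m - 1}"
    then show "summand u = 0" by (auto simp: root_coords_def)
  qed simp
  also have "\<dots> = sum summand ?S" using finite_wts by simp
  also have "\<dots> = (\<Sum>\<kappa>\<in>wts. summand (root_coords \<kappa>))" using inj by (simp add: sum.reindex)
  finally have Xsum: "X = (\<Sum>\<kappa>\<in>wts. q ^ (\<Sum>i<m. i * \<kappa> i) * real (weight_multiplicity m (d, rho) (root_weight (root_coords \<kappa>))))"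
    unfolding X_def using root_coords_exponent[OF _ len]
    by (simp add: sum_distrib_left summand_def power_add[symmetric] mult.assoc[symmetric])
  then have Xpos: "X \<ge> 0" using q by (simp add: sum_nonneg)
  let ?t = "\<lambda>i. complex_of_real q ^ i"
  have Xchar: "complex_of_real X = rep_char ?t"
    unfolding Xsum of_real_sum
  proof (rule sum.cong[OF refl])
    fix \<kappa> assume \<kappa>: "\<kappa> \<in> wts"
    have "complex_of_nat (weight_multiplicity m (d, rho) (root_weight (root_coords \<kappa>))) = wmult \<kappa>"
      using weight_multiplicity_eq[OF \<kappa> root_weight_coords[OF \<kappa>]] \<kappa> by (simp add: wmult_def)
    moreover have "tpow m ?t \<kappa> = complex_of_real q ^ (\<Sum>i<m. i * \<kappa> i)"
      by (simp add: tpow_def power_sum power_mult)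
    ultimately show "complex_of_real (q ^ (\<Sum>i<m. i * \<kappa> i) * real (weight_multiplicity m (d, rho) (root_weight (root_coords \<kappa>)))) = wmult \<kappa> * tpow m ?t \<kappa>"
      by simp
  qed
  have alt: "alternant m e ?t = complex_of_real (vandermonde m (\<lambda>i. q ^ e i))" for e
  proof -
    have "mat m m (\<lambda>(i, j). ?t i ^ e j) = mat m m (\<lambda>(i, j). (complex_of_real q ^ e j) ^ i)"
      by (rule eq_matI) (auto simp: power_mult[symmetric] mult.commute)
    then have "alternant m e ?t = vandermonde m (\<lambda>i. complex_of_real q ^ e i)"
      by (simp add: alternant_det det_vandermonde_transpose)
    then show ?thesis by (simp add: vandermonde_def)
  qed
  have "complex_of_real (vandermonde m (\<lambda>i. q ^ stair m i) * X) = complex_of_real (vandermonde m (\<lambda>i. q ^ kap i))"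
    using weyl_character_formula[of ?t] unfolding alt Xchar[symmetric] by simp
  then have "vandermonde m (\<lambda>i. q ^ stair m i) * X = vandermonde m (\<lambda>i. q ^ kap i)" by (simp only: of_real_eq_iff)
  then have "\<bar>vandermonde m (\<lambda>i. q ^ stair m i)\<bar> * X = \<bar>vandermonde m (\<lambda>i. q ^ kap i)\<bar>"
    using Xpos by (metis abs_mult abs_of_nonneg)
  moreover have "vandermonde m (\<lambda>i. q ^ kap i) = vandermonde m (\<lambda>i. q ^ particle m mu i)"
    unfolding vandermonde_def by (intro prod.cong refl) (auto simp: kap_def particle_def top_weight_def stair_def)
  moreover have "\<bar>vandermonde m (\<lambda>i. q ^ stair m i)\<bar> = \<bar>vandermonde m (\<lambda>i. q ^ i)\<bar>"
  proof -
    define p where "p = (\<lambda>i. if i < m then m - 1 - i else i)"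
    have "bij_betw p {0..<m} {0..<m}"
      by (rule bij_betwI[where g = p]) (auto simp: p_def)
    then have p: "p permutes {0..<m}" by (rule bij_imp_permutes) (simp add: p_def)
    have "vandermonde m (\<lambda>i. q ^ stair m i) = vandermonde m (\<lambda>i. q ^ p i)"
      unfolding vandermonde_def by (intro prod.cong refl) (auto simp: p_def stair_def)
    then show ?thesis using abs_vandermonde_permute[OF p, of "\<lambda>i. q ^ i"] by simp
  qed
  moreover have "vandermonde m (\<lambda>i. q ^ i) \<noteq> 0"
    by (rule vandermonde_nonzero) (auto simp: inj_on_def dest: power_inj_pos[OF q])
  ultimately have "X = \<bar>vandermonde m (\<lambda>i. q ^ particle m mu i)\<bar> / \<bar>vandermonde m (\<lambda>i. q ^ i)\<bar>"
    by (simp add: field_simps)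
  then show ?thesis by (simp add: X_def)
qed

end

lemma principal_specialization:
  assumes lam: "lam \<in> diagrams m k" and R: "is_irrep_GL m lam R" and q: "q > 0" "q \<noteq> 1"
  shows "q ^ diagram_norm lam * dim_q m lam R q =
    \<bar>vandermonde m (\<lambda>i. q ^ particle m lam i)\<bar> / \<bar>vandermonde m (\<lambda>i. q ^ i)\<bar>"
proof -
  have R': "(fst R, snd R) = R" by simp
  interpret dominant_gl_irrep m "fst R" "snd R" lam
    by unfold_locales (use R diagram_nth_mono[OF lam] in \<open>auto simp: is_irrep_GL_def\<close>)
  show ?thesis using dim_q_eq_vandermonde[OF q] lam by (simp add: diagrams_def)
qed

lemma vandermonde_measure_total:
  assumes q: "q > 0" "q \<noteq> 1" and r: "r > 0" "r \<noteq> (1 :: real)"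
  shows "(\<Sum>lam\<in>diagrams n k.
     \<bar>vandermonde n (\<lambda>i. q ^ particle n lam i)\<bar> / \<bar>vandermonde n (\<lambda>i. q ^ i)\<bar> *
     (\<bar>vandermonde k (\<lambda>j. r ^ holes k lam j)\<bar> / \<bar>vandermonde k (\<lambda>j. r ^ j)\<bar>) /
     (\<Prod>i<n. \<Prod>j<k. q ^ i + r ^ j)) = 1"
proof -
  let ?c = "\<bar>vandermonde n (\<lambda>i. q ^ i)\<bar> * \<bar>vandermonde k (\<lambda>j. r ^ j)\<bar> * (\<Prod>i<n. \<Prod>j<k. q ^ i + r ^ j)"
  have v: "vandermonde n (\<lambda>i. q ^ i) \<noteq> 0" "vandermonde k (\<lambda>j. r ^ j) \<noteq> 0"
    by (rule vandermonde_nonzero; auto simp: inj_on_def dest: power_inj_pos[OF q] power_inj_pos[OF r])+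
  have "(\<Prod>i<n. \<Prod>j<k. q ^ i + r ^ j) > 0"
    using q r by (intro prod_pos ballI) (simp add: add_pos_pos)
  then have "?c > 0" using v by (intro mult_pos_pos) auto
  then have c: "?c \<noteq> 0" by linarith
  have "(\<Sum>lam\<in>diagrams n k.
     \<bar>vandermonde n (\<lambda>i. q ^ particle n lam i)\<bar> / \<bar>vandermonde n (\<lambda>i. q ^ i)\<bar> *
     (\<bar>vandermonde k (\<lambda>j. r ^ holes k lam j)\<bar> / \<bar>vandermonde k (\<lambda>j. r ^ j)\<bar>) /
     (\<Prod>i<n. \<Prod>j<k. q ^ i + r ^ j)) =
    (\<Sum>lam\<in>diagrams n k. \<bar>vandermonde n (\<lambda>i. q ^ particle n lam i)\<bar> * \<bar>vandermonde k (\<lambda>j. r ^ holes k lam j)\<bar>) / ?c"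
    unfolding sum_divide_distrib by (intro sum.cong refl) (simp add: mult_ac)
  then show ?thesis unfolding vandermonde_sum_over_diagrams[OF q r] using c by simp
qed

text \<open>With these two values of \<open>p\<close> the factor \<open>p^(-c) q^(-c N)\<close> of the
orthogonality weight becomes \<open>q^(c (n - k))\<close> and \<open>q^(c (n - 1))\<close>.\<close>

lemma krawtchouk_weights:
  assumes q: "q > 0" and n: "n \<ge> 1" and k: "k \<ge> 1"
  shows "q_binomial q (n + k - 1) c * (q powi (1 - 2 * int n)) powi (- int c) *
      q powi (int (c choose 2) - int c * int (n + k - 1)) = weight_W n k q c"
    and "q_binomial q (n + k - 1) c * (q powi (2 - 2 * int n - int k)) powi (- int c) *
      q powi (int (c choose 2) - int c * int (n + k - 1)) = weight_W_hat n k q c"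
proof -
  have N: "int (n + k - 1) = int n + int k - 1" using n by simp
  have pw: "(q powi x) powi y * q powi z = q powi (x * y + z)" for x y z
    using q by (simp add: power_int_mult power_int_add)
  have ex: "(1 - 2 * int n) * (- int c) + (int (c choose 2) - int c * int (n + k - 1)) =
      int (c choose 2) + int c * (int n - int k)"
    "(2 - 2 * int n - int k) * (- int c) + (int (c choose 2) - int c * int (n + k - 1)) =
      int (c choose 2) + int c * (int n - 1)"
    unfolding N by (simp_all add: algebra_simps)
  show "q_binomial q (n + k - 1) c * (q powi (1 - 2 * int n)) powi (- int c) *
      q powi (int (c choose 2) - int c * int (n + k - 1)) = weight_W n k q c"
    unfolding mult.assoc pw ex weight_W_def by (rule mult.commute)
  show "q_binomial q (n + k - 1) c * (q powi (2 - 2 * int n - int k)) powi (- int c) *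
      q powi (int (c choose 2) - int c * int (n + k - 1)) = weight_W_hat n k q c"
    unfolding mult.assoc pw ex weight_W_hat_def by (rule mult.commute)
qed

text \<open>The common part of the two cases, which differ in the base \<open>r\<close> used at the holes,
either \<open>q\<close> or \<open>1 / q\<close>, and in the resulting weight.\<close>

lemma krawtchouk_ensemble:
  assumes f: "\<And>lam. lam \<in> diagrams n k \<Longrightarrow> f lam =
      \<bar>vandermonde n (\<lambda>i. q ^ particle n lam i)\<bar> / \<bar>vandermonde n (\<lambda>i. q ^ i)\<bar> *
      (\<bar>vandermonde k (\<lambda>j. r ^ holes k lam j)\<bar> / \<bar>vandermonde k (\<lambda>j. r ^ j)\<bar>) / (\<Prod>i<n. \<Prod>j<k. q ^ i + r ^ j)"
    and q: "q > 0" "q \<noteq> 1" and r: "r > 0" "r \<noteq> (1 :: real)" and n: "n \<ge> 1" and k: "k \<ge> 1"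
    and pair: "\<And>lam. lam \<in> diagrams n k \<Longrightarrow>
      \<bar>vandermonde n (\<lambda>i. q ^ particle n lam i)\<bar> * \<bar>vandermonde k (\<lambda>j. r ^ holes k lam j)\<bar> =
      C * (\<Prod>i<n. w (particle n lam i)) * (vandermonde n (\<lambda>i. q powi (- int (particle n lam i))))\<^sup>2"
    and w: "\<And>c. w c > 0"
    and weights: "\<And>c. q_binomial q (n + k - 1) c * p powi (- int c) *
      q powi (int (c choose 2) - int c * int (n + k - 1)) = w c"
  shows "is_probability_on (diagrams n k) f \<and>
    (\<forall>K. normalized_q_Krawtchouk p (n + k - 1) q K \<longrightarrow>
      (\<forall>lam\<in>diagrams n k. f lam = ensemble_det n q w K lam))"
proof (intro conjI allI impI ballI)
  have total: "(\<Sum>lam\<in>diagrams n k. f lam) = 1"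
    using vandermonde_measure_total[OF q r, of n k] f by (simp cong: sum.cong)
  have "f lam \<ge> 0" if "lam \<in> diagrams n k" for lam
    unfolding f[OF that] using q r
    by (intro divide_nonneg_nonneg mult_nonneg_nonneg prod_nonneg ballI) (auto simp: add_nonneg_nonneg)
  then show "is_probability_on (diagrams n k) f"
    using total finite_diagrams by (simp add: is_probability_on_def)
  fix K lam assume K: "normalized_q_Krawtchouk p (n + k - 1) q K" and lam: "lam \<in> diagrams n k"
  define D where "D = \<bar>vandermonde n (\<lambda>i. q ^ i)\<bar> * \<bar>vandermonde k (\<lambda>j. r ^ j)\<bar> * (\<Prod>i<n. \<Prod>j<k. q ^ i + r ^ j)"
  show "f lam = ensemble_det n q w K lam"
  proof (rule ensemble_det_unique[where C = "C / D", OF w _ _ total _ lam])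
    show "degree (K l) = l" if "l < n" for l
    proof -
      have "l \<le> n + k - 1" using that k by simp
      then show ?thesis using K by (simp add: normalized_q_Krawtchouk_def)
    qed
    show "(\<Sum>c<n + k. w c * poly (K j) (q powi - int c) * poly (K l) (q powi - int c)) = (if j = l then 1 else 0)"
      if "j < n" "l < n" for j l
      by (rule q_Krawtchouk_orthogonality[OF K n k weights that])
    fix lam assume lam: "lam \<in> diagrams n k"
    have "f lam = \<bar>vandermonde n (\<lambda>i. q ^ particle n lam i)\<bar> * \<bar>vandermonde k (\<lambda>j. r ^ holes k lam j)\<bar> / D"
      unfolding f[OF lam] D_def by simp
    then show "f lam = C / D * (\<Prod>i<n. w (particle n lam i)) * (vandermonde n (\<lambda>i. q powi - int (particle n lam i)))\<^sup>2"
      unfolding pair[OF lam] by simp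
  qed
qed

theorem theorem1:
  fixes n k :: nat and q :: real and V U :: "nat list \<Rightarrow> matrix_rep"
  assumes "n \<ge> 1" "k \<ge> 1" "q > 0" "q \<noteq> 1"
    and "\<And>lam. lam \<in> diagrams n k \<Longrightarrow> is_irrep_GL n lam (V lam)"
    and "\<And>nu. nu \<in> diagrams k n \<Longrightarrow> is_irrep_GL k nu (U nu)"
  shows
    "(is_probability_on (diagrams n k) (mu_q n k V U q) \<and>
      (\<forall>K. normalized_q_Krawtchouk (q powi (1 - 2 * int n)) (n + k - 1) q K \<longrightarrow>
         (\<forall>lam\<in>diagrams n k.
            mu_q n k V U q lam = ensemble_det n q (weight_W n k q) K lam))) \<and>
     (is_probability_on (diagrams n k) (mu_q_inv n k V U q) \<and>
      (\<forall>K. normalized_q_Krawtchouk (q powi (2 - 2 * int n - int k)) (n + k - 1) q K \<longrightarrow>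
         (\<forall>lam\<in>diagrams n k.
            mu_q_inv n k V U q lam = ensemble_det n q (weight_W_hat n k q) K lam)))"
proof
  note nk = assms(1,2) and q = assms(3,4) and V = assms(5) and U = assms(6)
  have shift: "(\<Prod>i=1..a. f i) = (\<Prod>i<a. f (Suc i))" for f :: "nat \<Rightarrow> real" and a
    by (simp add: prod.atLeast1_atMost_eq)
  have s: "q ^ diagram_norm lam * dim_q n lam (V lam) q =
      \<bar>vandermonde n (\<lambda>i. q ^ particle n lam i)\<bar> / \<bar>vandermonde n (\<lambda>i. q ^ i)\<bar>" if "lam \<in> diagrams n k" for lam
    by (rule principal_specialization[OF that V[OF that] q])
  have s': "r ^ diagram_norm (dual_diagram k lam) * dim_q k (dual_diagram k lam) (U (dual_diagram k lam)) r =
      \<bar>vandermonde k (\<lambda>j. r ^ holes k lam j)\<bar> / \<bar>vandermonde k (\<lambda>j. r ^ j)\<bar>"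
    if "lam \<in> diagrams n k" "r > 0" "r \<noteq> 1" for lam r
    using dual_diagram_in_diagrams[OF that(1)] U that(2,3) by (intro principal_specialization) auto
  show "is_probability_on (diagrams n k) (mu_q n k V U q) \<and>
      (\<forall>K. normalized_q_Krawtchouk (q powi (1 - 2 * int n)) (n + k - 1) q K \<longrightarrow>
         (\<forall>lam\<in>diagrams n k. mu_q n k V U q lam = ensemble_det n q (weight_W n k q) K lam))"
  proof -
    obtain C where C: "\<And>lam. lam \<in> diagrams n k \<Longrightarrow>
      \<bar>vandermonde n (\<lambda>i. q ^ particle n lam i)\<bar> * \<bar>vandermonde k (\<lambda>j. q ^ holes k lam j)\<bar> =
      C * (\<Prod>i<n. weight_W n k q (particle n lam i)) * (vandermonde n (\<lambda>i. q powi (- int (particle n lam i))))\<^sup>2"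
      using vandermonde_pair_weight_W[OF q nk(1)] by blast
    show ?thesis
    proof (rule krawtchouk_ensemble[OF _ q q nk C weight_W_pos[OF q] krawtchouk_weights(1)[OF q(1) nk]])
      fix lam assume lam: "lam \<in> diagrams n k"
      show "mu_q n k V U q lam = \<bar>vandermonde n (\<lambda>i. q ^ particle n lam i)\<bar> / \<bar>vandermonde n (\<lambda>i. q ^ i)\<bar> *
        (\<bar>vandermonde k (\<lambda>j. q ^ holes k lam j)\<bar> / \<bar>vandermonde k (\<lambda>j. q ^ j)\<bar>) / (\<Prod>i<n. \<Prod>j<k. q ^ i + q ^ j)"
        unfolding s[OF lam, symmetric] s'[OF lam q, symmetric]
        by (simp only: mu_q_def Let_def dual_diagram_def shift diff_Suc_1)
    qed
  qed
  show "is_probability_on (diagrams n k) (mu_q_inv n k V U q) \<and>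
      (\<forall>K. normalized_q_Krawtchouk (q powi (2 - 2 * int n - int k)) (n + k - 1) q K \<longrightarrow>
         (\<forall>lam\<in>diagrams n k. mu_q_inv n k V U q lam = ensemble_det n q (weight_W_hat n k q) K lam))"
  proof -
    have r: "1 / q > 0" "1 / q \<noteq> 1" using q by auto
    obtain C where C: "\<And>lam. lam \<in> diagrams n k \<Longrightarrow>
      \<bar>vandermonde n (\<lambda>i. q ^ particle n lam i)\<bar> * \<bar>vandermonde k (\<lambda>j. (1 / q) ^ holes k lam j)\<bar> =
      C * (\<Prod>i<n. weight_W_hat n k q (particle n lam i)) * (vandermonde n (\<lambda>i. q powi (- int (particle n lam i))))\<^sup>2"
      using vandermonde_pair_weight_W_hat[OF q nk] by blast
    have inv: "q powi (- int a) = (1 / q) ^ a" "q powi (1 - int (Suc a)) = (1 / q) ^ a" for a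
      by (simp_all add: power_int_minus power_divide inverse_eq_divide)
    show ?thesis
    proof (rule krawtchouk_ensemble[OF _ q r nk C weight_W_hat_pos[OF q] krawtchouk_weights(2)[OF q(1) nk]])
      fix lam assume lam: "lam \<in> diagrams n k"
      show "mu_q_inv n k V U q lam = \<bar>vandermonde n (\<lambda>i. q ^ particle n lam i)\<bar> / \<bar>vandermonde n (\<lambda>i. q ^ i)\<bar> *
        (\<bar>vandermonde k (\<lambda>j. (1 / q) ^ holes k lam j)\<bar> / \<bar>vandermonde k (\<lambda>j. (1 / q) ^ j)\<bar>) / (\<Prod>i<n. \<Prod>j<k. q ^ i + (1 / q) ^ j)"
        unfolding s[OF lam, symmetric] s'[OF lam r, symmetric]
        by (simp only: mu_q_inv_def Let_def dual_diagram_def shift inv diff_Suc_1)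
    qed
  qed
qed

end
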